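(* Let $M$ be an elementary substructure of $\mathbb{M}$. There exist an $M$-definable normal subgroup $H$ of $G$ of finite index and a finite union $B$ of cosets of $H$ such that $A(x)\triangle B(x)\in I$.
   Context: Work in a monster model $\mathbb{M}=(G,\cdot,\ldots)$ of a complete first-order theory $T$ in a language $L$, where $(G,\cdot)$ is a group. An ideal of formulas in variables $x$ with parameters from $\mathbb{M}$ is a family closed under implication and finite disjunctions and containing the empty formula; a partial type is wide for it if it implies no formula in it, and a tuple $a$ is wide over $A$ if $\mathrm{tp}(a/A)$ is. An ideal is $\emptyset$-invariant if it is closed under automorphisms of $\mathbb{M}$; an $\emptyset$-invariant ideal $I_x$ is $S_1$ if for every $L$-formula $\psi(x,z)$ and every indiscernible sequence $(a_i)_{i\in\mathbb{N}}$ with $\psi(x,a_0)\wedge\psi(x,a_1)\in I_x$ one has $\psi(x,a_0)\in I_x$. Let $I_x$, $I_y$ be $\emptyset$-invariant $S_1$-ideals (in the single-sorted variables $x$ and $y$ ranging over $G$) consisting of the same formulas up to renaming $x$ as $y$, invariant under left and right translations by elements of $G$, and such that $G\notin I$ (we write "wide" and $X\in I$ / $X\notin I$ for definable $X\subseteq G$ without distinguishing $I_x$, $I_y$). A finite sequence of elements is $M$-independent if the type of each over $M$ and the preceding ones is wide. Let $A\subseteq G$ be $\emptyset$-definable such that $\varphi(x,y):=A(y\cdot x)$ is $I$-stable: for some $k$ there are no model $M'$ and tuple $(a_1,b_1,\ldots,a_k,b_k)$ with $(a_1,b_1,\ldots,a_k,b_k)$ or $(b_k,a_k,\ldots,b_1,a_1)$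 $M'$-independent and $\varphi(a_i,b_j)$ holding iff $i\le j$. *)

theory Defs
  imports "HOL-Algebra.Coset"
begin

unbundle cardinal_syntax

section \<open>First-order formulas with parameters\<close>

text \<open>
  Languages are one-sorted. A formula may mention parameters from the ambient structure; the
  parameter-free formulas are the formulas of the language itself. Variables are named by natural
  numbers.
\<close>

record ('f, 'r) language =
  funs :: "'f set"
  rels :: "'r set"
  farity :: "'f \<Rightarrow> nat"
  rarity :: "'r \<Rightarrow> nat"

datatype ('f, params_tm: 'a) tm =
  Var nat
| Param 'a
| Fn 'f "('f, 'a) tm list"
for map: map_tm

datatype ('f, 'r, params: 'a) fm =
  Bot
| Equal "('f, 'a) tm" "('f, 'a) tm"
| Rel 'r "('f, 'a) tm list"
| Neg "('f, 'r, 'a) fm"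
| Conj "('f, 'r, 'a) fm" "('f, 'r, 'a) fm"
| Disj "('f, 'r, 'a) fm" "('f, 'r, 'a) fm"
| Exi nat "('f, 'r, 'a) fm"
for map: map_fm

fun wf_tm :: "('f, 'r) language \<Rightarrow> ('f, 'a) tm \<Rightarrow> bool" where
  "wf_tm L (Var n) = True"
| "wf_tm L (Param a) = True"
| "wf_tm L (Fn f ts) = (f \<in> funs L \<and> length ts = farity L f \<and> (\<forall>t \<in> set ts. wf_tm L t))"

primrec wf_fm :: "('f, 'r) language \<Rightarrow> ('f, 'r, 'a) fm \<Rightarrow> bool" where
  "wf_fm L Bot = True"
| "wf_fm L (Equal s t) = (wf_tm L s \<and> wf_tm L t)"
| "wf_fm L (Rel r ts) = (r \<in> rels L \<and> length ts = rarity L r \<and> (\<forall>t \<in> set ts. wf_tm L t))"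
| "wf_fm L (Neg \<phi>) = wf_fm L \<phi>"
| "wf_fm L (Conj \<phi> \<psi>) = (wf_fm L \<phi> \<and> wf_fm L \<psi>)"
| "wf_fm L (Disj \<phi> \<psi>) = (wf_fm L \<phi> \<and> wf_fm L \<psi>)"
| "wf_fm L (Exi n \<phi>) = wf_fm L \<phi>"

fun fv_tm :: "('f, 'a) tm \<Rightarrow> nat set" where
  "fv_tm (Var n) = {n}"
| "fv_tm (Param a) = {}"
| "fv_tm (Fn f ts) = (\<Union>t \<in> set ts. fv_tm t)"

primrec fv :: "('f, 'r, 'a) fm \<Rightarrow> nat set" where
  "fv Bot = {}"
| "fv (Equal s t) = fv_tm s \<union> fv_tm t"
| "fv (Rel r ts) = (\<Union>t \<in> set ts. fv_tm t)"
| "fv (Neg \<phi>) = fv \<phi>"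
| "fv (Conj \<phi> \<psi>) = fv \<phi> \<union> fv \<psi>"
| "fv (Disj \<phi> \<psi>) = fv \<phi> \<union> fv \<psi>"
| "fv (Exi n \<phi>) = fv \<phi> - {n}"

definition formulas :: "('f, 'r) language \<Rightarrow> 'a set \<Rightarrow> nat set \<Rightarrow> ('f, 'r, 'a) fm set" where
  "formulas L A V = {\<phi>. wf_fm L \<phi> \<and> params \<phi> \<subseteq> A \<and> fv \<phi> \<subseteq> V}"

text \<open>
  \<open>inst e \<phi>\<close> plugs the parameter \<open>a\<close> into the free occurrences of the variable \<open>n\<close>
  whenever \<open>e n = Some a\<close>.
\<close>

fun inst_tm :: "(nat \<Rightarrow> 'a option) \<Rightarrow> ('f, 'a) tm \<Rightarrow> ('f, 'a) tm" where
  "inst_tm e (Var n) = (case e n of None \<Rightarrow> Var n | Some a \<Rightarrow> Param a)"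
| "inst_tm e (Param a) = Param a"
| "inst_tm e (Fn f ts) = Fn f (map (inst_tm e) ts)"

primrec inst :: "(nat \<Rightarrow> 'a option) \<Rightarrow> ('f, 'r, 'a) fm \<Rightarrow> ('f, 'r, 'a) fm" where
  "inst e Bot = Bot"
| "inst e (Equal s t) = Equal (inst_tm e s) (inst_tm e t)"
| "inst e (Rel r ts) = Rel r (map (inst_tm e) ts)"
| "inst e (Neg \<phi>) = Neg (inst e \<phi>)"
| "inst e (Conj \<phi> \<psi>) = Conj (inst e \<phi>) (inst e \<psi>)"
| "inst e (Disj \<phi> \<psi>) = Disj (inst e \<phi>) (inst e \<psi>)"
| "inst e (Exi n \<phi>) = Exi n (inst (e(n := None)) \<phi>)"

section \<open>Structures\<close>

record ('f, 'r, 'a) struct =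
  univ :: "'a set"
  fun_of :: "'f \<Rightarrow> 'a list \<Rightarrow> 'a"
  rel_of :: "'r \<Rightarrow> 'a list \<Rightarrow> bool"

definition is_structure :: "('f, 'r) language \<Rightarrow> ('f, 'r, 'a) struct \<Rightarrow> bool" where
  "is_structure L \<M> \<longleftrightarrow> univ \<M> \<noteq> {} \<and>
     (\<forall>f \<in> funs L. \<forall>as. set as \<subseteq> univ \<M> \<and> length as = farity L f \<longrightarrow> fun_of \<M> f as \<in> univ \<M>)"

fun val :: "('f, 'r, 'a) struct \<Rightarrow> (nat \<Rightarrow> 'a) \<Rightarrow> ('f, 'a) tm \<Rightarrow> 'a" where
  "val \<M> v (Var n) = v n"
| "val \<M> v (Param a) = a"
| "val \<M> v (Fn f ts) = fun_of \<M> f (map (val \<M> v) ts)"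

primrec sat :: "('f, 'r, 'a) struct \<Rightarrow> (nat \<Rightarrow> 'a) \<Rightarrow> ('f, 'r, 'a) fm \<Rightarrow> bool" where
  "sat \<M> v Bot = False"
| "sat \<M> v (Equal s t) = (val \<M> v s = val \<M> v t)"
| "sat \<M> v (Rel r ts) = rel_of \<M> r (map (val \<M> v) ts)"
| "sat \<M> v (Neg \<phi>) = (\<not> sat \<M> v \<phi>)"
| "sat \<M> v (Conj \<phi> \<psi>) = (sat \<M> v \<phi> \<and> sat \<M> v \<psi>)"
| "sat \<M> v (Disj \<phi> \<psi>) = (sat \<M> v \<phi> \<or> sat \<M> v \<psi>)"
| "sat \<M> v (Exi n \<phi>) = (\<exists>a \<in> univ \<M>. sat \<M> (v(n := a)) \<phi>)"

text \<open>
  The single-variable notions below all use the variable 0, so that a formula in one variable is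
  evaluated at \<open>g\<close> under the constant assignment \<open>\<lambda>_. g\<close>.
\<close>

definition solutions :: "('f, 'r, 'a) struct \<Rightarrow> ('f, 'r, 'a) fm \<Rightarrow> 'a set" where
  "solutions \<M> \<phi> = {g \<in> univ \<M>. sat \<M> (\<lambda>_. g) \<phi>}"

definition definable ::
    "('f, 'r) language \<Rightarrow> ('f, 'r, 'a) struct \<Rightarrow> 'a set \<Rightarrow> 'a set \<Rightarrow> bool" where
  "definable L \<M> A X \<longleftrightarrow> (\<exists>\<phi> \<in> formulas L A {0}. solutions \<M> \<phi> = X)"

definition elementary_substructure ::
    "('f, 'r) language \<Rightarrow> 'a set \<Rightarrow> ('f, 'r, 'a) struct \<Rightarrow> bool" where
  "elementary_substructure L M \<M> \<longleftrightarrow> M \<subseteq> univ \<M> \<and> is_structure L (\<M>\<lparr>univ := M\<rparr>) \<and>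
     (\<forall>\<phi> \<in> formulas L {} UNIV. \<forall>v. range v \<subseteq> M \<longrightarrow> sat (\<M>\<lparr>univ := M\<rparr>) v \<phi> = sat \<M> v \<phi>)"

definition automorphism ::
    "('f, 'r) language \<Rightarrow> ('f, 'r, 'a) struct \<Rightarrow> ('a \<Rightarrow> 'a) \<Rightarrow> bool" where
  "automorphism L \<M> \<sigma> \<longleftrightarrow> bij_betw \<sigma> (univ \<M>) (univ \<M>) \<and>
     (\<forall>f \<in> funs L. \<forall>as. set as \<subseteq> univ \<M> \<and> length as = farity L f \<longrightarrow>
        \<sigma> (fun_of \<M> f as) = fun_of \<M> f (map \<sigma> as)) \<and>
     (\<forall>r \<in> rels L. \<forall>as. set as \<subseteq> univ \<M> \<and> length as = rarity L r \<longrightarrow>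
        rel_of \<M> r (map \<sigma> as) = rel_of \<M> r as)"

definition elementary_map ::
    "('f, 'r) language \<Rightarrow> ('f, 'r, 'a) struct \<Rightarrow> 'a set \<Rightarrow> ('a \<Rightarrow> 'a) \<Rightarrow> bool" where
  "elementary_map L \<M> A h \<longleftrightarrow> A \<subseteq> univ \<M> \<and> h ` A \<subseteq> univ \<M> \<and>
     (\<forall>\<phi> \<in> formulas L {} UNIV. \<forall>v. v ` fv \<phi> \<subseteq> A \<longrightarrow> sat \<M> v \<phi> = sat \<M> (h \<circ> v) \<phi>)"

definition saturated ::
    "('f, 'r) language \<Rightarrow> ('f, 'r, 'a) struct \<Rightarrow> 'k rel \<Rightarrow> bool" where
  "saturated L \<M> \<kappa> \<longleftrightarrow> (\<forall>A p. A \<subseteq> univ \<M> \<and> |A| <o \<kappa> \<and> p \<subseteq> formulas L A {0} \<and>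
     (\<forall>p0 \<subseteq> p. finite p0 \<longrightarrow> (\<exists>g \<in> univ \<M>. \<forall>\<phi> \<in> p0. g \<in> solutions \<M> \<phi>)) \<longrightarrow>
     (\<exists>g \<in> univ \<M>. \<forall>\<phi> \<in> p. g \<in> solutions \<M> \<phi>))"

definition strongly_homogeneous ::
    "('f, 'r) language \<Rightarrow> ('f, 'r, 'a) struct \<Rightarrow> 'k rel \<Rightarrow> bool" where
  "strongly_homogeneous L \<M> \<kappa> \<longleftrightarrow> (\<forall>A h. |A| <o \<kappa> \<and> elementary_map L \<M> A h \<longrightarrow>
     (\<exists>\<sigma>. automorphism L \<M> \<sigma> \<and> (\<forall>a \<in> A. \<sigma> a = h a)))"

text \<open>
  The complete theory of which \<open>\<M>\<close> is a monster model is the theory of \<open>\<M>\<close> and is not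
  mentioned separately. The cardinal \<open>\<kappa>\<close> is only required to be an uncountable cardinal
  larger than the number of symbols, so every larger choice is covered.
\<close>

definition monster_model ::
    "('f, 'r) language \<Rightarrow> ('f, 'r, 'a) struct \<Rightarrow> 'k rel \<Rightarrow> bool" where
  "monster_model L \<M> \<kappa> \<longleftrightarrow> is_structure L \<M> \<and>
     Card_order \<kappa> \<and> natLeq <o \<kappa> \<and> |funs L| <o \<kappa> \<and> |rels L| <o \<kappa> \<and>
     saturated L \<M> \<kappa> \<and> strongly_homogeneous L \<M> \<kappa>"

section \<open>Ideals, wide types and \<open>S\<^sub>1\<close>\<close>

definition formula_ideal ::
    "('f, 'r) language \<Rightarrow> ('f, 'r, 'a) struct \<Rightarrow> ('f, 'r, 'a) fm set \<Rightarrow> bool" where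
  "formula_ideal L \<M> I \<longleftrightarrow> I \<subseteq> formulas L (univ \<M>) {0} \<and> Bot \<in> I \<and>
     (\<forall>\<phi> \<in> I. \<forall>\<psi> \<in> formulas L (univ \<M>) {0}. solutions \<M> \<psi> \<subseteq> solutions \<M> \<phi> \<longrightarrow> \<psi> \<in> I) \<and>
     (\<forall>\<phi> \<in> I. \<forall>\<psi> \<in> I. Disj \<phi> \<psi> \<in> I)"

definition invariant_ideal ::
    "('f, 'r) language \<Rightarrow> ('f, 'r, 'a) struct \<Rightarrow> ('f, 'r, 'a) fm set \<Rightarrow> bool" where
  "invariant_ideal L \<M> I \<longleftrightarrow>
     (\<forall>\<sigma>. automorphism L \<M> \<sigma> \<longrightarrow> (\<forall>\<phi> \<in> I. map_fm id id \<sigma> \<phi> \<in> I))"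

definition same_type ::
    "('f, 'r) language \<Rightarrow> ('f, 'r, 'a) struct \<Rightarrow> 'a list \<Rightarrow> 'a list \<Rightarrow> bool" where
  "same_type L \<M> c d \<longleftrightarrow> length c = length d \<and>
     (\<forall>\<phi> \<in> formulas L {} {..<length c}. sat \<M> (\<lambda>i. c ! i) \<phi> = sat \<M> (\<lambda>i. d ! i) \<phi>)"

definition indiscernible ::
    "('f, 'r) language \<Rightarrow> ('f, 'r, 'a) struct \<Rightarrow> nat \<Rightarrow> (nat \<Rightarrow> 'a list) \<Rightarrow> bool" where
  "indiscernible L \<M> m a \<longleftrightarrow> (\<forall>i. length (a i) = m \<and> set (a i) \<subseteq> univ \<M>) \<and>
     (\<forall>is js. sorted_wrt (<) is \<and> sorted_wrt (<) js \<and> length is = length js \<longrightarrow>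
        same_type L \<M> (concat (map a is)) (concat (map a js)))"

text \<open>
  In \<open>\<psi>(x, z)\<close> the variable \<open>x\<close> is 0 and \<open>z\<close> is the tuple of variables \<open>1, \<dots>, m\<close>.
\<close>

definition inst_tuple :: "('f, 'r, 'a) fm \<Rightarrow> 'a list \<Rightarrow> ('f, 'r, 'a) fm" where
  "inst_tuple \<psi> c = inst (\<lambda>n. if 1 \<le> n \<and> n \<le> length c then Some (c ! (n - 1)) else None) \<psi>"

definition S1_ideal ::
    "('f, 'r) language \<Rightarrow> ('f, 'r, 'a) struct \<Rightarrow> ('f, 'r, 'a) fm set \<Rightarrow> bool" where
  "S1_ideal L \<M> I \<longleftrightarrow> (\<forall>m. \<forall>\<psi> \<in> formulas L {} {0..m}. \<forall>a. indiscernible L \<M> m a \<and>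
     Conj (inst_tuple \<psi> (a 0)) (inst_tuple \<psi> (a 1)) \<in> I \<longrightarrow> inst_tuple \<psi> (a 0) \<in> I)"

definition translation_invariant ::
    "('f, 'r) language \<Rightarrow> ('f, 'r, 'a) struct \<Rightarrow> ('a, 'm) monoid_scheme \<Rightarrow>
     ('f, 'r, 'a) fm set \<Rightarrow> bool" where
  "translation_invariant L \<M> G I \<longleftrightarrow>
     (\<forall>\<phi> \<in> I. \<forall>g \<in> carrier G. \<forall>\<psi> \<in> formulas L (univ \<M>) {0}.
        solutions \<M> \<psi> = g <#\<^bsub>G\<^esub> solutions \<M> \<phi> \<or> solutions \<M> \<psi> = solutions \<M> \<phi> #>\<^bsub>G\<^esub> g \<longrightarrow> \<psi> \<in> I)"

definition in_ideal :: "('f, 'r, 'a) struct \<Rightarrow> ('f, 'r, 'a) fm set \<Rightarrow> 'a set \<Rightarrow> bool" where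
  "in_ideal \<M> I X \<longleftrightarrow> (\<exists>\<phi> \<in> I. solutions \<M> \<phi> = X)"

text \<open>
  A partial type implies a formula if the elementary diagram of \<open>\<M>\<close> together with the type
  entails it; by compactness this means that finitely many formulas of the type imply it in
  \<open>\<M>\<close>. In this form the notion is correct for types over parameter sets of any size.
\<close>

definition type_implies ::
    "('f, 'r, 'a) struct \<Rightarrow> ('f, 'r, 'a) fm set \<Rightarrow> ('f, 'r, 'a) fm \<Rightarrow> bool" where
  "type_implies \<M> p \<phi> \<longleftrightarrow> (\<exists>p0 \<subseteq> p. finite p0 \<and>
     (\<forall>g \<in> univ \<M>. (\<forall>\<theta> \<in> p0. g \<in> solutions \<M> \<theta>) \<longrightarrow> g \<in> solutions \<M> \<phi>))"

definition wide_type ::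
    "('f, 'r, 'a) struct \<Rightarrow> ('f, 'r, 'a) fm set \<Rightarrow> ('f, 'r, 'a) fm set \<Rightarrow> bool" where
  "wide_type \<M> I p \<longleftrightarrow> \<not> (\<exists>\<phi> \<in> I. type_implies \<M> p \<phi>)"

definition type_over ::
    "('f, 'r) language \<Rightarrow> ('f, 'r, 'a) struct \<Rightarrow> 'a set \<Rightarrow> 'a \<Rightarrow> ('f, 'r, 'a) fm set" where
  "type_over L \<M> A a = {\<phi> \<in> formulas L A {0}. a \<in> solutions \<M> \<phi>}"

definition wide_over ::
    "('f, 'r) language \<Rightarrow> ('f, 'r, 'a) struct \<Rightarrow> ('f, 'r, 'a) fm set \<Rightarrow> 'a set \<Rightarrow> 'a \<Rightarrow> bool" where
  "wide_over L \<M> I A a \<longleftrightarrow> wide_type \<M> I (type_over L \<M> A a)"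

definition independent ::
    "('f, 'r) language \<Rightarrow> ('f, 'r, 'a) struct \<Rightarrow> ('f, 'r, 'a) fm set \<Rightarrow> 'a set \<Rightarrow> 'a list \<Rightarrow> bool" where
  "independent L \<M> I M cs \<longleftrightarrow>
     (\<forall>i < length cs. wide_over L \<M> I (M \<union> set (take i cs)) (cs ! i))"

definition I_stable ::
    "('f, 'r) language \<Rightarrow> ('f, 'r, 'a) struct \<Rightarrow> ('f, 'r, 'a) fm set \<Rightarrow> ('a \<Rightarrow> 'a \<Rightarrow> bool) \<Rightarrow> bool" where
  "I_stable L \<M> I R \<longleftrightarrow> (\<exists>k. \<not> (\<exists>M a b.
     elementary_substructure L M \<M> \<and>
     (\<forall>i \<in> {1..k}. a i \<in> univ \<M> \<and> b i \<in> univ \<M>) \<and>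
     (let cs = concat (map (\<lambda>i. [a i, b i]) [1..<Suc k])
      in independent L \<M> I M cs \<or> independent L \<M> I M (rev cs)) \<and>
     (\<forall>i \<in> {1..k}. \<forall>j \<in> {1..k}. R (a i) (b j) \<longleftrightarrow> i \<le> j)))"

end

theory Submission
  imports Defs "HOL-Library.Ramsey"
begin

text \<open>
  Fix a small elementary substructure \<open>M\<close>. By \<open>S\<^sub>1\<close> and a coheir argument, a wide fibre over
  \<open>M\<close> stays wide when it is intersected with an \<open>M\<close>-conjugate over a wide extension
  (\<open>wide_amalgam\<close>). If the truth value of \<open>b \<otimes> a \<in> A\<close> at independent \<open>a\<close>, \<open>b\<close> were not determined
  by the types of \<open>a\<close> and \<open>b\<close> over \<open>M\<close>, amalgamation would produce arbitrarily long independent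
  ladders, against \<open>I\<close>-stability. So there is a separately continuous function \<open>F\<close> on pairs of
  wide types over \<open>M\<close>, and it has no long ladders. A function without long ladders has an isolated
  point up to the equivalence \<open>sim\<close> it induces. As \<open>G\<close> moves wide types transitively modulo
  \<open>sim\<close>, all classes are isolated, and by compactness there are finitely many, each of them
  \<open>M\<close>-definable. Right translations permute the classes; the kernel of this action is the
  subgroup, and modulo \<open>I\<close> the classes are unions of its cosets and \<open>A\<close> is a translate of a union
  of classes.
\<close>

section \<open>Definable relations\<close>

text \<open>Wideness is not a symmetric notion of independence: \<open>b\<close> may be wide over
  \<open>M\<close> and \<open>a\<close> although \<open>a\<close> is not wide over \<open>M\<close>
  and \<open>b\<close>. The ladders built by amalgamation alternate between the two sides, so they
  only refute a disagreement between a pair with \<open>b\<close> wide over \<open>a\<close> and a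
  pair with \<open>a\<close> wide over \<open>b\<close>; two pairs of the same orientation are
  compared through a third of the opposite one. The two possible disagreements give ladders read in
  opposite directions, which is why stability is required for both orders of the rungs. A second
  obstacle is that the translating elements lie outside \<open>M\<close>, so \<open>G\<close> acts
  on types over \<open>M\<close> only through realizations that are wide over everything in sight;
  for such \<open>a\<close> the action is governed by \<open>F a (b g) = F (g a) b\<close>. Finally,
  the model in the theorem may have any size, while saturation and homogeneity handle fewer than
  \<open>\<kappa>\<close> parameters; the argument therefore runs over a small elementary
  substructure of that model.\<close>

lemma val_cong: "(\<And>n. n \<in> fv_tm t \<Longrightarrow> v n = w n) \<Longrightarrow> val \<M> v t = val \<M> w t"
proof (induction t)
  case (Fn f ts)
  have "map (val \<M> v) ts = map (val \<M> w) ts"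
    using Fn by (intro map_cong) auto
  then show ?case by (simp only: val.simps)
qed auto

lemma sat_cong: "(\<And>n. n \<in> fv \<phi> \<Longrightarrow> v n = w n) \<Longrightarrow> sat \<M> v \<phi> = sat \<M> w \<phi>"
proof (induction \<phi> arbitrary: v w)
  case (Equal s t)
  then show ?case using val_cong[of s v w \<M>] val_cong[of t v w \<M>] by auto
next
  case (Rel r ts)
  have "map (val \<M> v) ts = map (val \<M> w) ts"
    using Rel by (intro map_cong val_cong) auto
  then show ?case by (simp only: sat.simps)
next
  case (Neg \<phi>)
  have "sat \<M> v \<phi> = sat \<M> w \<phi>" using Neg.prems by (intro Neg.IH) auto
  then show ?case by simp
next
  case (Conj \<phi>1 \<phi>2)
  have "sat \<M> v \<phi>1 = sat \<M> w \<phi>1" "sat \<M> v \<phi>2 = sat \<M> w \<phi>2"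
    using Conj.prems by (auto intro!: Conj.IH)
  then show ?case by simp
next
  case (Disj \<phi>1 \<phi>2)
  have "sat \<M> v \<phi>1 = sat \<M> w \<phi>1" "sat \<M> v \<phi>2 = sat \<M> w \<phi>2"
    using Disj.prems by (auto intro!: Disj.IH)
  then show ?case by simp
next
  case (Exi n \<phi>)
  have "sat \<M> (v(n := a)) \<phi> = sat \<M> (w(n := a)) \<phi>" for a
    using Exi.prems by (intro Exi.IH) auto
  then show ?case by simp
qed auto

lemma finite_fv_tm: "finite (fv_tm t)"
  by (induction t) auto

lemma finite_fv: "finite (fv \<phi>)"
  by (induction \<phi>) (auto simp: finite_fv_tm)

lemma finite_params_tm: "finite (params_tm t)"
  by (induction t) auto

lemma finite_params: "finite (params \<phi>)"
  by (induction \<phi>) (auto simp: finite_params_tm)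

lemma fv_tm_map: "fv_tm (map_tm f g t) = fv_tm t"
  by (induction t) auto

lemma fv_map: "fv (map_fm f r g \<phi>) = fv \<phi>"
  by (induction \<phi>) (auto simp: fv_tm_map)

section \<open>Substituting terms for variables and for parameters\<close>

fun subst_tm :: "(nat \<Rightarrow> ('f, 'a) tm) \<Rightarrow> ('b \<Rightarrow> ('f, 'a) tm) \<Rightarrow> ('f, 'b) tm \<Rightarrow> ('f, 'a) tm" where
  "subst_tm s \<pi> (Var n) = s n"
| "subst_tm s \<pi> (Param a) = \<pi> a"
| "subst_tm s \<pi> (Fn f ts) = Fn f (map (subst_tm s \<pi>) ts)"

lemma val_subst_tm:
  "val \<M> v (subst_tm s \<pi> t) = val \<M> (\<lambda>n. val \<M> v (s n)) (map_tm (\<lambda>x. x) (\<lambda>a. val \<M> v (\<pi> a)) t)"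
proof (induction t)
  case (Fn f ts)
  have "map (val \<M> v) (map (subst_tm s \<pi>) ts)
      = map (val \<M> (\<lambda>n. val \<M> v (s n))) (map (map_tm (\<lambda>x. x) (\<lambda>a. val \<M> v (\<pi> a))) ts)"
    using Fn by simp
  then show ?case by (simp only: val.simps subst_tm.simps tm.map)
qed auto

definition tm_over :: "('f, 'r) language \<Rightarrow> 'a set \<Rightarrow> ('f, 'a) tm \<Rightarrow> bool" where
  "tm_over L B t \<longleftrightarrow> wf_tm L t \<and> params_tm t \<subseteq> B"

lemma tm_over_simps [simp]:
  "tm_over L B (Var n)" "tm_over L B (Param a) \<longleftrightarrow> a \<in> B"
  by (auto simp: tm_over_def)

lemma tm_over_subst:
  assumes "wf_tm L t" "\<And>n. tm_over L B (s n)" "\<And>a. a \<in> params_tm t \<Longrightarrow> tm_over L B (\<pi> a)"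
  shows "tm_over L B (subst_tm s \<pi> t)"
  using assms
proof (induction t)
  case (Fn f ts)
  have "tm_over L B (subst_tm s \<pi> t)" if "t \<in> set ts" for t
    using Fn that by auto
  then show ?case using Fn.prems(1) by (auto simp: tm_over_def)
qed (auto simp: tm_over_def)

text \<open>Only the existence of the substituted formula is claimed, because bound variables have
  to be renamed to avoid capture. The parameter map on the right depends on \<open>v\<close>, so
  that a parameter can be turned into a variable, as \<open>dfn_abst\<close> does.\<close>

lemma sat_subst_ex:
  assumes "wf_fm L \<phi>" "\<And>n. tm_over L B (s n)" "\<And>a. a \<in> params \<phi> \<Longrightarrow> tm_over L B (\<pi> a)"
  shows "\<exists>\<psi> \<in> formulas L B UNIV. \<forall>v.
    sat \<M> v \<psi> = sat \<M> (\<lambda>n. val \<M> v (s n)) (map_fm (\<lambda>x. x) (\<lambda>x. x) (\<lambda>a. val \<M> v (\<pi> a)) \<phi>)"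
  using assms
proof (induction \<phi> arbitrary: s)
  case Bot
  then show ?case by (intro bexI[of _ Bot]) (auto simp: formulas_def)
next
  case (Equal t u)
  then have "tm_over L B (subst_tm s \<pi> t)" "tm_over L B (subst_tm s \<pi> u)"
    by (auto intro!: tm_over_subst)
  then show ?case
    by (intro bexI[of _ "Equal (subst_tm s \<pi> t) (subst_tm s \<pi> u)"])
      (auto simp: formulas_def val_subst_tm tm_over_def)
next
  case (Rel r ts)
  have ok: "tm_over L B (subst_tm s \<pi> t)" if "t \<in> set ts" for t
    using Rel that by (auto intro!: tm_over_subst)
  have "map (val \<M> v) (map (subst_tm s \<pi>) ts)
      = map (val \<M> (\<lambda>n. val \<M> v (s n))) (map (map_tm (\<lambda>x. x) (\<lambda>a. val \<M> v (\<pi> a))) ts)" for v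
    by (auto simp: val_subst_tm)
  then have "sat \<M> v (Rel r (map (subst_tm s \<pi>) ts))
      = sat \<M> (\<lambda>n. val \<M> v (s n)) (map_fm (\<lambda>x. x) (\<lambda>x. x) (\<lambda>a. val \<M> v (\<pi> a)) (Rel r ts))" for v
    by (simp only: sat.simps fm.map)
  moreover have "Rel r (map (subst_tm s \<pi>) ts) \<in> formulas L B UNIV"
    using Rel.prems(1) ok unfolding formulas_def tm_over_def by fastforce
  ultimately show ?case by blast
next
  case (Neg \<phi>)
  obtain \<psi> where "\<psi> \<in> formulas L B UNIV" "\<forall>v.
    sat \<M> v \<psi> = sat \<M> (\<lambda>n. val \<M> v (s n)) (map_fm (\<lambda>x. x) (\<lambda>x. x) (\<lambda>a. val \<M> v (\<pi> a)) \<phi>)"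
    using Neg.IH[of s] Neg.prems by auto
  then show ?case by (intro bexI[of _ "Neg \<psi>"]) (auto simp: formulas_def)
next
  case (Conj \<phi>1 \<phi>2)
  obtain \<psi>1 where 1: "\<psi>1 \<in> formulas L B UNIV" "\<forall>v.
    sat \<M> v \<psi>1 = sat \<M> (\<lambda>n. val \<M> v (s n)) (map_fm (\<lambda>x. x) (\<lambda>x. x) (\<lambda>a. val \<M> v (\<pi> a)) \<phi>1)"
    using Conj.IH(1)[of s] Conj.prems by auto
  obtain \<psi>2 where 2: "\<psi>2 \<in> formulas L B UNIV" "\<forall>v.
    sat \<M> v \<psi>2 = sat \<M> (\<lambda>n. val \<M> v (s n)) (map_fm (\<lambda>x. x) (\<lambda>x. x) (\<lambda>a. val \<M> v (\<pi> a)) \<phi>2)"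
    using Conj.IH(2)[of s] Conj.prems by auto
  show ?case using 1 2 by (intro bexI[of _ "Conj \<psi>1 \<psi>2"]) (auto simp: formulas_def)
next
  case (Disj \<phi>1 \<phi>2)
  obtain \<psi>1 where 1: "\<psi>1 \<in> formulas L B UNIV" "\<forall>v.
    sat \<M> v \<psi>1 = sat \<M> (\<lambda>n. val \<M> v (s n)) (map_fm (\<lambda>x. x) (\<lambda>x. x) (\<lambda>a. val \<M> v (\<pi> a)) \<phi>1)"
    using Disj.IH(1)[of s] Disj.prems by auto
  obtain \<psi>2 where 2: "\<psi>2 \<in> formulas L B UNIV" "\<forall>v.
    sat \<M> v \<psi>2 = sat \<M> (\<lambda>n. val \<M> v (s n)) (map_fm (\<lambda>x. x) (\<lambda>x. x) (\<lambda>a. val \<M> v (\<pi> a)) \<phi>2)"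
    using Disj.IH(2)[of s] Disj.prems by auto
  show ?case using 1 2 by (intro bexI[of _ "Disj \<psi>1 \<psi>2"]) (auto simp: formulas_def)
next
  case (Exi n \<phi>)
  \<comment> \<open>The new bound variable avoids every term put for a free variable or a parameter
    of \<open>\<phi>\<close>, so changing its value does not change the values of these
    terms.\<close>
  let ?F = "(\<Union>k \<in> fv \<phi>. fv_tm (s k)) \<union> (\<Union>a \<in> params \<phi>. fv_tm (\<pi> a))"
  have "finite ?F" by (auto simp: finite_fv finite_fv_tm finite_params)
  then obtain m where m: "m \<notin> ?F" using ex_new_if_finite[OF infinite_UNIV_nat] by blast
  have "\<exists>\<psi> \<in> formulas L B UNIV. \<forall>v. sat \<M> v \<psi>
      = sat \<M> (\<lambda>k. val \<M> v ((s(n := Var m)) k)) (map_fm (\<lambda>x. x) (\<lambda>x. x) (\<lambda>a. val \<M> v (\<pi> a)) \<phi>)"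
    using Exi.prems by (intro Exi.IH) auto
  then obtain \<psi> where \<psi>: "\<psi> \<in> formulas L B UNIV" "\<And>v. sat \<M> v \<psi>
      = sat \<M> (\<lambda>k. val \<M> v ((s(n := Var m)) k)) (map_fm (\<lambda>x. x) (\<lambda>x. x) (\<lambda>a. val \<M> v (\<pi> a)) \<phi>)"
    by blast
  have "sat \<M> (v(m := a)) \<psi>
      = sat \<M> ((\<lambda>k. val \<M> v (s k))(n := a)) (map_fm (\<lambda>x. x) (\<lambda>x. x) (\<lambda>a. val \<M> v (\<pi> a)) \<phi>)" for v a
  proof -
    have "map_fm (\<lambda>x. x) (\<lambda>x. x) (\<lambda>b. val \<M> (v(m := a)) (\<pi> b)) \<phi> = map_fm (\<lambda>x. x) (\<lambda>x. x) (\<lambda>b. val \<M> v (\<pi> b)) \<phi>"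
      using m by (intro fm.map_cong0) (auto intro!: val_cong)
    moreover have "sat \<M> (\<lambda>k. val \<M> (v(m := a)) ((s(n := Var m)) k)) \<theta>
        = sat \<M> ((\<lambda>k. val \<M> v (s k))(n := a)) \<theta>" if "fv \<theta> = fv \<phi>" for \<theta>
      using m that by (intro sat_cong) (auto intro!: val_cong)
    ultimately show ?thesis
      by (simp add: \<psi>(2) fv_map del: fun_upd_apply)
  qed
  then show ?case using \<psi>(1)
    by (intro bexI[of _ "Exi m \<psi>"]) (auto simp: formulas_def)
qed


section \<open>Encodings of tuples and of sequences of tuples\<close>

definition scons :: "'a \<Rightarrow> (nat \<Rightarrow> 'a) \<Rightarrow> nat \<Rightarrow> 'a" (infixr "##" 65) where
  "x ## v = (\<lambda>n. case n of 0 \<Rightarrow> x | Suc m \<Rightarrow> v m)"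

lemma scons_simps [simp]: "(x ## v) 0 = x" "(x ## v) (Suc n) = v n"
  by (auto simp: scons_def)

text \<open>Tuples are infinite, so two of them cannot be concatenated; they are joined by
  alternation, and \<open>flat\<close> joins countably many by pairing of indices. Passing from one
  encoding to another is then a reindexing of variables, under which definability is
  preserved.\<close>

definition ileave :: "(nat \<Rightarrow> 'a) \<Rightarrow> (nat \<Rightarrow> 'a) \<Rightarrow> nat \<Rightarrow> 'a" (infixr "\<bowtie>" 65) where
  "c \<bowtie> v = (\<lambda>n. if even n then c (n div 2) else v (n div 2))"

lemma ileave_simps [simp]: "(c \<bowtie> v) (2 * n) = c n" "(c \<bowtie> v) (Suc (2 * n)) = v n"
  "(c \<bowtie> v) 0 = c 0"
  by (auto simp: ileave_def)

definition flat :: "(nat \<Rightarrow> nat \<Rightarrow> 'a) \<Rightarrow> nat \<Rightarrow> 'a" where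
  "flat d = (\<lambda>n. d (fst (prod_decode n)) (snd (prod_decode n)))"

lemma flat_simps [simp]: "flat d (prod_encode (l, k)) = d l k"
  by (auto simp: flat_def)

section \<open>Definable properties of infinite tuples\<close>

locale monster =
  fixes L :: "('f, 'r) language" and \<M> :: "('f, 'r, 'a) struct" and \<kappa> :: "'k rel"
  assumes monster: "monster_model L \<M> \<kappa>"
begin

abbreviation "U \<equiv> univ \<M>"

definition asg :: "(nat \<Rightarrow> 'a) set" where "asg = {v. \<forall>n. v n \<in> U}"

lemma asgI: "(\<And>n. v n \<in> U) \<Longrightarrow> v \<in> asg"
  and asgD: "v \<in> asg \<Longrightarrow> v n \<in> U"
  by (auto simp: asg_def)

lemma asg_range: "v \<in> asg \<longleftrightarrow> range v \<subseteq> U"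
  by (auto simp: asg_def)

lemma asg_const [simp]: "(\<lambda>_. x) \<in> asg \<longleftrightarrow> x \<in> U"
  by (auto simp: asg_def)

lemma asg_upd [simp]: "v \<in> asg \<Longrightarrow> x \<in> U \<Longrightarrow> v(n := x) \<in> asg"
  by (auto simp: asg_def)

lemma asg_scons [simp]: "x ## v \<in> asg \<longleftrightarrow> x \<in> U \<and> v \<in> asg"
proof
  assume a: "x ## v \<in> asg"
  show "x \<in> U \<and> v \<in> asg"
    using asgD[OF a, of 0] asgD[OF a, of "Suc _"] by (auto simp: asg_def)
qed (auto simp: asg_def scons_def split: nat.splits)

lemma asg_ileave [simp]: "c \<bowtie> v \<in> asg \<longleftrightarrow> c \<in> asg \<and> v \<in> asg"
proof
  assume a: "c \<bowtie> v \<in> asg"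
  show "c \<in> asg \<and> v \<in> asg"
    using asgD[OF a, of "2 * _"] asgD[OF a, of "Suc (2 * _)"] by (auto simp: asg_def)
qed (auto simp: asg_def ileave_def)

lemma asg_flat: "(\<And>l. d l \<in> asg) \<Longrightarrow> flat d \<in> asg"
  by (auto simp: asg_def flat_def)

lemma univ_nonempty: "U \<noteq> {}"
  using monster by (auto simp: monster_model_def is_structure_def)

lemma val_in: "wf_tm L t \<Longrightarrow> params_tm t \<subseteq> U \<Longrightarrow> v \<in> asg \<Longrightarrow> val \<M> v t \<in> U"
proof (induction t)
  case (Fn f ts)
  have "set (map (val \<M> v) ts) \<subseteq> U" using Fn by auto
  moreover have "length (map (val \<M> v) ts) = farity L f" "f \<in> funs L" using Fn by auto
  ultimately show ?case
    using monster unfolding monster_model_def is_structure_def val.simps by blast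
qed (auto simp: asg_def)

text \<open>
  Types are handled semantically. A tuple is a whole assignment \<open>nat \<Rightarrow> 'a\<close>, of which a formula
  sees only finitely many entries; \<open>dfn B P\<close> says that the property \<open>P\<close> of tuples is expressed by
  a formula over \<open>B\<close>, and \<open>dtm B t\<close> that \<open>t\<close> is the value of a term over \<open>B\<close>.
\<close>

definition dfn :: "'a set \<Rightarrow> ((nat \<Rightarrow> 'a) \<Rightarrow> bool) \<Rightarrow> bool" where
  "dfn B P \<longleftrightarrow> B \<subseteq> U \<and> (\<exists>\<phi> \<in> formulas L B UNIV. \<forall>v \<in> asg. P v \<longleftrightarrow> sat \<M> v \<phi>)"

definition dtm :: "'a set \<Rightarrow> ((nat \<Rightarrow> 'a) \<Rightarrow> 'a) \<Rightarrow> bool" where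
  "dtm B t \<longleftrightarrow> B \<subseteq> U \<and> (\<exists>s. tm_over L B s \<and> (\<forall>v \<in> asg. t v = val \<M> v s))"

lemma dfnD: "dfn B P \<Longrightarrow> B \<subseteq> U"
  by (simp add: dfn_def)

lemma dfn_cong: "dfn B P \<Longrightarrow> (\<And>v. v \<in> asg \<Longrightarrow> P v = Q v) \<Longrightarrow> dfn B Q"
  by (auto simp: dfn_def)

lemma dfn_mono: "dfn B P \<Longrightarrow> B \<subseteq> C \<Longrightarrow> C \<subseteq> U \<Longrightarrow> dfn C P"
  unfolding dfn_def formulas_def by blast

lemma dfn_not: "dfn B P \<Longrightarrow> dfn B (\<lambda>v. \<not> P v)"
  unfolding dfn_def formulas_def
  by (clarsimp, rule_tac x = "Neg \<phi>" in exI) auto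

lemma dfn_conj: "dfn B P \<Longrightarrow> dfn B Q \<Longrightarrow> dfn B (\<lambda>v. P v \<and> Q v)"
  unfolding dfn_def formulas_def
  by (clarsimp, rule_tac x = "Conj \<phi> \<phi>'" in exI) auto

lemma dfn_False: "B \<subseteq> U \<Longrightarrow> dfn B (\<lambda>_. False)"
  unfolding dfn_def formulas_def by (auto intro!: exI[of _ Bot])

lemma dfn_True: "B \<subseteq> U \<Longrightarrow> dfn B (\<lambda>_. True)"
  using dfn_not[OF dfn_False] by simp

lemma dfn_bool: "B \<subseteq> U \<Longrightarrow> dfn B (\<lambda>_. b)"
  by (cases b) (auto intro: dfn_True dfn_False)

lemma dfn_disj: "dfn B P \<Longrightarrow> dfn B Q \<Longrightarrow> dfn B (\<lambda>v. P v \<or> Q v)"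
  using dfn_not[OF dfn_conj[OF dfn_not dfn_not, of B P Q]] by simp

lemma dfn_imp: "dfn B P \<Longrightarrow> dfn B Q \<Longrightarrow> dfn B (\<lambda>v. P v \<longrightarrow> Q v)"
  unfolding imp_conv_disj by (intro dfn_disj dfn_not)

lemma dfn_iff: "dfn B P \<Longrightarrow> dfn B Q \<Longrightarrow> dfn B (\<lambda>v. P v \<longleftrightarrow> Q v)"
  unfolding iff_conv_conj_imp by (intro dfn_conj dfn_imp)

lemma dfn_Ball: "finite S \<Longrightarrow> B \<subseteq> U \<Longrightarrow> (\<And>i. i \<in> S \<Longrightarrow> dfn B (P i)) \<Longrightarrow> dfn B (\<lambda>v. \<forall>i\<in>S. P i v)"
proof (induction S rule: finite_induct)
  case (insert x F)
  then show ?case using dfn_conj[of B "P x" "\<lambda>v. \<forall>i\<in>F. P i v"] by simp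
qed (simp add: dfn_True)

lemma dfn_Bex: "finite S \<Longrightarrow> B \<subseteq> U \<Longrightarrow> (\<And>i. i \<in> S \<Longrightarrow> dfn B (P i)) \<Longrightarrow> dfn B (\<lambda>v. \<exists>i\<in>S. P i v)"
  using dfn_not[OF dfn_Ball[of S B "\<lambda>i v. \<not> P i v"]] dfn_not by simp

lemma dfn_Ball_less: "B \<subseteq> U \<Longrightarrow> (\<And>i. i < (n::nat) \<Longrightarrow> dfn B (P i)) \<Longrightarrow> dfn B (\<lambda>v. \<forall>i<n. P i v)"
  by (rule dfn_cong[OF dfn_Ball[of "{..<n}" B P]]) auto

lemma dfn_ex: "dfn B P \<Longrightarrow> dfn B (\<lambda>v. \<exists>x\<in>U. P (v(n := x)))"
  unfolding dfn_def formulas_def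
  by (clarsimp, rule_tac x = "Exi n \<phi>" in exI) (auto simp del: fun_upd_apply)

lemma dtm_var: "B \<subseteq> U \<Longrightarrow> dtm B (\<lambda>v. v n)"
  by (auto simp: dtm_def intro!: exI[of _ "Var n"])

lemma dtm_const: "B \<subseteq> U \<Longrightarrow> b \<in> B \<Longrightarrow> dtm B (\<lambda>v. b)"
  by (auto simp: dtm_def intro!: exI[of _ "Param b"])

lemma map_fm_param_id: "(\<And>a. a \<in> params \<phi> \<Longrightarrow> h a = a) \<Longrightarrow> map_fm (\<lambda>x. x) (\<lambda>x. x) h \<phi> = \<phi>"
  using fm.map_cong0[of \<phi> "\<lambda>x. x" "\<lambda>x. x" "\<lambda>x. x" "\<lambda>x. x" h "\<lambda>x. x"] fm.map_ident
  by metis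

lemma dfn_sub:
  assumes P: "dfn B P" and t: "\<And>n. dtm B (t n)"
  shows "dfn B (\<lambda>v. P (\<lambda>n. t n v))"
proof -
  have B: "B \<subseteq> U" by (rule dfnD[OF P])
  obtain \<phi> where \<phi>: "\<phi> \<in> formulas L B UNIV" "\<forall>v \<in> asg. P v \<longleftrightarrow> sat \<M> v \<phi>"
    using P by (auto simp: dfn_def)
  obtain s where s: "\<And>n. tm_over L B (s n)" "\<And>n v. v \<in> asg \<Longrightarrow> t n v = val \<M> v (s n)"
    using t unfolding dtm_def by metis
  obtain \<psi> where \<psi>: "\<psi> \<in> formulas L B UNIV" "\<forall>v. sat \<M> v \<psi>
      = sat \<M> (\<lambda>n. val \<M> v (s n)) (map_fm (\<lambda>x. x) (\<lambda>x. x) (\<lambda>a. val \<M> v (Param a)) \<phi>)"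
    using sat_subst_ex[of L \<phi> B s Param \<M>] \<phi>(1) s(1) by (auto simp: formulas_def)
  have "P (\<lambda>n. t n v) = sat \<M> v \<psi>" if v: "v \<in> asg" for v
  proof -
    have "(\<lambda>n. val \<M> v (s n)) \<in> asg"
      using s(1) B by (auto simp: tm_over_def intro!: asgI val_in[OF _ _ v])
    then show ?thesis using \<psi>(2) \<phi>(2) s(2)[OF v] by (simp add: map_fm_param_id)
  qed
  then show ?thesis using \<psi>(1) B by (auto simp: dfn_def)
qed

lemma dfn_reindex: "dfn B P \<Longrightarrow> dfn B (\<lambda>v. P (\<lambda>n. v (f n)))"
  by (rule dfn_sub) (auto intro: dtm_var dest: dfnD)

lemma dfn_eq:
  assumes "dtm B s" "dtm B t"
  shows "dfn B (\<lambda>v. s v = t v)"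
proof -
  obtain s' t' where "tm_over L B s'" "\<forall>v\<in>asg. s v = val \<M> v s'" "tm_over L B t'" "\<forall>v\<in>asg. t v = val \<M> v t'"
    using assms by (auto simp: dtm_def)
  then show ?thesis using assms unfolding dfn_def dtm_def
    by (auto simp: formulas_def tm_over_def intro!: exI[of _ "Equal s' t'"])
qed

lemma dfn_exs:
  assumes "dfn B P" shows "dfn B (\<lambda>v. \<exists>x\<in>U. P (x ## v))"
proof -
  have "dfn B (\<lambda>v. (\<lambda>w. \<exists>x\<in>U. P (w(0 := x))) (\<lambda>n. v (n - 1)))"
    by (rule dfn_reindex[OF dfn_ex[OF assms]])
  moreover have "(\<lambda>n. v (n - 1))(0 := x) = x ## v" for v :: "nat \<Rightarrow> 'a" and x
    by (auto simp: scons_def fun_eq_iff split: nat.splits)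
  ultimately show ?thesis by simp
qed

text \<open>A formula has finitely many free variables. This is what makes infinite tuples harmless:
  each property is decided by an initial segment.\<close>

lemma dfn_supp:
  assumes "dfn B P"
  shows "\<exists>K. \<forall>v\<in>asg. \<forall>w\<in>asg. (\<forall>n<K. v n = w n) \<longrightarrow> P v = P w"
proof -
  obtain \<phi> where \<phi>: "\<forall>v \<in> asg. P v \<longleftrightarrow> sat \<M> v \<phi>"
    using assms by (auto simp: dfn_def)
  obtain K where "fv \<phi> \<subseteq> {..<K}"
    using finite_nat_bounded[OF finite_fv] by blast
  then have "P v = P w" if "v \<in> asg" "w \<in> asg" "\<forall>n<K. v n = w n" for v w
    using \<phi> that sat_cong[of \<phi> v w \<M>] by blast
  then show ?thesis by blast
qed

text \<open>\<open>P\<close> depends on its first \<open>K\<close> entries, so only finitely many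
  entries from \<open>n\<close> on have to be quantified.\<close>

lemma dfn_ex_many:
  assumes P: "dfn B P"
  shows "dfn B (\<lambda>v. \<exists>w\<in>asg. (\<forall>i<n. w i = v i) \<and> P w)"
proof -
  obtain K where K: "\<And>v w. v \<in> asg \<Longrightarrow> w \<in> asg \<Longrightarrow> (\<And>n. n < K \<Longrightarrow> v n = w n) \<Longrightarrow> P v = P w"
    using dfn_supp[OF P] by blast
  have "dfn B (\<lambda>v. \<exists>w\<in>asg. (\<forall>i<n. w i = v i) \<and> P w)" if "K \<le> n" for n
  proof (rule dfn_cong[OF P])
    fix v assume v: "v \<in> asg"
    show "P v = (\<exists>w\<in>asg. (\<forall>i<n. w i = v i) \<and> P w)"
      using K[OF v] v that by (metis order_less_le_trans)
  qed
  \<comment> \<open>Downward from \<open>K\<close>: the bound is written \<open>K - m\<close> so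
    that induction on \<open>m\<close> adds one quantifier at a time.\<close>
  moreover have *: "dfn B (\<lambda>v. \<exists>w\<in>asg. (\<forall>i<K-m. w i = v i) \<and> P w)" for m
  proof (induction m)
    case (Suc m)
    show ?case
    proof (cases "m < K")
      case True
      show ?thesis
      proof (rule dfn_cong[OF dfn_ex[OF Suc, of "K - Suc m"]])
        fix v assume v: "v \<in> asg"
        have *: "K - m = Suc (K - Suc m)" using True by simp
        show "(\<exists>x\<in>U. \<exists>w\<in>asg. (\<forall>i<K - m. w i = (v(K - Suc m := x)) i) \<and> P w)
            = (\<exists>w\<in>asg. (\<forall>i<K - Suc m. w i = v i) \<and> P w)" (is "?l = ?r")
        proof
          assume ?l
          then show ?r unfolding * by (metis fun_upd_apply less_Suc_eq nat_neq_iff)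
        next
          assume ?r
          then obtain w where w: "w \<in> asg" "\<forall>i<K - Suc m. w i = v i" "P w" by blast
          then have "\<forall>i<K - m. w i = (v(K - Suc m := w (K - Suc m))) i"
            unfolding * by (auto simp: less_Suc_eq)
          moreover have "w (K - Suc m) \<in> U" by (rule asgD[OF w(1)])
          ultimately show ?l using w by blast
        qed
      qed
    next
      case False
      then have "K - Suc m = K - m" by simp
      then show ?thesis using Suc by simp
    qed
  qed (use calculation[of K] in simp)
  ultimately show ?thesis
  proof (cases "K \<le> n")
    case False
    then have "K - (K - n) = n" by simp
    with *[of "K - n"] show ?thesis by simp
  qed auto
qed

text \<open>Parameters from the range of \<open>c\<close> are traded for the even variables.\<close>

lemma dfn_abst:
  assumes P: "dfn (B \<union> C) P" and c: "C \<subseteq> range c"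
  shows "\<exists>P'. dfn B P' \<and> (\<forall>v\<in>asg. P v \<longleftrightarrow> P' (c \<bowtie> v))"
proof -
  have B: "B \<subseteq> U" using dfnD[OF P] by simp
  obtain \<phi> where \<phi>: "\<phi> \<in> formulas L (B \<union> C) UNIV" "\<forall>v \<in> asg. P v \<longleftrightarrow> sat \<M> v \<phi>"
    using P by (auto simp: dfn_def)
  define \<pi> where "\<pi> = (\<lambda>a. if a \<in> B then Param a else Var (2 * (SOME k. c k = a)) :: ('f, 'a) tm)"
  have \<pi>: "tm_over L B (\<pi> a)" for a by (auto simp: \<pi>_def)
  obtain \<psi> where \<psi>: "\<psi> \<in> formulas L B UNIV" "\<forall>v. sat \<M> v \<psi>
      = sat \<M> (\<lambda>n. val \<M> v (Var (Suc (2 * n)))) (map_fm (\<lambda>x. x) (\<lambda>x. x) (\<lambda>a. val \<M> v (\<pi> a)) \<phi>)"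
    using sat_subst_ex[of L \<phi> B "\<lambda>n. Var (Suc (2 * n))" \<pi> \<M>] \<phi>(1) \<pi> by (auto simp: formulas_def)
  have "P v = sat \<M> (c \<bowtie> v) \<psi>" if v: "v \<in> asg" for v
  proof -
    have "val \<M> (c \<bowtie> v) (\<pi> a) = a" if "a \<in> params \<phi>" for a
    proof (cases "a \<in> B")
      case False
      then have "\<exists>k. c k = a" using that \<phi>(1) c by (auto simp: formulas_def)
      then show ?thesis using False by (auto simp: \<pi>_def intro: someI_ex)
    qed (auto simp: \<pi>_def)
    then have "map_fm (\<lambda>x. x) (\<lambda>x. x) (\<lambda>a. val \<M> (c \<bowtie> v) (\<pi> a)) \<phi> = \<phi>"
      by (rule map_fm_param_id)
    then show ?thesis using \<psi>(2) \<phi>(2) v by simp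
  qed
  moreover have "dfn B (\<lambda>w. sat \<M> w \<psi>)" using \<psi>(1) B by (auto simp: dfn_def)
  ultimately show ?thesis by blast
qed

text \<open>The formula behind \<open>dfn\<close> may mention further variables on which the truth
  value does not depend. They are removed by quantifying them one at a time, which is sound because
  the universe is nonempty.\<close>

lemma definable_iff:
  assumes B: "B \<subseteq> U"
  shows "definable L \<M> B X \<longleftrightarrow> X \<subseteq> U \<and> dfn B (\<lambda>v. v 0 \<in> X)"
proof
  assume "definable L \<M> B X"
  then obtain \<phi> where \<phi>: "\<phi> \<in> formulas L B {0}" "solutions \<M> \<phi> = X"
    by (auto simp: definable_def)
  have "sat \<M> (\<lambda>_. v 0) \<phi> = sat \<M> v \<phi>" for v
    using \<phi>(1) by (intro sat_cong) (auto simp: formulas_def)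
  then have "v 0 \<in> X \<longleftrightarrow> sat \<M> v \<phi>" if "v \<in> asg" for v
    using \<phi>(2) that by (auto simp: solutions_def asg_def)
  then show "X \<subseteq> U \<and> dfn B (\<lambda>v. v 0 \<in> X)"
    using B \<phi> by (auto simp: dfn_def formulas_def solutions_def)
next
  assume X: "X \<subseteq> U \<and> dfn B (\<lambda>v. v 0 \<in> X)"
  then obtain \<phi> where \<phi>: "\<phi> \<in> formulas L B UNIV" "\<forall>v\<in>asg. v 0 \<in> X \<longleftrightarrow> sat \<M> v \<phi>"
    by (auto simp: dfn_def)
  have ex: "\<exists>\<psi> \<in> formulas L B UNIV. fv \<psi> = fv \<phi> - S \<and> (\<forall>v\<in>asg. v 0 \<in> X \<longleftrightarrow> sat \<M> v \<psi>)"
    if "finite S" "0 \<notin> S" for S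
    using that
  proof (induction S rule: finite_induct)
    case empty
    then show ?case using \<phi> by auto
  next
    case (insert n S)
    then obtain \<psi> where \<psi>: "\<psi> \<in> formulas L B UNIV" "fv \<psi> = fv \<phi> - S"
      "\<forall>v\<in>asg. v 0 \<in> X \<longleftrightarrow> sat \<M> v \<psi>" by auto
    have "v 0 \<in> X \<longleftrightarrow> sat \<M> v (Exi n \<psi>)" if v: "v \<in> asg" for v
    proof -
      have "sat \<M> (v(n := a)) \<psi> \<longleftrightarrow> v 0 \<in> X" if "a \<in> U" for a
        using \<psi>(3) insert.prems v that by (metis asg_upd fun_upd_other insertCI)
      then show ?thesis using univ_nonempty by auto
    qed
    then show ?case using \<psi>(1,2)
      by (intro bexI[of _ "Exi n \<psi>"]) (auto simp: formulas_def)
  qed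
  obtain \<psi> where \<psi>: "\<psi> \<in> formulas L B UNIV" "fv \<psi> = fv \<phi> - (fv \<phi> - {0})"
      "\<forall>v\<in>asg. v 0 \<in> X \<longleftrightarrow> sat \<M> v \<psi>" using ex[of "fv \<phi> - {0}"] finite_fv by blast
  have "g \<in> X \<longleftrightarrow> sat \<M> (\<lambda>_. g) \<psi>" if "g \<in> U" for g
    using bspec[OF \<psi>(3), of "\<lambda>_. g"] that by simp
  then have "solutions \<M> \<psi> = X" using X by (auto simp: solutions_def)
  then show "definable L \<M> B X"
    using \<psi>(1,2) by (auto simp: definable_def formulas_def intro!: bexI[of _ \<psi>])
qed

lemma definableI:
  assumes "dfn B (\<lambda>v. Q (v 0))" shows "definable L \<M> B {y \<in> U. Q y}"
  unfolding definable_iff[OF dfnD[OF assms]]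
  by (rule conjI, blast, rule dfn_cong[OF assms]) (auto simp: asg_def)

lemma definable_dfn:
  assumes "definable L \<M> B X" "B \<subseteq> U" shows "dfn B (\<lambda>v. v n \<in> X)"
proof -
  have "dfn B (\<lambda>v. v 0 \<in> X)" using assms definable_iff by blast
  from dfn_reindex[OF this, of "\<lambda>_. n"] show ?thesis .
qed

lemma definable_tm:
  assumes "definable L \<M> B X" "dtm B t" shows "dfn B (\<lambda>v. t v \<in> X)"
proof -
  have "dfn B (\<lambda>v. v 0 \<in> X)" using assms definable_iff dtm_def by blast
  from dfn_sub[OF this, of "\<lambda>_. t"] show ?thesis using assms by simp
qed

lemma definable_subset: "definable L \<M> B X \<Longrightarrow> X \<subseteq> U"
  by (auto simp: definable_def solutions_def)

lemma definable_mono: "definable L \<M> B X \<Longrightarrow> B \<subseteq> C \<Longrightarrow> definable L \<M> C X"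
  by (auto simp: definable_def formulas_def)

lemma definable_fiber:
  assumes P: "dfn B P" and c: "c \<in> asg"
  shows "definable L \<M> (B \<union> range c) {y \<in> U. P (y ## c)}"
proof -
  have sub: "B \<union> range c \<subseteq> U" using dfnD[OF P] c asg_range by auto
  have "dfn (B \<union> range c) (\<lambda>v. P (\<lambda>n. (v 0 ## c) n))"
  proof (rule dfn_sub[OF dfn_mono[OF P]])
    show "dtm (B \<union> range c) (\<lambda>v. (v 0 ## c) n)" for n
      using sub by (cases n) (auto intro: dtm_var dtm_const)
  qed (use sub in auto)
  then show ?thesis by (intro definableI) simp
qed

end

section \<open>Saturation and indiscernible sequences\<close>

lemma enum_finite:
  assumes "finite S" shows "\<exists>c :: nat \<Rightarrow> 'a. range c = insert x S"
proof -
  obtain xs where xs: "set xs = S" using finite_list[OF assms] by blast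
  have "range (\<lambda>i. if i < length xs then xs ! i else x) = insert x S"
    unfolding xs[symmetric] set_conv_nth by (auto simp: image_iff)
  then show ?thesis by blast
qed

context monster
begin

text \<open>\<open>teq B c d\<close>: the tuples \<open>c\<close> and \<open>d\<close> have the same type over \<open>B\<close>.\<close>

definition teq :: "'a set \<Rightarrow> (nat \<Rightarrow> 'a) \<Rightarrow> (nat \<Rightarrow> 'a) \<Rightarrow> bool" where
  "teq B c d \<longleftrightarrow> (\<forall>P. dfn B P \<longrightarrow> P c = P d)"

lemma teq_refl [simp]: "teq B c c" by (simp add: teq_def)

lemma teq_sym: "teq B c d \<Longrightarrow> teq B d c" unfolding teq_def by metis

lemma teq_trans: "teq B c d \<Longrightarrow> teq B d e \<Longrightarrow> teq B c e" unfolding teq_def by metis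

lemma teqD: "teq B c d \<Longrightarrow> dfn B P \<Longrightarrow> P c = P d" by (auto simp: teq_def)

lemma teq_sub: "teq B c d \<Longrightarrow> (\<And>n. dtm B (t n)) \<Longrightarrow> teq B (\<lambda>n. t n c) (\<lambda>n. t n d)"
  unfolding teq_def using dfn_sub by blast

lemma teq_reindex: "teq B c d \<Longrightarrow> teq B (\<lambda>n. c (f n)) (\<lambda>n. d (f n))"
  unfolding teq_def using dfn_reindex by blast

lemma dfn_finite_params:
  assumes "dfn B P" shows "\<exists>C. finite C \<and> C \<subseteq> B \<and> dfn C P"
proof -
  obtain \<phi> where "\<phi> \<in> formulas L B UNIV" "\<forall>v\<in>asg. P v \<longleftrightarrow> sat \<M> v \<phi>" "B \<subseteq> U"
    using assms by (auto simp: dfn_def)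
  then show ?thesis
    by (intro exI[of _ "params \<phi>"]) (auto simp: dfn_def formulas_def finite_params)
qed

text \<open>Finitely many parameters occur, and a single tuple from \<open>B\<close> lists them; the
  point \<open>x\<close> keeps the list nonempty.\<close>

lemma dfn_abst_finite:
  assumes P: "dfn B P" and x: "x \<in> B"
  shows "\<exists>P' c. dfn {} P' \<and> range c \<subseteq> B \<and> (\<forall>v\<in>asg. P v \<longleftrightarrow> P' (c \<bowtie> v))"
proof -
  obtain C where C: "finite C" "C \<subseteq> B" "dfn C P" using dfn_finite_params[OF P] by blast
  obtain c :: "nat \<Rightarrow> 'a" where c: "range c = insert x C" using enum_finite[OF C(1)] by blast
  obtain P' where "dfn {} P'" "\<forall>v\<in>asg. P v \<longleftrightarrow> P' (c \<bowtie> v)"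
    using dfn_abst[of "{}" C P c] C(3) c by auto
  moreover have "range c \<subseteq> B" using c C(2) x by simp
  ultimately show ?thesis by (intro exI[of _ P'] exI[of _ c] conjI)
qed

section \<open>Tarski-Vaught for definable properties of tuples\<close>

lemma elementary_subset: "elementary_substructure L M \<M> \<Longrightarrow> M \<subseteq> U"
  and elementary_nonempty: "elementary_substructure L M \<M> \<Longrightarrow> M \<noteq> {}"
  by (auto simp: elementary_substructure_def is_structure_def)

lemma tarski_vaught_step:
  assumes M: "elementary_substructure L M \<M>" and P: "dfn M P" and m: "range m \<subseteq> M"
    and ex: "\<exists>x\<in>U. P (m(n := x))"
  shows "\<exists>x\<in>M. P (m(n := x))"
proof -
  have MU: "M \<subseteq> U" by (rule elementary_subset[OF M])
  have "m 0 \<in> M" using m by auto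
  from dfn_abst_finite[OF P this] obtain P' c
    where P'0: "dfn {} P'" "range c \<subseteq> M" "\<forall>v\<in>asg. P v \<longleftrightarrow> P' (c \<bowtie> v)" by (elim exE conjE)
  then have P': "dfn {} P'" "range c \<subseteq> M" "v \<in> asg \<Longrightarrow> P v \<longleftrightarrow> P' (c \<bowtie> v)" for v
    by simp_all
  obtain \<phi> where \<phi>: "\<phi> \<in> formulas L {} UNIV" "\<And>v. v \<in> asg \<Longrightarrow> P' v \<longleftrightarrow> sat \<M> v \<phi>"
    using P'(1) by (auto simp: dfn_def)
  \<comment> \<open>Entry \<open>n\<close> of \<open>m\<close> sits at the odd position
    \<open>Suc (2 * n)\<close> of \<open>c \<bowtie> m\<close>, so updating it leaves the parameters
    at the even positions alone.\<close>
  have upd: "(c \<bowtie> m)(Suc (2 * n) := x) = c \<bowtie> m(n := x)" for x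
    by (auto simp: ileave_def fun_eq_iff elim!: oddE)
  have masg: "m \<in> asg" "c \<in> asg" using m P'(2) MU by (auto simp: asg_def)
  have Pm: "P (m(n := x)) \<longleftrightarrow> sat \<M> ((c \<bowtie> m)(Suc (2 * n) := x)) \<phi>" if "x \<in> U" for x
    using that masg P'(3) \<phi>(2) by (simp add: upd)
  have el: "\<And>\<phi> v. \<phi> \<in> formulas L {} UNIV \<Longrightarrow> range v \<subseteq> M \<Longrightarrow> sat (\<M>\<lparr>univ := M\<rparr>) v \<phi> = sat \<M> v \<phi>"
    using M by (auto simp: elementary_substructure_def)
  have rng: "range (c \<bowtie> v) \<subseteq> M" if "range v \<subseteq> M" for v
    using that P'(2) by (auto simp: ileave_def)
  have "sat \<M> (c \<bowtie> m) (Exi (Suc (2 * n)) \<phi>)" using ex Pm by auto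
  moreover have "Exi (Suc (2 * n)) \<phi> \<in> formulas L {} UNIV" using \<phi>(1) by (auto simp: formulas_def)
  ultimately have "sat (\<M>\<lparr>univ := M\<rparr>) (c \<bowtie> m) (Exi (Suc (2 * n)) \<phi>)"
    using el rng m by blast
  then obtain x where x: "x \<in> M" "sat (\<M>\<lparr>univ := M\<rparr>) (c \<bowtie> m(n := x)) \<phi>"
    by (auto simp: upd simp del: fun_upd_apply)
  have "range (m(n := x)) \<subseteq> M" using m x(1) by auto
  then have "sat \<M> (c \<bowtie> m(n := x)) \<phi>" using el[OF \<phi>(1)] rng x(2) by blast
  then show ?thesis using x(1) Pm MU by (auto simp: upd simp del: fun_upd_apply)
qed

text \<open>Entries are moved into \<open>M\<close> one at a time; once \<open>K\<close> of them are
  there, the rest no longer matters. This supplies the finite intersection property behind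
  coheirs.\<close>

lemma tarski_vaught:
  assumes M: "elementary_substructure L M \<M>" and P: "dfn M P" and v: "v \<in> asg" "P v"
  shows "\<exists>m. range m \<subseteq> M \<and> P m"
proof -
  have MU: "M \<subseteq> U" by (rule elementary_subset[OF M])
  have ex: "\<exists>m. range m \<subseteq> M \<and> (\<exists>w\<in>asg. (\<forall>i<n. w i = m i) \<and> P w)" for n
  proof (induction n)
    case 0
    obtain x where "x \<in> M" using elementary_nonempty[OF M] by blast
    then show ?case using v by (intro exI[of _ "\<lambda>_. x"]) auto
  next
    case (Suc n)
    then obtain m w where m: "range m \<subseteq> M" "w \<in> asg" "\<forall>i<n. w i = m i" "P w" by blast
    have "\<exists>x\<in>U. \<exists>w\<in>asg. (\<forall>i<Suc n. w i = (m(n := x)) i) \<and> P w"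
      using m by (intro bexI[of _ "w n"] bexI[of _ w]) (auto simp: less_Suc_eq asg_def)
    then obtain x where "x \<in> M" "\<exists>w\<in>asg. (\<forall>i<Suc n. w i = (m(n := x)) i) \<and> P w"
      using tarski_vaught_step[OF M dfn_ex_many[OF P] m(1)] by blast
    moreover from this(1) have "range (m(n := x)) \<subseteq> M" using m(1) by auto
    ultimately show ?case by blast
  qed
  obtain K where K: "\<forall>v\<in>asg. \<forall>w\<in>asg. (\<forall>n<K. v n = w n) \<longrightarrow> P v = P w"
    using dfn_supp[OF P] by blast
  obtain m w where m: "range m \<subseteq> M" "w \<in> asg" "\<forall>i<K. w i = m i" "P w" using ex by blast
  moreover have "m \<in> asg" using m(1) MU by (auto simp: asg_def)
  ultimately show ?thesis using K by blast
qed

section \<open>Smallness and saturation\<close>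

definition small :: "'a set \<Rightarrow> bool" where "small B \<longleftrightarrow> B \<subseteq> U \<and> |B| <o \<kappa>"

lemma Cinfinite_kappa: "Cinfinite \<kappa>"
  using monster cinfinite_mono[OF ordLess_imp_ordLeq natLeq_cinfinite]
  by (auto simp: monster_model_def)

lemma small_Un: "small B \<Longrightarrow> small C \<Longrightarrow> small (B \<union> C)"
  using Un_Cinfinite_bound_strict[OF _ _ Cinfinite_kappa] by (auto simp: small_def)

text \<open>Here it counts that \<open>\<kappa>\<close> is uncountable: a tuple has countably many
  entries, so a tuple can always be added to the parameters.\<close>

lemma small_range: "c \<in> asg \<Longrightarrow> small (range c)"
proof -
  have "|range c| \<le>o |UNIV :: nat set|" by (rule card_of_image)
  also have "|UNIV :: nat set| =o natLeq" by (rule card_of_nat)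
  also have "natLeq <o \<kappa>" using monster by (simp add: monster_model_def)
  finally show "c \<in> asg \<Longrightarrow> ?thesis" by (auto simp: small_def asg_def)
qed

lemma small_finite: "finite C \<Longrightarrow> C \<subseteq> U \<Longrightarrow> small C"
proof -
  assume C: "finite C" "C \<subseteq> U"
  obtain x where x: "x \<in> U" using univ_nonempty by blast
  obtain c :: "nat \<Rightarrow> 'a" where c: "range c = insert x C" using enum_finite[OF C(1)] by blast
  then have "small (insert x C)" using small_range[of c] C x by (auto simp: asg_range)
  moreover have "|C| \<le>o |insert x C|" by (rule card_of_mono1) auto
  ultimately show ?thesis using C(2) ordLeq_ordLess_trans by (auto simp: small_def)
qed

lemma smallD: "small B \<Longrightarrow> B \<subseteq> U" by (simp add: small_def)

lemma saturation:
  assumes B: "small B" and X: "\<And>X. X \<in> \<X> \<Longrightarrow> definable L \<M> B X"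
    and fip: "\<And>F. finite F \<Longrightarrow> F \<subseteq> \<X> \<Longrightarrow> \<exists>g\<in>U. \<forall>X\<in>F. g \<in> X"
  shows "\<exists>g\<in>U. \<forall>X\<in>\<X>. g \<in> X"
proof -
  have sat: "saturated L \<M> \<kappa>" using monster by (simp add: monster_model_def)
  define p where "p = {\<phi> \<in> formulas L B {0}. solutions \<M> \<phi> \<in> \<X>}"
  have "\<exists>g\<in>U. \<forall>\<phi>\<in>p0. g \<in> solutions \<M> \<phi>" if "p0 \<subseteq> p" "finite p0" for p0
    using fip[of "solutions \<M> ` p0"] that by (auto simp: p_def)
  then have "\<exists>g\<in>U. \<forall>\<phi>\<in>p. g \<in> solutions \<M> \<phi>"
    using sat[unfolded saturated_def, rule_format, of B p] B by (auto simp: p_def small_def)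
  then show ?thesis using X by (fastforce simp: p_def definable_def)
qed

text \<open>Saturation realizes types in one variable. For a tuple the entries are chosen one by
  one, keeping every finite part of \<open>\<Gamma>\<close> satisfiable by a continuation of the
  entries already fixed.\<close>

lemma realize:
  assumes B: "small B" and G: "\<And>P. P \<in> \<Gamma> \<Longrightarrow> dfn B P"
    and fip: "\<And>F. finite F \<Longrightarrow> F \<subseteq> \<Gamma> \<Longrightarrow> \<exists>v\<in>asg. \<forall>P\<in>F. P v"
  shows "\<exists>v\<in>asg. \<forall>P\<in>\<Gamma>. P v"
proof -
  define Fin where "Fin = (\<lambda>(n::nat) c. \<forall>F. finite F \<longrightarrow> F \<subseteq> \<Gamma> \<longrightarrow>
    (\<exists>w\<in>asg. (\<forall>i<n. w i = c i) \<and> (\<forall>P\<in>F. P w)))"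
  have step: "\<exists>x\<in>U. Fin (Suc n) (c(n := x))" if c: "c \<in> asg" and F: "Fin n c" for n c
  proof -
    define X where "X = (\<lambda>F. {x\<in>U. \<exists>w\<in>asg. (\<forall>i<Suc n. w i = (if i < n then c i else x)) \<and> (\<forall>P\<in>F. P w)})"
    have small: "small (B \<union> range c)" using B c by (intro small_Un small_range)
    have X1: "definable L \<M> (B \<union> range c) (X F)" if F: "finite F" "F \<subseteq> \<Gamma>" for F
    proof -
      have *: "dfn (B \<union> range c) (\<lambda>v. \<forall>P\<in>F. P v)"
      proof (intro dfn_Ball)
        show "dfn (B \<union> range c) P" if "P \<in> F" for P
          using dfn_mono[OF G[of P]] that F smallD[OF small] by blast
      qed (use F smallD[OF small] in auto)
      have "dfn (B \<union> range c) (\<lambda>v. \<exists>w\<in>asg. (\<forall>i<Suc n. w i = (if i < n then c i else v 0)) \<and> (\<forall>P\<in>F. P w))"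
      proof -
        have "dtm (B \<union> range c) (\<lambda>v. if i < n then c i else v 0)" for i
          using smallD[OF small] by (cases "i < n") (auto intro: dtm_const dtm_var)
        then show ?thesis
          by (rule dfn_sub[OF dfn_ex_many[OF *, of "Suc n"], of "\<lambda>i v. if i < n then c i else v 0"])
      qed
      then show ?thesis unfolding X_def by (rule definableI)
    qed
    have X2: "\<exists>g\<in>U. \<forall>Y\<in>X ` \<F>. g \<in> Y"
      if FF: "finite \<F>" "\<And>F. F \<in> \<F> \<Longrightarrow> finite F \<and> F \<subseteq> \<Gamma>" for \<F>
    proof -
      have "finite (\<Union>\<F>)" "\<Union>\<F> \<subseteq> \<Gamma>" using FF by auto
      then obtain w where "w \<in> asg" "\<forall>i<n. w i = c i" "\<forall>P\<in>\<Union>\<F>. P w" using F Fin_def by blast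
      then have "w n \<in> U" "\<forall>F\<in>\<F>. w n \<in> X F"
        by (auto simp: X_def less_Suc_eq asgD intro!: bexI[of _ w])
      then show ?thesis by blast
    qed
    have "\<exists>g\<in>U. \<forall>Y\<in>X ` {F. finite F \<and> F \<subseteq> \<Gamma>}. g \<in> Y"
    proof (rule saturation[OF small])
      fix F' assume "finite F'" "F' \<subseteq> X ` {F. finite F \<and> F \<subseteq> \<Gamma>}"
      from finite_subset_image[OF this] obtain \<F> where \<F>: "\<F> \<subseteq> {F. finite F \<and> F \<subseteq> \<Gamma>}" "finite \<F>" "F' = X ` \<F>"
        by blast
      show "\<exists>g\<in>U. \<forall>Y\<in>F'. g \<in> Y"
        unfolding \<F>(3) by (rule X2) (use \<F> in auto)
    qed (use X1 in auto)
    then obtain g where g: "g \<in> U" "\<And>F. finite F \<Longrightarrow> F \<subseteq> \<Gamma> \<Longrightarrow> g \<in> X F" by auto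
    have "Fin (Suc n) (c(n := g))"
      unfolding Fin_def
    proof (intro allI impI)
      fix F assume "finite F" "F \<subseteq> \<Gamma>"
      then obtain w where "w \<in> asg" "\<forall>i<Suc n. w i = (if i < n then c i else g)" "\<forall>P\<in>F. P w"
        using g(2) X_def by blast
      then show "\<exists>w\<in>asg. (\<forall>i<Suc n. w i = (c(n := g)) i) \<and> (\<forall>P\<in>F. P w)"
        by (intro bexI[of _ w]) (auto simp: less_Suc_eq)
    qed
    with g(1) show ?thesis by blast
  qed
  obtain c0 where c0: "c0 \<in> asg" using fip[of "{}"] by auto
  have "\<exists>f. \<forall>n. (f n \<in> asg \<and> Fin n (f n)) \<and> (\<exists>x. f (Suc n) = (f n)(n := x))"
  proof (rule dependent_nat_choice)
    show "\<exists>x. x \<in> asg \<and> Fin 0 x" using c0 fip by (intro exI[of _ c0]) (auto simp: Fin_def)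
    show "\<exists>y. (y \<in> asg \<and> Fin (Suc n) y) \<and> (\<exists>xa. y = x(n := xa))" if "x \<in> asg \<and> Fin n x" for x n
      using step[of x n] that asg_upd by blast
  qed
  then obtain f where f: "\<And>n. f n \<in> asg" "\<And>n. Fin n (f n)" "\<And>n. \<exists>x. f (Suc n) = (f n)(n := x)"
    by blast
  have st: "f (Suc n) i = f n i" if "i \<noteq> n" for i n using f(3)[of n] that by auto
  \<comment> \<open>Entry \<open>i\<close> is settled at stage \<open>i\<close> and never changes
    afterwards. Each member of \<open>\<Gamma>\<close> sees only finitely many entries, so the
    diagonal tuple satisfies it.\<close>
  define v where "v = (\<lambda>i. f (Suc i) i)"
  have fv: "f (Suc i + k) i = v i" for i k
    by (induction k) (auto simp: v_def st)
  have "f n i = v i" if "i < n" for i n using fv[of i "n - Suc i"] that by simp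
  then have Fv: "Fin n v" for n using f(2)[of n] unfolding Fin_def by simp
  have vasg: "v \<in> asg" unfolding v_def using f(1) by (intro asgI) (auto simp: asg_def)
  have "P v" if P: "P \<in> \<Gamma>" for P
  proof -
    obtain K where K: "\<forall>v\<in>asg. \<forall>w\<in>asg. (\<forall>n<K. v n = w n) \<longrightarrow> P v = P w"
      using dfn_supp[OF G[OF P]] by blast
    obtain w where "w \<in> asg" "\<forall>i<K. w i = v i" "P w"
      using Fv[of K, unfolded Fin_def, rule_format, of "{P}"] P by auto
    then show ?thesis using K vasg by blast
  qed
  with vasg show ?thesis by blast
qed

section \<open>Automorphisms and homogeneity\<close>

lemma aut_val:
  assumes \<sigma>: "automorphism L \<M> \<sigma>"
  shows "wf_tm L t \<Longrightarrow> params_tm t \<subseteq> U \<Longrightarrow> v \<in> asg \<Longrightarrow>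
    val \<M> (\<lambda>n. \<sigma> (v n)) (map_tm (\<lambda>x. x) \<sigma> t) = \<sigma> (val \<M> v t)"
proof (induction t)
  case (Fn f ts)
  have sub: "set (map (val \<M> v) ts) \<subseteq> U" using Fn by (auto intro!: val_in)
  have "map (val \<M> (\<lambda>n. \<sigma> (v n))) (map (map_tm (\<lambda>x. x) \<sigma>) ts) = map \<sigma> (map (val \<M> v) ts)"
    using Fn by auto
  moreover have "\<sigma> (fun_of \<M> f (map (val \<M> v) ts)) = fun_of \<M> f (map \<sigma> (map (val \<M> v) ts))"
    using \<sigma> sub Fn.prems unfolding automorphism_def by auto
  ultimately show ?case by (simp only: tm.map val.simps)
qed auto

lemma aut_sat:
  assumes \<sigma>: "automorphism L \<M> \<sigma>"
  shows "wf_fm L \<phi> \<Longrightarrow> params \<phi> \<subseteq> U \<Longrightarrow> v \<in> asg \<Longrightarrow>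
    sat \<M> (\<lambda>n. \<sigma> (v n)) (map_fm (\<lambda>x. x) (\<lambda>x. x) \<sigma> \<phi>) = sat \<M> v \<phi>"
proof (induction \<phi> arbitrary: v)
  case (Equal s t)
  have "val \<M> v s \<in> U" "val \<M> v t \<in> U" using Equal by (auto intro!: val_in)
  moreover have "inj_on \<sigma> U" using \<sigma> by (auto simp: automorphism_def bij_betw_def)
  ultimately show ?case using Equal by (auto simp: aut_val[OF \<sigma>] inj_on_eq_iff)
next
  case (Rel r ts)
  have sub: "set (map (val \<M> v) ts) \<subseteq> U" using Rel by (auto intro!: val_in)
  have "map (val \<M> (\<lambda>n. \<sigma> (v n))) (map (map_tm (\<lambda>x. x) \<sigma>) ts) = map \<sigma> (map (val \<M> v) ts)"
    using Rel by (auto intro!: aut_val[OF \<sigma>])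
  moreover have "rel_of \<M> r (map \<sigma> (map (val \<M> v) ts)) = rel_of \<M> r (map (val \<M> v) ts)"
    using \<sigma> sub Rel.prems(1) unfolding automorphism_def wf_fm.simps by (metis length_map)
  ultimately show ?case by (simp only: fm.map sat.simps)
next
  case (Exi n \<phi>)
  have im: "\<sigma> ` U = U" using \<sigma> by (auto simp: automorphism_def bij_betw_def)
  have "sat \<M> ((\<lambda>k. \<sigma> (v k))(n := \<sigma> a)) (map_fm (\<lambda>x. x) (\<lambda>x. x) \<sigma> \<phi>) = sat \<M> (v(n := a)) \<phi>" if "a \<in> U" for a
  proof -
    have "(\<lambda>k. \<sigma> (v k))(n := \<sigma> a) = (\<lambda>k. \<sigma> ((v(n := a)) k))" by auto
    then show ?thesis using Exi.IH[of "v(n := a)"] Exi.prems that by (simp del: fun_upd_apply)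
  qed
  then have "(\<exists>b\<in>\<sigma> ` U. sat \<M> ((\<lambda>k. \<sigma> (v k))(n := b)) (map_fm (\<lambda>x. x) (\<lambda>x. x) \<sigma> \<phi>)) = (\<exists>a\<in>U. sat \<M> (v(n := a)) \<phi>)"
    by auto
  then show ?case by (simp only: im fm.map sat.simps)
qed auto

lemma aut_dfn:
  assumes \<sigma>: "automorphism L \<M> \<sigma>" and P: "dfn B P" and fixB: "\<And>b. b \<in> B \<Longrightarrow> \<sigma> b = b" and v: "v \<in> asg"
  shows "P (\<lambda>n. \<sigma> (v n)) = P v"
proof -
  obtain \<phi> where \<phi>: "\<phi> \<in> formulas L B UNIV" "\<forall>v\<in>asg. P v \<longleftrightarrow> sat \<M> v \<phi>" and B: "B \<subseteq> U"
    using P by (auto simp: dfn_def)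
  have "map_fm (\<lambda>x. x) (\<lambda>x. x) \<sigma> \<phi> = \<phi>"
    using \<phi>(1) fixB by (intro map_fm_param_id) (auto simp: formulas_def)
  moreover have "(\<lambda>n. \<sigma> (v n)) \<in> asg"
    using \<sigma> v by (auto simp: asg_def automorphism_def bij_betw_def)
  ultimately show ?thesis using aut_sat[OF \<sigma>, of \<phi> v] \<phi> v B by (auto simp: formulas_def)
qed

lemma homogeneity:
  assumes B: "small B" and c: "c \<in> asg" and d: "d \<in> asg" and eq: "teq B c d"
  shows "\<exists>\<sigma>. automorphism L \<M> \<sigma> \<and> (\<forall>b\<in>B. \<sigma> b = b) \<and> (\<forall>n. \<sigma> (c n) = d n)"
proof -
  define idx where "idx = (\<lambda>x. SOME n. c n = x)"
  have idx: "c (idx x) = x" if "x \<in> range c" for x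
    using that unfolding idx_def by (auto intro: someI_ex)
  \<comment> \<open>A point outside \<open>B\<close> goes to the entry of \<open>d\<close> at a
    chosen index. The choice is immaterial, because equalities between entries, and between entries
    and points of \<open>B\<close>, belong to the type.\<close>
  define h where "h = (\<lambda>x. if x \<in> B then x else d (idx x))"
  have BU: "B \<subseteq> U" by (rule smallD[OF B])
  have hc: "h (c n) = d n" for n
  proof (cases "c n \<in> B")
    case True
    have "dfn B (\<lambda>v. v n = c n)" using True BU by (intro dfn_eq dtm_var dtm_const)
    from teqD[OF eq this] show ?thesis using True by (simp add: h_def)
  next
    case False
    have "dfn B (\<lambda>v. v n = v (idx (c n)))" using BU by (intro dfn_eq dtm_var)
    from teqD[OF eq this] have "d n = d (idx (c n))" using idx[of "c n"] by simp
    then show ?thesis using False by (simp add: h_def)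
  qed
  have el: "elementary_map L \<M> (B \<union> range c) h"
    unfolding elementary_map_def
  proof (intro conjI ballI allI impI)
    show "B \<union> range c \<subseteq> U" using BU c by (auto simp: asg_def)
    show "h ` (B \<union> range c) \<subseteq> U" using BU d hc by (auto simp: asg_def h_def)
    fix \<phi> :: "('f, 'r, 'a) fm" and v assume \<phi>: "\<phi> \<in> formulas L {} UNIV" and v: "v ` fv \<phi> \<subseteq> B \<union> range c"
    define t where "t = (\<lambda>n w. if n \<in> fv \<phi> then (if v n \<in> B then v n else w (idx (v n))) else w 0)"
    have "dfn B (\<lambda>w. sat \<M> w \<phi>)" using \<phi> BU by (auto simp: dfn_def formulas_def)
    moreover have "dtm B (t n)" for n
      using BU by (cases "n \<in> fv \<phi>"; cases "v n \<in> B") (auto simp: t_def intro: dtm_var dtm_const)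
    ultimately have "dfn B (\<lambda>w. sat \<M> (\<lambda>n. t n w) \<phi>)" by (rule dfn_sub)
    then have "sat \<M> (\<lambda>n. t n c) \<phi> = sat \<M> (\<lambda>n. t n d) \<phi>" by (rule teqD[OF eq])
    moreover have "sat \<M> (\<lambda>n. t n c) \<phi> = sat \<M> v \<phi>"
      using v idx by (intro sat_cong) (auto simp: t_def)
    moreover have "sat \<M> (\<lambda>n. t n d) \<phi> = sat \<M> (h \<circ> v) \<phi>"
      by (intro sat_cong) (auto simp: t_def h_def)
    ultimately show "sat \<M> v \<phi> = sat \<M> (h \<circ> v) \<phi>" by simp
  qed
  have "|B \<union> range c| <o \<kappa>" using small_Un[OF B small_range[OF c]] by (simp add: small_def)
  then obtain \<sigma> where "automorphism L \<M> \<sigma>" "\<forall>a\<in>B \<union> range c. \<sigma> a = h a"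
    using monster el unfolding monster_model_def strongly_homogeneous_def by blast
  then show ?thesis using hc by (intro exI[of _ \<sigma>]) (auto simp: h_def)
qed

text \<open>
  Invariance under strictly increasing reindexing of the whole sequence amounts to the usual
  condition on increasing finite subtuples, since formulas have finite support.
\<close>

definition indisc :: "'a set \<Rightarrow> (nat \<Rightarrow> nat \<Rightarrow> 'a) \<Rightarrow> bool" where
  "indisc B e \<longleftrightarrow> (\<forall>l. e l \<in> asg) \<and> (\<forall>f. strict_mono f \<longrightarrow> teq B (flat (\<lambda>l. e (f l))) (flat e))"

end

section \<open>Extracting indiscernible sequences\<close>

lemma sorted_list_of_strict_mono:
  assumes "strict_mono (g :: nat \<Rightarrow> nat)"
  shows "sorted_list_of_set (g ` {..<K}) = map g [0..<K]"
proof (rule sorted_distinct_set_unique)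
  show "sorted (map g [0..<K])"
    using assms by (auto simp: sorted_iff_nth_mono strict_mono_less_eq)
  show "distinct (map g [0..<K])"
    using strict_mono_imp_inj_on[OF assms] by (auto simp: distinct_map intro: inj_on_subset)
qed (auto simp: atLeast0LessThan)

lemma strict_mono_comp: "strict_mono f \<Longrightarrow> strict_mono g \<Longrightarrow> strict_mono (\<lambda>l. f (g l))"
  by (auto simp: strict_mono_def)

context monster
begin

text \<open>By compactness finitely many instances of indiscernibility suffice, and a subsequence of
  \<open>d\<close> satisfies them: by Ramsey's theorem finitely many properties have constant truth
  values on all of its subsequences. What holds along every subsequence of \<open>d\<close> is
  kept.\<close>

lemma extract_indisc:
  fixes d :: "nat \<Rightarrow> nat \<Rightarrow> 'a"
  assumes B: "small B" and d: "\<And>l. d l \<in> asg"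
  shows "\<exists>e. indisc B e \<and>
    (\<forall>P. dfn B P \<longrightarrow> (\<forall>f. strict_mono f \<longrightarrow> P (flat (\<lambda>l. d (f l)))) \<longrightarrow> P (flat e))"
proof -
  define re where "re = (\<lambda>f v n. (v :: nat \<Rightarrow> 'a) (prod_encode (f (fst (prod_decode n)), snd (prod_decode n))))"
  have re_flat: "re f (flat e) = flat (\<lambda>l. e (f l))" for f e
    by (auto simp: re_def flat_def fun_eq_iff)
  define \<Gamma>1 where "\<Gamma>1 = {P. dfn B P \<and> (\<forall>f. strict_mono f \<longrightarrow> P (flat (\<lambda>l. d (f l))))}"
  define eqv where "eqv = (\<lambda>(P :: (nat \<Rightarrow> 'a) \<Rightarrow> bool, f) v. P (re f v) \<longleftrightarrow> P v)"
  define \<Gamma>2 where "\<Gamma>2 = eqv ` ({P. dfn B P} \<times> {f. strict_mono f})"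
  have dfnG: "dfn B P" if P: "P \<in> \<Gamma>1 \<union> \<Gamma>2" for P
  proof (cases "P \<in> \<Gamma>1")
    case False
    then obtain Q f where "dfn B Q" "P = (\<lambda>v. Q (re f v) \<longleftrightarrow> Q v)" using P by (auto simp: \<Gamma>2_def eqv_def)
    moreover have "dfn B (\<lambda>v. Q (re f v))"
      unfolding re_def using \<open>dfn B Q\<close> by (rule dfn_reindex)
    ultimately show ?thesis using dfn_iff by simp
  qed (auto simp: \<Gamma>1_def)
  have fip: "\<exists>v\<in>asg. \<forall>P\<in>F. P v" if F: "finite F" "F \<subseteq> \<Gamma>1 \<union> \<Gamma>2" for F
  proof -
    have "F \<inter> \<Gamma>2 \<subseteq> eqv ` ({P. dfn B P} \<times> {f. strict_mono f})" "finite (F \<inter> \<Gamma>2)"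
      using F by (auto simp: \<Gamma>2_def)
    from finite_subset_image[OF this(2) this(1)]
    obtain S where S: "S \<subseteq> {P. dfn B P} \<times> {f. strict_mono f}" "finite S" "F \<inter> \<Gamma>2 = eqv ` S"
      by blast
    define Ps where "Ps = fst ` S"
    have Ps: "finite Ps" "\<And>P. P \<in> Ps \<Longrightarrow> dfn B P" using S by (auto simp: Ps_def)
    have "\<exists>K. \<forall>P\<in>Ps. \<forall>v\<in>asg. \<forall>w\<in>asg. (\<forall>n<K. v n = w n) \<longrightarrow> P v = P w"
      using Ps
    proof (induction Ps rule: finite_induct)
      case (insert P Ps)
      obtain K where K: "\<forall>P\<in>Ps. \<forall>v\<in>asg. \<forall>w\<in>asg. (\<forall>n<K. v n = w n) \<longrightarrow> P v = P w"
        using insert by auto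
      obtain K' where K': "\<forall>v\<in>asg. \<forall>w\<in>asg. (\<forall>n<K'. v n = w n) \<longrightarrow> P v = P w"
        using dfn_supp[OF insert.prems[of P]] by blast
      show ?case
      proof (intro exI[of _ "max K K'"] ballI impI)
        fix Q v w assume a: "Q \<in> insert P Ps" "v \<in> asg" "w \<in> asg" "\<forall>n<max K K'. v n = w n"
        then have "\<forall>n<K. v n = w n" "\<forall>n<K'. v n = w n" by auto
        then show "Q v = Q w" using K K' a(1-3) by blast
      qed
    qed simp
    then obtain K where "\<forall>P\<in>Ps. \<forall>v\<in>asg. \<forall>w\<in>asg. (\<forall>n<K. v n = w n) \<longrightarrow> P v = P w" ..
    then have K: "P v = P w" if "P \<in> Ps" "v \<in> asg" "w \<in> asg" "\<forall>n<K. v n = w n" for P v w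
      using that by simp
    \<comment> \<open>The first \<open>K\<close> entries of a flattened sequence come from tuples
      with index below \<open>K\<close>, so the truth values depend on a \<open>K\<close>-element
      set of indices, which Ramsey's theorem can colour. The value 0 from \<open>K\<close> on is a
      filler.\<close>
    define en where "en = (\<lambda>X l. if l < K then sorted_list_of_set X ! l else (0::nat))"
    define col where "col = (\<lambda>X. {P \<in> Ps. P (flat (\<lambda>l. d (en X l)))})"
    obtain ix and s :: nat where ix: "ix ` Pow Ps = {i. i < s}" "inj_on ix (Pow Ps)"
      using finite_imp_inj_to_nat_seg[of "Pow Ps"] Ps(1) by blast
    have "\<forall>X. X \<subseteq> UNIV \<and> finite X \<and> card X = K \<longrightarrow> ix (col X) < s"
      using ix(1) by (auto simp: col_def)
    then obtain Y t where Y: "infinite Y" "\<And>X. X \<subseteq> Y \<Longrightarrow> finite X \<Longrightarrow> card X = K \<Longrightarrow> ix (col X) = t"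
      using Ramsey[of "UNIV :: nat set" K "\<lambda>X. ix (col X)" s] by auto
    define h where "h = enumerate Y"
    have h: "strict_mono h" "range h \<subseteq> Y"
      using Y(1) by (auto simp: h_def strict_mono_enumerate enumerate_in_set)
    have key: "P (flat (\<lambda>l. d (h (f l)))) \<longleftrightarrow> P (flat (\<lambda>l. d (h l)))" if P: "P \<in> Ps" and f: "strict_mono f" for P f
    proof -
      have *: "P (flat (\<lambda>l. d (g l))) \<longleftrightarrow> P \<in> col (g ` {..<K})" if g: "strict_mono g" for g
      proof -
        have "en (g ` {..<K}) l = g l" if "l < K" for l
          using that sorted_list_of_strict_mono[OF g] by (simp add: en_def)
        moreover have "fst (prod_decode n) < K" if "n < K" for n
          using that le_prod_encode_1[of "fst (prod_decode n)" "snd (prod_decode n)"] by simp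
        ultimately have "P (flat (\<lambda>l. d (g l))) \<longleftrightarrow> P (flat (\<lambda>l. d (en (g ` {..<K}) l)))"
          using d by (intro K[OF P]) (simp_all add: asg_flat, simp add: flat_def)
        then show ?thesis using P by (auto simp: col_def)
      qed
      have card: "card (g ` {..<K}) = K" if "strict_mono g" for g :: "nat \<Rightarrow> nat"
        using card_image[of g "{..<K}"] strict_mono_imp_inj_on[OF that] inj_on_subset by fastforce
      have hf: "strict_mono (\<lambda>l. h (f l))" using h f strict_mono_comp by blast
      have "ix (col (h ` {..<K})) = t" using h card by (intro Y(2)) auto
      moreover have "ix (col ((\<lambda>l. h (f l)) ` {..<K})) = t" using h card[OF hf] by (intro Y(2)) auto
      moreover have "col X \<in> Pow Ps" for X by (auto simp: col_def)
      ultimately have "col (h ` {..<K}) = col ((\<lambda>l. h (f l)) ` {..<K})"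
        using ix(2) by (metis inj_onD)
      then show ?thesis using *[OF hf] *[OF h(1)] by simp
    qed
    have "P (flat (\<lambda>l. d (h l)))" if P: "P \<in> F" for P
    proof (cases "P \<in> \<Gamma>1")
      case True
      then show ?thesis using h(1) by (auto simp: \<Gamma>1_def)
    next
      case False
      then have "P \<in> F \<inter> \<Gamma>2" using P F by auto
      then obtain Q f where Qf: "(Q, f) \<in> S" "P = (\<lambda>v. Q (re f v) \<longleftrightarrow> Q v)" unfolding S(3) by (auto simp: eqv_def)
      then have "Q \<in> Ps" "strict_mono f" using S(1) by (auto simp: Ps_def intro: image_eqI[of _ fst "(Q, f)"])
      then show ?thesis using key Qf(2) by (simp add: re_flat)
    qed
    moreover have "flat (\<lambda>l. d (h l)) \<in> asg" using d by (intro asg_flat)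
    ultimately show ?thesis by blast
  qed
  have "\<exists>v\<in>asg. \<forall>P\<in>\<Gamma>1 \<union> \<Gamma>2. P v" by (rule realize[OF B dfnG fip])
  then obtain v where v1: "v \<in> asg" "\<forall>P\<in>\<Gamma>1 \<union> \<Gamma>2. P v" by (rule bexE)
  have v: "v \<in> asg" "P \<in> \<Gamma>1 \<union> \<Gamma>2 \<Longrightarrow> P v" for P
    using v1(1) bspec[OF v1(2), of P] by simp_all
  define e where "e = (\<lambda>l k. v (prod_encode (l, k)))"
  have fe: "flat e = v" by (auto simp: e_def flat_def)
  have "indisc B e"
    unfolding indisc_def teq_def
  proof (intro conjI allI impI)
    show "e l \<in> asg" for l using v(1) by (auto simp: e_def asg_def)
    fix f :: "nat \<Rightarrow> nat" and P assume "strict_mono f" "dfn B P"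
    then have "eqv (P, f) \<in> \<Gamma>2" by (auto simp: \<Gamma>2_def)
    then have "eqv (P, f) v" using v(2)[of "eqv (P, f)"] by simp
    then have "P (re f v) \<longleftrightarrow> P v" by (simp add: eqv_def)
    then show "P (flat (\<lambda>l. e (f l))) = P (flat e)" using re_flat[of f e] fe by simp
  qed
  moreover have "P (flat e)" if "dfn B P" "\<forall>f. strict_mono f \<longrightarrow> P (flat (\<lambda>l. d (f l)))" for P
  proof -
    have "P \<in> \<Gamma>1" using that by (simp add: \<Gamma>1_def)
    then show ?thesis using v(2)[of P] fe by simp
  qed
  ultimately show ?thesis by (intro exI[of _ e] conjI allI impI) simp_all
qed

end

section \<open>Wide elements and the \<open>S\<^sub>1\<close> property\<close>

lemma nth_concat_uniform:
  "(\<And>xs. xs \<in> set xss \<Longrightarrow> length xs = m) \<Longrightarrow> i < length xss * m \<Longrightarrow>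
    concat xss ! i = xss ! (i div m) ! (i mod m)"
proof (induction xss arbitrary: i)
  case (Cons xs xss)
  have len: "length xs = m" using Cons.prems by simp
  show ?case
  proof (cases "i < m")
    case True
    then show ?thesis using len by (simp add: nth_append)
  next
    case False
    then have "m > 0" using Cons.prems(2) by (cases m) auto
    have "concat xss ! (i - m) = xss ! ((i - m) div m) ! ((i - m) mod m)"
      using Cons.prems False by (intro Cons.IH) auto
    then show ?thesis using False len \<open>m > 0\<close>
      by (simp add: nth_append le_div_geq le_mod_geq)
  qed
qed simp

lemma val_inst_tm:
  "val \<M> v (inst_tm e t) = val \<M> (\<lambda>n. case e n of None \<Rightarrow> v n | Some a \<Rightarrow> a) t"
proof (induction t)
  case (Fn f ts)
  have "map (val \<M> v) (map (inst_tm e) ts) = map (val \<M> (\<lambda>n. case e n of None \<Rightarrow> v n | Some a \<Rightarrow> a)) ts"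
    using Fn by simp
  then show ?case by (simp only: val.simps inst_tm.simps)
qed (auto split: option.splits)

lemma sat_inst:
  "sat \<M> v (inst e \<phi>) = sat \<M> (\<lambda>n. case e n of None \<Rightarrow> v n | Some a \<Rightarrow> a) \<phi>"
proof (induction \<phi> arbitrary: v e)
  case (Rel r ts)
  have "map (val \<M> v) (map (inst_tm e) ts) = map (val \<M> (\<lambda>n. case e n of None \<Rightarrow> v n | Some a \<Rightarrow> a)) ts"
    by (simp add: val_inst_tm)
  then show ?case by (simp only: sat.simps inst.simps)
next
  case (Exi n \<phi>)
  have "(\<lambda>k. case (e(n := None)) k of None \<Rightarrow> (v(n := a)) k | Some b \<Rightarrow> b)
      = (\<lambda>k. case e k of None \<Rightarrow> v k | Some b \<Rightarrow> b)(n := a)" for a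
    by (auto simp: fun_eq_iff split: option.split)
  then show ?case by (simp only: sat.simps inst.simps Exi)
qed (auto simp: val_inst_tm)

lemma wf_inst_tm: "wf_tm L t \<Longrightarrow> wf_tm L (inst_tm e t)"
  by (induction t) (auto split: option.splits)

lemma params_inst_tm: "params_tm (inst_tm e t) \<subseteq> params_tm t \<union> ran e"
  by (induction t) (auto split: option.splits simp: ran_def)

lemma fv_inst_tm: "fv_tm (inst_tm e t) = fv_tm t - dom e"
  by (induction t) (auto split: option.splits)

lemma wf_inst: "wf_fm L \<phi> \<Longrightarrow> wf_fm L (inst e \<phi>)"
  by (induction \<phi> arbitrary: e) (auto simp: wf_inst_tm)

lemma params_inst: "params (inst e \<phi>) \<subseteq> params \<phi> \<union> ran e"
proof (induction \<phi> arbitrary: e)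
  case (Exi n \<phi>)
  have "ran (e(n := None)) \<subseteq> ran e" by (auto simp: ran_def)
  then show ?case using Exi[of "e(n := None)"] by (auto simp del: fun_upd_apply)
next
  case (Equal s t)
  then show ?case using params_inst_tm[of e s] params_inst_tm[of e t] by auto
next
  case (Rel r ts)
  then show ?case using params_inst_tm[of e] by fastforce
qed fastforce+

lemma fv_inst: "fv (inst e \<phi>) = fv \<phi> - dom e"
  by (induction \<phi> arbitrary: e) (auto simp: fv_inst_tm)

lemma image_Collect_bij:
  assumes "\<sigma> ` U = U" "\<And>g. g \<in> U \<Longrightarrow> R (\<sigma> g) = Q g"
  shows "{g \<in> U. R g} = \<sigma> ` {g \<in> U. Q g}"
proof (intro equalityI subsetI)
  fix x assume "x \<in> {g \<in> U. R g}"
  then obtain g where "g \<in> U" "x = \<sigma> g" "R x" using assms(1) by (metis (no_types, lifting) imageE mem_Collect_eq)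
  then show "x \<in> \<sigma> ` {g \<in> U. Q g}" using assms(2) by simp
next
  fix x assume "x \<in> \<sigma> ` {g \<in> U. Q g}"
  then obtain g where "g \<in> U" "x = \<sigma> g" "Q g" by blast
  then show "x \<in> {g \<in> U. R g}" using assms by auto
qed

section \<open>The ideal as a family of definable sets\<close>

locale s1_ideal = monster L \<M> \<kappa>
  for L :: "('f, 'r) language" and \<M> :: "('f, 'r, 'a) struct" and \<kappa> :: "'k rel" +
  fixes I :: "('f, 'r, 'a) fm set"
  assumes ideal: "formula_ideal L \<M> I" and inv: "invariant_ideal L \<M> I" and S1: "S1_ideal L \<M> I"
begin

abbreviation "J \<equiv> in_ideal \<M> I"

lemma J_definable: "J X \<Longrightarrow> definable L \<M> U X"
  using ideal by (auto simp: in_ideal_def formula_ideal_def definable_def)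

lemma J_subset: "J X \<Longrightarrow> X \<subseteq> U"
  using J_definable definable_subset by blast

lemma J_formula: "\<phi> \<in> formulas L U {0} \<Longrightarrow> J (solutions \<M> \<phi>) \<Longrightarrow> \<phi> \<in> I"
  using ideal by (auto simp: in_ideal_def formula_ideal_def)

lemma J_mono: "J X \<Longrightarrow> definable L \<M> U Y \<Longrightarrow> Y \<subseteq> X \<Longrightarrow> J Y"
  using ideal unfolding in_ideal_def formula_ideal_def definable_def by blast

lemma J_mono': "J X \<Longrightarrow> definable L \<M> B Y \<Longrightarrow> B \<subseteq> U \<Longrightarrow> Y \<subseteq> X \<Longrightarrow> J Y"
  using J_mono definable_mono by blast

lemma J_empty: "J {}"
proof -
  have "solutions \<M> Bot = {}" by (auto simp: solutions_def)
  then show ?thesis using ideal by (auto simp: in_ideal_def formula_ideal_def)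
qed

lemma J_Un: "J X \<Longrightarrow> J Y \<Longrightarrow> J (X \<union> Y)"
proof -
  assume "J X" "J Y"
  then obtain \<phi> \<psi> where "\<phi> \<in> I" "solutions \<M> \<phi> = X" "\<psi> \<in> I" "solutions \<M> \<psi> = Y"
    by (auto simp: in_ideal_def)
  then have "Disj \<phi> \<psi> \<in> I" "solutions \<M> (Disj \<phi> \<psi>) = X \<union> Y"
    using ideal by (auto simp: formula_ideal_def solutions_def)
  then show ?thesis unfolding in_ideal_def by blast
qed

lemma J_UN: "finite F \<Longrightarrow> (\<And>i. i \<in> F \<Longrightarrow> J (X i)) \<Longrightarrow> J (\<Union>i\<in>F. X i)"
  by (induction F rule: finite_induct) (auto intro: J_Un J_empty)

lemma J_aut:
  assumes \<sigma>: "automorphism L \<M> \<sigma>" and X: "J X"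
  shows "J (\<sigma> ` X)"
proof -
  obtain \<phi> where \<phi>: "\<phi> \<in> I" "solutions \<M> \<phi> = X" using X by (auto simp: in_ideal_def)
  then have wf: "wf_fm L \<phi>" "params \<phi> \<subseteq> U" using ideal by (auto simp: formula_ideal_def formulas_def)
  have im: "\<sigma> ` U = U" using \<sigma> by (auto simp: automorphism_def bij_betw_def)
  have "map_fm id id \<sigma> \<phi> \<in> I" using inv \<sigma> \<phi>(1) by (auto simp: invariant_ideal_def)
  then have "map_fm (\<lambda>x. x) (\<lambda>x. x) \<sigma> \<phi> \<in> I" by (simp add: id_def)
  moreover have "sat \<M> (\<lambda>_. \<sigma> g) (map_fm (\<lambda>x. x) (\<lambda>x. x) \<sigma> \<phi>) = sat \<M> (\<lambda>_. g) \<phi>" if "g \<in> U" for g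
    using aut_sat[OF \<sigma> wf, of "\<lambda>_. g"] that by simp
  then have "solutions \<M> (map_fm (\<lambda>x. x) (\<lambda>x. x) \<sigma> \<phi>) = \<sigma> ` X"
    unfolding \<phi>(2)[symmetric] solutions_def by (rule image_Collect_bij[OF im])
  ultimately show ?thesis by (auto simp: in_ideal_def)
qed

text \<open>Tuples of the same type over a small set are conjugate under an automorphism fixing it,
  and the ideal is invariant. So whether a fibre is in the ideal is decided by the type of its
  parameters.\<close>

lemma J_teq1:
  assumes B: "small B" and P: "dfn B P" and cd: "c \<in> asg" "d \<in> asg" "teq B c d"
    and J: "J {y \<in> U. P (y ## c)}"
  shows "J {y \<in> U. P (y ## d)}"
proof -
  obtain \<sigma> where \<sigma>: "automorphism L \<M> \<sigma>" "\<forall>b\<in>B. \<sigma> b = b" "\<forall>n. \<sigma> (c n) = d n"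
    using homogeneity[OF B cd] by blast
  have im: "\<sigma> ` U = U" using \<sigma> by (auto simp: automorphism_def bij_betw_def)
  have "P (\<sigma> y ## d) = P (y ## c)" if "y \<in> U" for y
  proof -
    have "(\<lambda>n. \<sigma> ((y ## c) n)) = \<sigma> y ## d"
      using \<sigma>(3) by (auto simp: scons_def split: nat.splits)
    then show ?thesis using aut_dfn[OF \<sigma>(1) P, of "y ## c"] \<sigma>(2) that cd by simp
  qed
  then have "{y \<in> U. P (y ## d)} = \<sigma> ` {y \<in> U. P (y ## c)}"
    by (rule image_Collect_bij[OF im])
  then show ?thesis using J_aut[OF \<sigma>(1) J] by simp
qed

lemma J_teq:
  assumes B: "small B" and P: "dfn B P" and cd: "c \<in> asg" "d \<in> asg" "teq B c d"
  shows "J {y \<in> U. P (y ## c)} \<longleftrightarrow> J {y \<in> U. P (y ## d)}"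
  using J_teq1[OF B P cd] J_teq1[OF B P cd(2,1) teq_sym[OF cd(3)]] by blast

definition wide :: "'a set \<Rightarrow> 'a \<Rightarrow> bool" where
  "wide B a \<longleftrightarrow> a \<in> U \<and> (\<forall>X. definable L \<M> B X \<longrightarrow> J X \<longrightarrow> a \<notin> X)"

lemma wide_in: "wide B a \<Longrightarrow> a \<in> U" by (simp add: wide_def)

lemma wideD: "wide B a \<Longrightarrow> definable L \<M> B X \<Longrightarrow> a \<in> X \<Longrightarrow> \<not> J X" by (auto simp: wide_def)

lemma wide_mono: "wide C a \<Longrightarrow> B \<subseteq> C \<Longrightarrow> wide B a"
  by (auto simp: wide_def dest: definable_mono)

lemma definable_Ball:
  assumes "finite F" "B \<subseteq> U" "\<And>X. X \<in> F \<Longrightarrow> definable L \<M> B X"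
  shows "definable L \<M> B {y \<in> U. \<forall>X\<in>F. y \<in> X}"
  using assms by (intro definableI dfn_Ball) (auto intro: definable_dfn)

lemma definable_UN:
  assumes "finite F" "B \<subseteq> U" "\<And>X. X \<in> F \<Longrightarrow> definable L \<M> B X"
  shows "definable L \<M> B (\<Union>F)"
proof -
  have "definable L \<M> B {y \<in> U. \<exists>X\<in>F. y \<in> X}"
    using assms by (intro definableI dfn_Bex) (auto intro: definable_dfn)
  moreover have "{y \<in> U. \<exists>X\<in>F. y \<in> X} = \<Union>F" using assms(3) definable_subset by blast
  ultimately show ?thesis by simp
qed

lemma definable_Un:
  assumes "B \<subseteq> U" "definable L \<M> B X" "definable L \<M> B Y" shows "definable L \<M> B (X \<union> Y)"
proof -
  have "definable L \<M> B (\<Union>{X, Y})" by (rule definable_UN) (use assms in auto)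
  then show ?thesis by simp
qed

lemma definable_U: "B \<subseteq> U \<Longrightarrow> definable L \<M> B U"
  using definable_Ball[of "{}" B] by simp

lemma definable_Int: "B \<subseteq> U \<Longrightarrow> definable L \<M> B X \<Longrightarrow> definable L \<M> B Y \<Longrightarrow> definable L \<M> B (X \<inter> Y)"
proof -
  assume a: "B \<subseteq> U" "definable L \<M> B X" "definable L \<M> B Y"
  have "definable L \<M> B {y \<in> U. y \<in> X \<and> y \<in> Y}"
    using a by (intro definableI dfn_conj definable_dfn)
  moreover have "{y \<in> U. y \<in> X \<and> y \<in> Y} = X \<inter> Y" using definable_subset[OF a(2)] by auto
  ultimately show ?thesis by simp
qed

lemma definable_Diff: "B \<subseteq> U \<Longrightarrow> definable L \<M> B X \<Longrightarrow> definable L \<M> B Y \<Longrightarrow> definable L \<M> B (X - Y)"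
proof -
  assume a: "B \<subseteq> U" "definable L \<M> B X" "definable L \<M> B Y"
  have "definable L \<M> B {y \<in> U. y \<in> X \<and> y \<notin> Y}"
    using a by (intro definableI dfn_conj dfn_not definable_dfn)
  moreover have "{y \<in> U. y \<in> X \<and> y \<notin> Y} = X - Y" using definable_subset[OF a(2)] by auto
  ultimately show ?thesis by simp
qed

text \<open>A type over \<open>B\<close> is closed under finite conjunctions, so the finitely many
  formulas that witness an implication merge into one \<open>B\<close>-definable set.\<close>

lemma wide_iff:
  assumes B: "B \<subseteq> U" and a: "a \<in> U"
  shows "wide_over L \<M> I B a \<longleftrightarrow> wide B a"
proof
  assume w: "wide_over L \<M> I B a"
  show "wide B a"
    unfolding wide_def
  proof (intro conjI allI impI notI)
    fix X assume X: "definable L \<M> B X" "J X" "a \<in> X"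
    obtain \<phi> where \<phi>: "\<phi> \<in> formulas L B {0}" "solutions \<M> \<phi> = X" using X(1) by (auto simp: definable_def)
    obtain \<psi> where \<psi>: "\<psi> \<in> I" "solutions \<M> \<psi> = X" using X(2) by (auto simp: in_ideal_def)
    have "type_implies \<M> (type_over L \<M> B a) \<psi>"
      unfolding type_implies_def using \<phi> \<psi> X(3)
      by (intro exI[of _ "{\<phi>}"]) (auto simp: type_over_def)
    then show False using w \<psi>(1) by (auto simp: wide_over_def wide_type_def)
  qed fact
next
  assume w: "wide B a"
  have False if "\<phi> \<in> I" "p0 \<subseteq> type_over L \<M> B a" "finite p0"
    "\<forall>g\<in>U. (\<forall>\<theta>\<in>p0. g \<in> solutions \<M> \<theta>) \<longrightarrow> g \<in> solutions \<M> \<phi>" for \<phi> p0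
  proof -
    let ?X = "{y \<in> U. \<forall>X\<in>solutions \<M> ` p0. y \<in> X}"
    have def: "definable L \<M> B ?X"
      using that(2,3) B by (intro definable_Ball) (auto simp: type_over_def definable_def)
    moreover have "J (solutions \<M> \<phi>)" using that(1) by (auto simp: in_ideal_def)
    moreover have "?X \<subseteq> solutions \<M> \<phi>" using that(4) by simp blast
    ultimately have "J ?X" using J_mono' B by blast
    moreover have "a \<in> ?X" using a that(2) by (auto simp: type_over_def)
    ultimately show False using wideD[OF w def] by blast
  qed
  then show "wide_over L \<M> I B a"
    unfolding wide_over_def wide_type_def type_implies_def by blast
qed

text \<open>Asking the point to avoid all \<open>B\<close>-definable members of the ideal keeps the
  family finitely satisfiable, since finitely many of them cannot cover a set outside the
  ideal.\<close>

lemma wide_ext: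
  assumes B: "small B" and X: "\<And>X. X \<in> \<X> \<Longrightarrow> definable L \<M> B X"
    and nJ: "\<And>F. finite F \<Longrightarrow> F \<subseteq> \<X> \<Longrightarrow> \<not> J {y \<in> U. \<forall>X\<in>F. y \<in> X}"
  shows "\<exists>b. wide B b \<and> (\<forall>X\<in>\<X>. b \<in> X)"
proof -
  have BU: "B \<subseteq> U" by (rule smallD[OF B])
  let ?N = "{U - Y |Y. definable L \<M> B Y \<and> J Y}"
  have "\<exists>g\<in>U. \<forall>X\<in>\<X> \<union> ?N. g \<in> X"
  proof (rule saturation[OF B])
    show "definable L \<M> B X" if "X \<in> \<X> \<union> ?N" for X
      using that X definable_Diff[OF BU definable_U[OF BU]] by auto
    fix F assume F: "finite F" "F \<subseteq> \<X> \<union> ?N"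
    let ?X = "{y \<in> U. \<forall>X\<in>F \<inter> \<X>. y \<in> X}"
    have "J (\<Union>Y\<in>F \<inter> ?N. U - Y)"
    proof (rule J_UN)
      show "J (U - Z)" if Z: "Z \<in> F \<inter> ?N" for Z
      proof -
        obtain Y where "Z = U - Y" "J Y" using Z by blast
        then have "U - Z = Y" using J_subset by blast
        then show ?thesis using \<open>J Y\<close> by simp
      qed
    qed (use F in auto)
    moreover have "definable L \<M> B ?X" using F X BU by (intro definable_Ball) auto
    moreover have "\<not> J ?X" using F by (intro nJ) auto
    ultimately have "\<not> ?X \<subseteq> (\<Union>Y\<in>F \<inter> ?N. U - Y)" using J_mono' BU by blast
    then obtain g where "g \<in> ?X" "g \<notin> (\<Union>Y\<in>F \<inter> ?N. U - Y)" by blast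
    moreover have "g \<in> X" if "X \<in> F" "X \<notin> \<X>" for X
    proof -
      have "X \<subseteq> U" "X \<in> F \<inter> ?N" using that F(2) by auto
      then show ?thesis using \<open>g \<in> ?X\<close> \<open>g \<notin> (\<Union>Y\<in>F \<inter> ?N. U - Y)\<close> by blast
    qed
    ultimately have "g \<in> U" "\<forall>X\<in>F. g \<in> X" by auto
    then show "\<exists>g\<in>U. \<forall>X\<in>F. g \<in> X" by blast
  qed
  then obtain g where "g \<in> U" "\<forall>X\<in>\<X> \<union> ?N. g \<in> X" by blast
  then have "wide B g \<and> (\<forall>X\<in>\<X>. g \<in> X)" unfolding wide_def by blast
  then show ?thesis by blast
qed

lemma wide_in_set:
  assumes B: "small B" and X: "definable L \<M> B X" "\<not> J X"
  shows "\<exists>b. wide B b \<and> b \<in> X"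
proof -
  have "\<not> J U" using X J_mono' definable_subset smallD[OF B] by blast
  moreover have "{y \<in> U. y \<in> X} = X" using definable_subset[OF X(1)] by blast
  ultimately have "\<not> J {y \<in> U. \<forall>Z\<in>F. y \<in> Z}" if "F \<subseteq> {X}" for F
    using X(2) that by (cases "F = {}") (auto simp: subset_singleton_iff)
  then show ?thesis using wide_ext[OF B, of "{X}"] X(1) by auto
qed

text \<open>\<open>S1_ideal\<close> speaks of indiscernible finite lists put into a formula. The
  tuples are cut to the \<open>m\<close> entries the formula can see, and indiscernibility of the
  lists is read off from the flattened sequence.\<close>

lemma S1_empty:
  assumes d: "indisc {} d" and P: "dfn {} P"
    and J01: "J ({y \<in> U. P (y ## d 0)} \<inter> {y \<in> U. P (y ## d 1)})"
  shows "J {y \<in> U. P (y ## d 0)}"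
proof -
  have dasg: "\<And>l. d l \<in> asg" using d by (simp add: indisc_def)
  obtain \<phi> where \<phi>: "\<phi> \<in> formulas L {} UNIV" "\<forall>v\<in>asg. P v \<longleftrightarrow> sat \<M> v \<phi>"
    using P by (auto simp: dfn_def)
  obtain m where m: "fv \<phi> \<subseteq> {..<m}" using finite_nat_bounded[OF finite_fv] by blast
  define a where "a = (\<lambda>l. map (d l) [0..<m])"
  define e where "e = (\<lambda>l n. if 1 \<le> n \<and> n \<le> length (a l) then Some (a l ! (n - 1)) else None)"
  have e: "inst_tuple \<phi> (a l) = inst (e l) \<phi>" for l by (simp add: inst_tuple_def e_def)
  have \<phi>m: "\<phi> \<in> formulas L {} {0..m}" using \<phi>(1) m by (auto simp: formulas_def)
  have ran: "ran (e l) \<subseteq> U" for l using asgD[OF dasg] by (auto simp: ran_def e_def a_def)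
  have form: "inst_tuple \<phi> (a l) \<in> formulas L U {0}" for l
  proof -
    have "dom (e l) = {1..m}" by (auto simp: e_def a_def split: if_splits)
    then have "fv (inst (e l) \<phi>) \<subseteq> {0}" unfolding fv_inst using m by auto
    moreover have "params (inst (e l) \<phi>) \<subseteq> U" using params_inst[of "e l" \<phi>] ran \<phi>m by (auto simp: formulas_def)
    ultimately show ?thesis using \<phi>m unfolding e by (auto simp: formulas_def wf_inst)
  qed
  have sol: "solutions \<M> (inst_tuple \<phi> (a l)) = {y \<in> U. P (y ## d l)}" for l
  proof -
    have "sat \<M> (\<lambda>_. y) (inst (e l) \<phi>) = P (y ## d l)" if "y \<in> U" for y
    proof -
      have "sat \<M> (\<lambda>n. case e l n of None \<Rightarrow> y | Some b \<Rightarrow> b) \<phi> = sat \<M> (y ## d l) \<phi>"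
      proof (rule sat_cong)
        fix n assume "n \<in> fv \<phi>"
        then show "(case e l n of None \<Rightarrow> y | Some b \<Rightarrow> b) = (y ## d l) n"
          using m by (cases n) (auto simp: e_def a_def)
      qed
      then show ?thesis using \<phi>(2) that dasg by (simp add: sat_inst)
    qed
    then show ?thesis unfolding e solutions_def by blast
  qed
  have st: "same_type L \<M> (concat (map a is)) (concat (map a js))"
    if s: "sorted_wrt (<) is" "sorted_wrt (<) js" "length is = length js" for "is" js
  proof -
    let ?r = "length is"
    have len: "length (concat (map a ks)) = length ks * m" for ks
      by (induction ks) (auto simp: a_def)
    \<comment> \<open>A finite increasing list of indices is extended to a strictly increasing
      function, because \<open>indisc\<close> reindexes the whole sequence.\<close>
    have ex: "\<exists>f. strict_mono f \<and> (\<forall>l<length ks. f l = ks ! l)" if "sorted_wrt (<) ks" for ks :: "nat list"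
    proof (intro exI conjI)
      let ?f = "\<lambda>l. if l < length ks then ks ! l else Suc (Max (insert 0 (set ks)) + l)"
      have "ks ! l < Suc (Max (insert 0 (set ks)) + l')" if "l < length ks" for l l'
        using that Max_ge[of "insert 0 (set ks)" "ks ! l"] by (auto simp: less_Suc_eq_le trans_le_add1)
      then show "strict_mono ?f"
        using that by (auto simp: strict_mono_def sorted_wrt_iff_nth_less)
    qed auto
    have cn: "concat (map a ks) ! i = flat (\<lambda>l. d (f l)) (prod_encode (i div m, i mod m))"
      if i: "i < length ks * m" and f: "\<forall>l<length ks. f l = ks ! l" for ks i f
    proof -
      have "m > 0" using i by (cases m) auto
      have "concat (map a ks) ! i = map a ks ! (i div m) ! (i mod m)"
        using i by (intro nth_concat_uniform) (auto simp: a_def)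
      moreover have "i div m < length ks" using i \<open>m > 0\<close> by (simp add: less_mult_imp_div_less)
      ultimately show ?thesis using f \<open>m > 0\<close> by (simp add: a_def)
    qed
    obtain f g where f: "strict_mono f" "\<forall>l<length is. f l = is ! l"
      and g: "strict_mono g" "\<forall>l<length js. g l = js ! l" using ex s by metis
    have "teq {} (flat (\<lambda>l. d (f l))) (flat (\<lambda>l. d (g l)))"
      using d f g teq_trans teq_sym unfolding indisc_def by metis
    show ?thesis
      unfolding same_type_def len
    proof (intro conjI ballI)
      show "length is * m = length js * m" using s by simp
      fix \<psi> :: "('f, 'r, 'a) fm" assume \<psi>: "\<psi> \<in> formulas L {} {..<length is * m}"
      have "dfn {} (\<lambda>w. sat \<M> w \<psi>)" using \<psi> by (auto simp: dfn_def formulas_def)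
      then have "dfn {} (\<lambda>w. sat \<M> (\<lambda>i. w (prod_encode (i div m, i mod m))) \<psi>)"
        by (rule dfn_reindex)
      from teqD[OF \<open>teq {} (flat (\<lambda>l. d (f l))) (flat (\<lambda>l. d (g l)))\<close> this]
      have *: "sat \<M> (\<lambda>i. flat (\<lambda>l. d (f l)) (prod_encode (i div m, i mod m))) \<psi>
         = sat \<M> (\<lambda>i. flat (\<lambda>l. d (g l)) (prod_encode (i div m, i mod m))) \<psi>" .
      have "sat \<M> (\<lambda>i. concat (map a is) ! i) \<psi>
         = sat \<M> (\<lambda>i. flat (\<lambda>l. d (f l)) (prod_encode (i div m, i mod m))) \<psi>"
        using \<psi> f(2) by (intro sat_cong cn) (auto simp: formulas_def)
      moreover have "sat \<M> (\<lambda>i. concat (map a js) ! i) \<psi>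
         = sat \<M> (\<lambda>i. flat (\<lambda>l. d (g l)) (prod_encode (i div m, i mod m))) \<psi>"
        using \<psi> g(2) s(3) by (intro sat_cong cn) (auto simp: formulas_def)
      ultimately show "sat \<M> (\<lambda>i. concat (map a is) ! i) \<psi> = sat \<M> (\<lambda>i. concat (map a js) ! i) \<psi>"
        using * by simp
    qed
  qed
  have "set (a l) \<subseteq> U" "length (a l) = m" for l using asgD[OF dasg] by (auto simp: a_def)
  then have ind: "indiscernible L \<M> m a" using st by (auto simp: indiscernible_def)
  have "Conj (inst_tuple \<phi> (a 0)) (inst_tuple \<phi> (a 1)) \<in> I"
  proof (rule J_formula)
    show "Conj (inst_tuple \<phi> (a 0)) (inst_tuple \<phi> (a 1)) \<in> formulas L U {0}"
      using form[of 0] form[of 1] by (auto simp: formulas_def)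
    have "solutions \<M> (Conj (inst_tuple \<phi> (a 0)) (inst_tuple \<phi> (a 1)))
      = solutions \<M> (inst_tuple \<phi> (a 0)) \<inter> solutions \<M> (inst_tuple \<phi> (a 1))"
      by (auto simp: solutions_def)
    then show "J (solutions \<M> (Conj (inst_tuple \<phi> (a 0)) (inst_tuple \<phi> (a 1))))"
      using J01 by (simp add: sol)
  qed
  then have "inst_tuple \<phi> (a 0) \<in> I" using S1 ind \<phi>m unfolding S1_ideal_def by blast
  then show ?thesis using sol[of 0] by (auto simp: in_ideal_def)
qed

text \<open>The parameters are absorbed into the sequence: the tuple \<open>c\<close> that lists
  them is attached to every term, and the result is indiscernible over the empty set.\<close>

lemma S1_indisc:
  assumes d: "indisc B d" and P: "dfn B P"
    and J01: "J ({y \<in> U. P (y ## d 0)} \<inter> {y \<in> U. P (y ## d 1)})"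
  shows "J {y \<in> U. P (y ## d 0)}"
proof (cases "B = {}")
  case True
  then show ?thesis using S1_empty d P J01 by simp
next
  case False
  have BU: "B \<subseteq> U" by (rule dfnD[OF P])
  have dasg: "\<And>l. d l \<in> asg" using d by (simp add: indisc_def)
  obtain x where "x \<in> B" using False by blast
  from dfn_abst_finite[OF P this] obtain P' c
    where P': "dfn {} P'" "range c \<subseteq> B" "\<forall>v\<in>asg. P v \<longleftrightarrow> P' (c \<bowtie> v)" by (elim exE conjE)
  have casg: "c \<in> asg" using P'(2) BU by (auto simp: asg_def)
  \<comment> \<open>\<open>P'\<close> expects \<open>c\<close> at the even positions and
    \<open>y ## d\<close> at the odd ones. In \<open>y ## (c \<bowtie> d)\<close> the entries of
    \<open>c\<close> stand one place later and all others one place earlier.\<close>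
  define P'' where "P'' = (\<lambda>w :: nat \<Rightarrow> 'a. P' (\<lambda>n. w (if even n then Suc n else n - 1)))"
  have "dfn {} P''" unfolding P''_def by (rule dfn_reindex[OF P'(1)])
  moreover have "indisc {} (\<lambda>l. c \<bowtie> d l)"
    unfolding indisc_def
  proof (intro conjI allI impI)
    show "c \<bowtie> d l \<in> asg" for l using casg dasg by simp
    fix f :: "nat \<Rightarrow> nat" assume "strict_mono f"
    then have teq: "teq B (flat (\<lambda>l. d (f l))) (flat d)" using d by (simp add: indisc_def)
    define t where "t = (\<lambda>n v. let (l, k) = prod_decode n in
      if even k then c (k div 2) else (v :: nat \<Rightarrow> 'a) (prod_encode (l, k div 2)))"
    have "dtm B (t n)" for n
    proof -
      obtain l k where "prod_decode n = (l, k)" by fastforce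
      moreover have "c (k div 2) \<in> B" using P'(2) by blast
      ultimately show ?thesis using BU by (cases "even k") (auto simp: t_def intro: dtm_var dtm_const)
    qed
    then have "teq B (\<lambda>n. t n (flat (\<lambda>l. d (f l)))) (\<lambda>n. t n (flat d))" by (rule teq_sub[OF teq])
    moreover have "(\<lambda>n. t n (flat e)) = flat (\<lambda>l. c \<bowtie> e l)" for e
      by (auto simp: t_def flat_def ileave_def fun_eq_iff split: prod.splits)
    ultimately have "teq B (flat (\<lambda>l. c \<bowtie> d (f l))) (flat (\<lambda>l. c \<bowtie> d l))" by simp
    then show "teq {} (flat (\<lambda>l. c \<bowtie> d (f l))) (flat (\<lambda>l. c \<bowtie> d l))"
      unfolding teq_def using dfn_mono[of "{}" _ B] BU by simp
  qed
  moreover have "P'' (y ## (c \<bowtie> d l)) = P (y ## d l)" if "y \<in> U" for y l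
  proof -
    have "(\<lambda>n. (y ## (c \<bowtie> d l)) (if even n then Suc n else n - 1)) = c \<bowtie> (y ## d l)"
    proof
      fix n
      show "(y ## (c \<bowtie> d l)) (if even n then Suc n else n - 1) = (c \<bowtie> (y ## d l)) n"
      proof (cases "even n")
        case False
        then obtain k where "n = Suc (2 * k)" by (auto elim: oddE)
        then show ?thesis by (cases k) (auto simp: ileave_def)
      qed (auto simp: ileave_def)
    qed
    then show ?thesis using P'(3) that dasg by (simp add: P''_def)
  qed
  then have "{y \<in> U. P'' (y ## (c \<bowtie> d l))} = {y \<in> U. P (y ## d l)}" for l by blast
  ultimately show ?thesis using S1_empty[of "\<lambda>l. c \<bowtie> d l" P''] J01 by simp
qed

text \<open>By S1, if one fibre is outside the ideal then so is the intersection of two. Grouping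
  the sequence into consecutive pairs gives an indiscernible sequence whose fibres are these
  intersections, so each round doubles the number of fibres with a common point.\<close>

lemma S1_many:
  assumes d: "indisc B d" and P: "dfn B P" and nJ: "\<not> J {y \<in> U. P (y ## d 0)}"
  shows "\<exists>y\<in>U. \<forall>l<2 ^ n. P (y ## d l)"
  using assms
proof (induction n arbitrary: d P)
  case 0
  then have "{y \<in> U. P (y ## d 0)} \<noteq> {}" using J_empty by metis
  then show ?case by auto
next
  case (Suc n)
  define P2 where "P2 = (\<lambda>w :: nat \<Rightarrow> 'a. P (\<lambda>n. w (2 * n - 1)) \<and> P (\<lambda>n. w (2 * n)))"
  define e where "e = (\<lambda>l. d (2 * l) \<bowtie> d (Suc (2 * l)))"
  have dasg: "\<And>l. d l \<in> asg" using Suc.prems by (simp add: indisc_def)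
  have P2: "dfn B P2" unfolding P2_def by (rule dfn_conj[OF dfn_reindex[OF Suc.prems(2)] dfn_reindex[OF Suc.prems(2)]])
  have "(\<lambda>n. (y ## (c \<bowtie> c')) (2 * n - 1)) = y ## c" "(\<lambda>n. (y ## (c \<bowtie> c')) (2 * n)) = y ## c'"
    for y :: 'a and c c'
  proof -
    show "(\<lambda>n. (y ## (c \<bowtie> c')) (2 * n - 1)) = y ## c"
    proof
      show "(y ## (c \<bowtie> c')) (2 * n - 1) = (y ## c) n" for n by (cases n) auto
    qed
    show "(\<lambda>n. (y ## (c \<bowtie> c')) (2 * n)) = y ## c'"
    proof
      show "(y ## (c \<bowtie> c')) (2 * n) = (y ## c') n" for n by (cases n) auto
    qed
  qed
  then have P2e: "P2 (y ## e l) = (P (y ## d (2 * l)) \<and> P (y ## d (Suc (2 * l))))" for y l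
    by (simp only: P2_def e_def)
  have ind: "indisc B e"
    unfolding indisc_def
  proof (intro conjI allI impI)
    show "e l \<in> asg" for l using dasg by (simp add: e_def)
    fix f :: "nat \<Rightarrow> nat" assume f: "strict_mono f"
    \<comment> \<open>Selecting pairs along \<open>f\<close> amounts to selecting the underlying
      terms along \<open>g\<close>.\<close>
    define g where "g = (\<lambda>l. 2 * f (l div 2) + l mod 2)"
    have "strict_mono g"
    proof (rule strict_mono_Suc_iff[THEN iffD2], rule allI)
      fix n show "g n < g (Suc n)"
      proof (cases "even n")
        case False
        then obtain k where "n = Suc (2 * k)" by (auto elim: oddE)
        moreover have "f k < f (Suc k)" using f by (simp add: strict_mono_Suc_iff)
        ultimately show ?thesis by (simp add: g_def)
      qed (auto simp: g_def elim!: evenE)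
    qed
    then have teq: "teq B (flat (\<lambda>l. d (g l))) (flat d)" using Suc.prems by (simp add: indisc_def)
    define r where "r = (\<lambda>n. let (l, k) = prod_decode n in prod_encode (2 * l + k mod 2, k div 2))"
    have r: "(\<lambda>n. flat q (r n)) = flat (\<lambda>l. q (2 * l) \<bowtie> q (Suc (2 * l)))" for q :: "nat \<Rightarrow> nat \<Rightarrow> 'a"
      by (auto simp: r_def flat_def ileave_def fun_eq_iff mod2_eq_if split: prod.splits)
    have "(\<lambda>n. flat (\<lambda>l. d (g l)) (r n)) = flat (\<lambda>l. e (f l))"
      unfolding r by (simp add: g_def e_def)
    moreover have "(\<lambda>n. flat d (r n)) = flat e" unfolding r e_def by simp
    ultimately show "teq B (flat (\<lambda>l. e (f l))) (flat e)"
      using teq_reindex[OF teq, of r] by simp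
  qed
  have "{y \<in> U. P2 (y ## e 0)} = {y \<in> U. P (y ## d 0)} \<inter> {y \<in> U. P (y ## d 1)}"
    by (auto simp: P2e)
  then have "\<not> J {y \<in> U. P2 (y ## e 0)}"
    using S1_indisc[OF Suc.prems(1,2)] Suc.prems(3) by auto
  from Suc.IH[OF ind P2 this] obtain y where y: "y \<in> U" "\<forall>l<2 ^ n. P2 (y ## e l)" by blast
  have "P (y ## d l)" if "l < 2 ^ Suc n" for l
  proof -
    have "l div 2 < 2 ^ n" using that by auto
    then have "P (y ## d (2 * (l div 2))) \<and> P (y ## d (Suc (2 * (l div 2))))" using y(2) P2e by blast
    moreover have "l = 2 * (l div 2) \<or> l = Suc (2 * (l div 2))" by presburger
    ultimately show ?thesis by metis
  qed
  with y(1) show ?case by blast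
qed

end

section \<open>Coheirs\<close>

lemma ultrafilter_ex:
  assumes fip: "\<And>F. finite F \<Longrightarrow> F \<subseteq> S \<Longrightarrow> \<Inter>F \<noteq> {}"
  shows "\<exists>W. S \<subseteq> W \<and> (\<forall>A. A \<in> W \<or> - A \<in> W) \<and> (\<forall>F. finite F \<longrightarrow> F \<subseteq> W \<longrightarrow> \<Inter>F \<noteq> {})"
proof -
  let ?A = "{W. S \<subseteq> W \<and> (\<forall>F. finite F \<longrightarrow> F \<subseteq> W \<longrightarrow> \<Inter>F \<noteq> {})}"
  have "\<exists>M\<in>?A. \<forall>X\<in>?A. M \<subseteq> X \<longrightarrow> X = M"
  proof (rule subset_Zorn)
    fix C assume C: "subset.chain ?A C"
    show "\<exists>W\<in>?A. \<forall>X\<in>C. X \<subseteq> W"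
    proof (cases "C = {}")
      case True
      then show ?thesis using fip by (intro bexI[of _ S]) auto
    next
      case False
      have "\<Inter>F \<noteq> {}" if F: "finite F" "F \<subseteq> \<Union>C" for F
      proof -
        obtain X where "X \<in> C" "F \<subseteq> X" using finite_subset_Union_chain[OF F False C] by blast
        then show ?thesis using C F(1) unfolding subset_chain_def by blast
      qed
      moreover have "S \<subseteq> \<Union>C" using False C unfolding subset_chain_def by blast
      ultimately show ?thesis by (intro bexI[of _ "\<Union>C"]) auto
    qed
  qed
  then obtain W where W0: "W \<in> ?A" and max0: "\<forall>X\<in>?A. W \<subseteq> X \<longrightarrow> X = W" by (rule bexE)
  have W: "S \<subseteq> W" "finite F \<Longrightarrow> F \<subseteq> W \<Longrightarrow> \<Inter>F \<noteq> {}" for F using W0 by auto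
  have max: "X \<in> ?A \<Longrightarrow> W \<subseteq> X \<Longrightarrow> X = W" for X using bspec[OF max0, of X] by simp
  have bad: "\<exists>F. finite F \<and> F \<subseteq> W \<and> A \<inter> \<Inter>F = {}" if A: "A \<notin> W" for A
  proof -
    have "insert A W \<notin> ?A" using max[of "insert A W"] A by blast
    then obtain F where F: "finite F" "F \<subseteq> insert A W" "\<Inter>F = {}" using W(1) by blast
    have "\<Inter>F = \<Inter>(insert A (F - {A})) \<or> A \<notin> F" by auto
    then have "A \<inter> \<Inter>(F - {A}) = {}" using F(3) by auto
    then show ?thesis using F by (intro exI[of _ "F - {A}"]) auto
  qed
  have "A \<in> W \<or> - A \<in> W" for A
  proof (rule ccontr)
    assume "\<not> (A \<in> W \<or> - A \<in> W)"
    then obtain F1 F2 where F: "finite F1" "F1 \<subseteq> W" "A \<inter> \<Inter>F1 = {}" "finite F2" "F2 \<subseteq> W" "- A \<inter> \<Inter>F2 = {}"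
      using bad by meson
    have "\<Inter>(F1 \<union> F2) \<noteq> {}" using F by (intro W(2)) auto
    then obtain x where "\<forall>Y\<in>F1. x \<in> Y" "\<forall>Y\<in>F2. x \<in> Y" by auto
    then have "x \<in> \<Inter>F1" "x \<in> \<Inter>F2" by auto
    then show False using F(3,6) by blast
  qed
  then show ?thesis using W by blast
qed

locale s1_model = s1_ideal L \<M> \<kappa> I
  for L :: "('f, 'r) language" and \<M> :: "('f, 'r, 'a) struct" and \<kappa> :: "'k rel" and I +
  fixes M :: "'a set"
  assumes elem: "elementary_substructure L M \<M>" and smallM: "small M"
begin

lemma MU: "M \<subseteq> U" by (rule smallD[OF smallM])

lemma range_asg: "range m \<subseteq> M \<Longrightarrow> m \<in> asg"
  using MU by (auto simp: asg_def)

lemma teqI: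
  assumes "\<And>P. dfn B P \<Longrightarrow> P c \<Longrightarrow> P d" shows "teq B c d"
  unfolding teq_def
proof (intro allI impI iffI)
  show "P d" if "dfn B P" "P c" for P using assms that .
  show "P c" if "dfn B P" "P d" for P
    using assms[OF dfn_not[OF that(1)]] that(2) by blast
qed

end

text \<open>\<open>W\<close> encodes a coheir of the type of \<open>cs\<close>: evaluating
  properties at tuples from \<open>M\<close> along \<open>W\<close> gives a type finitely
  satisfiable in \<open>M\<close>. The point \<open>z\<close> is padding for
  \<open>hist\<close>.\<close>

locale coheir = s1_model L \<M> \<kappa> I M
  for L :: "('f, 'r) language" and \<M> :: "('f, 'r, 'a) struct" and \<kappa> :: "'k rel" and I M +
  fixes W :: "(nat \<Rightarrow> 'a) set set" and cs :: "nat \<Rightarrow> 'a" and z :: 'a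
  assumes cs: "cs \<in> asg" and z: "z \<in> M"
    and Wcs: "\<And>P. dfn M P \<Longrightarrow> P cs \<Longrightarrow> {m. range m \<subseteq> M \<and> P m} \<in> W"
    and Wultra: "\<And>A. A \<in> W \<or> - A \<in> W"
    and Wfip: "\<And>F. finite F \<Longrightarrow> F \<subseteq> W \<Longrightarrow> \<Inter>F \<noteq> {}"
begin

lemma W_range: "{m. range m \<subseteq> M} \<in> W"
  using Wcs[of "\<lambda>_. True"] dfn_True[OF MU] by simp

lemma W_mono: "A \<in> W \<Longrightarrow> A \<subseteq> B \<Longrightarrow> B \<in> W"
  using Wultra[of B] Wfip[of "{A, - B}"] by auto

lemma W_Int: "A \<in> W \<Longrightarrow> B \<in> W \<Longrightarrow> A \<inter> B \<in> W"
  using Wultra[of "A \<inter> B"] Wfip[of "{A, B, - (A \<inter> B)}"] by auto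

text \<open>
  \<open>coh w c\<close>: the tuple \<open>c\<close> realizes, over \<open>M\<close> and \<open>w\<close>, the global coheir of the type of \<open>cs\<close>
  over \<open>M\<close> that is given by the ultrafilter \<open>W\<close>.
\<close>

definition coh :: "(nat \<Rightarrow> 'a) \<Rightarrow> (nat \<Rightarrow> 'a) \<Rightarrow> bool" where
  "coh w c \<longleftrightarrow> c \<in> asg \<and> (\<forall>Q. dfn M Q \<longrightarrow> (Q (c \<bowtie> w) \<longleftrightarrow> {m. range m \<subseteq> M \<and> Q (m \<bowtie> w)} \<in> W))"

lemma coh_asg: "coh w c \<Longrightarrow> c \<in> asg" by (simp add: coh_def)

lemma cohD: "coh w c \<Longrightarrow> dfn M Q \<Longrightarrow> Q (c \<bowtie> w) \<longleftrightarrow> {m. range m \<subseteq> M \<and> Q (m \<bowtie> w)} \<in> W"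
  unfolding coh_def by (elim conjE allE[of _ Q]) simp

lemma W_neg: "{m. range m \<subseteq> M \<and> \<not> R m} \<in> W \<longleftrightarrow> {m. range m \<subseteq> M \<and> R m} \<notin> W"
proof
  assume "{m. range m \<subseteq> M \<and> \<not> R m} \<in> W"
  moreover have "{m. range m \<subseteq> M \<and> \<not> R m} \<inter> {m. range m \<subseteq> M \<and> R m} = {}" by blast
  ultimately show "{m. range m \<subseteq> M \<and> R m} \<notin> W"
    using Wfip[of "{{m. range m \<subseteq> M \<and> \<not> R m}, {m. range m \<subseteq> M \<and> R m}}"] by auto
next
  assume "{m. range m \<subseteq> M \<and> R m} \<notin> W"
  then have "- {m. range m \<subseteq> M \<and> R m} \<inter> {m. range m \<subseteq> M} \<in> W"
    using Wultra W_Int W_range by blast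
  then show "{m. range m \<subseteq> M \<and> \<not> R m} \<in> W" by (rule W_mono) blast
qed

text \<open>Finitely many properties that hold along \<open>W\<close> hold together at some tuple
  from \<open>M\<close>, so saturation realizes all of them.\<close>

lemma coh_ex:
  assumes w: "w \<in> asg" shows "\<exists>c. coh w c"
proof -
  define D where "D = {Q. dfn M Q \<and> {m. range m \<subseteq> M \<and> Q (m \<bowtie> w)} \<in> W}"
  define g where "g = (\<lambda>Q v. (Q :: (nat \<Rightarrow> 'a) \<Rightarrow> bool) (v \<bowtie> w))"
  have small: "small (M \<union> range w)" using smallM w by (intro small_Un small_range)
  have "\<exists>v\<in>asg. \<forall>P\<in>g ` D. P v"
  proof (rule realize[OF small])
    fix P assume "P \<in> g ` D"
    then obtain Q where Q: "dfn M Q" "P = g Q" by (auto simp: D_def)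
    have t: "dtm (M \<union> range w) (\<lambda>v. (v \<bowtie> w) n)" for n
      using smallD[OF small] by (cases "even n") (auto simp: ileave_def intro: dtm_var dtm_const)
    have "dfn (M \<union> range w) Q" using dfn_mono[OF Q(1)] smallD[OF small] by simp
    from dfn_sub[OF this t] show "dfn (M \<union> range w) P" by (simp add: Q(2) g_def)
  next
    fix F assume F: "finite F" "F \<subseteq> g ` D"
    from finite_subset_image[OF this] obtain S where S: "S \<subseteq> D" "finite S" "F = g ` S" by blast
    have "\<Inter>((\<lambda>Q. {m. range m \<subseteq> M \<and> Q (m \<bowtie> w)}) ` S \<union> {{m. range m \<subseteq> M}}) \<noteq> {}"
      using S W_range by (intro Wfip) (auto simp: D_def)
    then obtain m where m: "range m \<subseteq> M" "\<And>Q. Q \<in> S \<Longrightarrow> Q (m \<bowtie> w)" by auto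
    then show "\<exists>v\<in>asg. \<forall>P\<in>F. P v"
      using range_asg[OF m(1)] unfolding S(3) by (intro bexI[of _ m]) (auto simp: g_def)
  qed
  then obtain c where c: "c \<in> asg" "\<forall>P\<in>g ` D. P c" by (rule bexE)
  have pos: "Q (c \<bowtie> w)" if "dfn M Q" "{m. range m \<subseteq> M \<and> Q (m \<bowtie> w)} \<in> W" for Q
  proof -
    have "g Q c" using bspec[OF c(2), of "g Q"] that by (simp add: D_def)
    then show ?thesis by (simp add: g_def)
  qed
  have "Q (c \<bowtie> w) \<longleftrightarrow> {m. range m \<subseteq> M \<and> Q (m \<bowtie> w)} \<in> W" if Q: "dfn M Q" for Q
    using pos[OF Q] pos[OF dfn_not[OF Q]] W_neg[of "\<lambda>m. Q (m \<bowtie> w)"] by argo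
  with c(1) show ?thesis unfolding coh_def by (intro exI[of _ c] conjI allI impI)
qed

lemma coh_reindex:
  assumes "coh w c" shows "coh (\<lambda>n. w (f n)) c"
  unfolding coh_def
proof (intro conjI allI impI)
  show "c \<in> asg" using assms by (rule coh_asg)
  fix Q assume Q: "dfn M Q"
  define Q' where "Q' = (\<lambda>v :: nat \<Rightarrow> 'a. Q (\<lambda>k. v (if even k then k else Suc (2 * f (k div 2)))))"
  have "(\<lambda>k. (m \<bowtie> w) (if even k then k else Suc (2 * f (k div 2)))) = m \<bowtie> (\<lambda>n. w (f n))" for m
    by (auto simp: ileave_def fun_eq_iff)
  then have eq: "Q' (m \<bowtie> w) = Q (m \<bowtie> (\<lambda>n. w (f n)))" for m by (simp add: Q'_def)
  have "dfn M Q'" unfolding Q'_def by (rule dfn_reindex[OF Q])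
  from cohD[OF assms this] show "Q (c \<bowtie> (\<lambda>n. w (f n)))
      \<longleftrightarrow> {m. range m \<subseteq> M \<and> Q (m \<bowtie> (\<lambda>n. w (f n)))} \<in> W"
    by (simp add: eq)
qed

text \<open>Invariance of the coheir: \<open>W\<close> tests a property only at tuples from
  \<open>M\<close>, and there the truth value is decided by the type of \<open>w\<close> over
  \<open>M\<close>.\<close>

lemma coh_teq:
  assumes c: "coh w c" "coh w' c'" and w: "teq M w w'"
  shows "teq M (c \<bowtie> w) (c' \<bowtie> w')"
  unfolding teq_def
proof (intro allI impI)
  fix Q assume Q: "dfn M Q"
  have "Q (m \<bowtie> w) = Q (m \<bowtie> w')" if m: "range m \<subseteq> M" for m
  proof -
    have t: "dtm M (\<lambda>v. (m \<bowtie> v) n)" for n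
    proof -
      have "m (n div 2) \<in> M" using m by blast
      then show ?thesis using MU by (cases "even n") (auto simp: ileave_def intro: dtm_var dtm_const)
    qed
    from teqD[OF w dfn_sub[OF Q t]] show ?thesis by simp
  qed
  then have "{m. range m \<subseteq> M \<and> Q (m \<bowtie> w)} = {m. range m \<subseteq> M \<and> Q (m \<bowtie> w')}" by blast
  then show "Q (c \<bowtie> w) = Q (c' \<bowtie> w')" using cohD[OF c(1) Q] cohD[OF c(2) Q] by simp
qed

lemma coh_type:
  assumes "coh w c" shows "teq M cs c"
proof (rule teqI)
  fix P assume P: "dfn M P" "P cs"
  have "dfn M (\<lambda>v. P (\<lambda>k. v (2 * k)))" by (rule dfn_reindex[OF P(1)])
  from cohD[OF assms this] Wcs[OF P] show "P c" by simp
qed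

text \<open>The first \<open>n\<close> tuples of \<open>e\<close>, packed into one tuple and padded with \<open>z\<close>.\<close>

definition hist :: "(nat \<Rightarrow> nat \<Rightarrow> 'a) \<Rightarrow> nat \<Rightarrow> nat \<Rightarrow> 'a" where
  "hist e n = flat (\<lambda>l. if l < n then e l else (\<lambda>_. z))"

lemma hist_simps: "hist e n (prod_encode (l, k)) = (if l < n then e l k else z)"
  by (simp add: hist_def)

lemma hist_cong: "(\<And>l. l < n \<Longrightarrow> e l = e' l) \<Longrightarrow> hist e n = hist e' n"
  unfolding hist_def by (intro arg_cong[of _ _ flat]) auto

lemma hist_asg: "(\<And>l. l < n \<Longrightarrow> e l \<in> asg) \<Longrightarrow> hist e n \<in> asg"
  unfolding hist_def using z MU by (intro asg_flat) auto

lemma fun_prodI: "(\<And>l k. f (prod_encode (l, k)) = g (prod_encode (l, k))) \<Longrightarrow> f = g"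
  by (metis ext prod.collapse prod_decode_inverse)

section \<open>Morley sequences of a coheir\<close>

definition morley :: "nat \<Rightarrow> (nat \<Rightarrow> nat \<Rightarrow> 'a) \<Rightarrow> bool" where
  "morley n e \<longleftrightarrow> (\<forall>i<n. coh (hist e i) (e i))"

lemma morley_hist_asg: "morley n e \<Longrightarrow> i \<le> n \<Longrightarrow> hist e i \<in> asg"
  unfolding morley_def by (intro hist_asg) (metis coh_asg less_le_trans)

text \<open>By \<open>coh_teq\<close>, the type of the next tuple together with the history depends
  only on the type of the history.\<close>

lemma morley_unique: "morley n e \<Longrightarrow> morley n e' \<Longrightarrow> teq M (hist e n) (hist e' n)"
proof (induction n)
  case 0
  have "hist e 0 = hist e' 0" by (simp add: hist_def)
  then show ?case by simp
next
  case (Suc n)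
  then have IH: "teq M (hist e n) (hist e' n)" by (auto simp: morley_def)
  have "coh (hist e n) (e n)" "coh (hist e' n) (e' n)" using Suc.prems by (auto simp: morley_def)
  from coh_teq[OF this IH] have teq: "teq M (e n \<bowtie> hist e n) (e' n \<bowtie> hist e' n)" .
  define f where "f = (\<lambda>p. let (l, k) = prod_decode p in if l = n then 2 * k else Suc (2 * p))"
  have "hist e (Suc n) = (\<lambda>p. (e n \<bowtie> hist e n) (f p))" for e
    by (rule fun_prodI) (auto simp: f_def hist_simps)
  then show ?case using teq_reindex[OF teq, of f] by simp
qed

lemma morley_ex: "\<exists>e. \<forall>n. morley n e"
proof -
  have "\<exists>e. \<forall>n. coh (hist e n) (e n)"
  proof (rule dependent_wellorder_choice)
    show "coh (hist f x) r = coh (hist g x) r" if "\<And>y. y < x \<Longrightarrow> f y = g y" for r f g x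
      using hist_cong[of x f g] that by simp
    show "\<exists>r. coh (hist f x) r" if "\<And>y. y < x \<Longrightarrow> coh (hist f y) (f y)" for x f
      using that by (intro coh_ex hist_asg) (auto dest: coh_asg)
  qed
  then show ?thesis by (auto simp: morley_def)
qed

text \<open>A subsequence of a Morley sequence is again a Morley sequence, and those of equal length
  have the same type.\<close>

lemma morley_indisc:
  assumes e: "\<And>n. morley n e" shows "indisc M e"
  unfolding indisc_def
proof (intro conjI allI impI)
  have coh: "coh (hist e i) (e i)" for i using e[of "Suc i"] by (simp add: morley_def)
  show easg: "e l \<in> asg" for l using coh_asg[OF coh] .
  fix f :: "nat \<Rightarrow> nat" assume f: "strict_mono f"
  let ?e' = "\<lambda>l. e (f l)"
  have coh': "coh (hist ?e' i) (?e' i)" for i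
  proof -
    \<comment> \<open>Rows from \<open>i\<close> on must read the padding \<open>z\<close>. Row
      \<open>f i\<close> of \<open>hist e (f i)\<close> consists of padding, hence the second
      clause.\<close>
    define g where "g = (\<lambda>p. let (l, k) = prod_decode p in
      if l < i then prod_encode (f l, k) else prod_encode (f i, k))"
    have "hist ?e' i = (\<lambda>p. hist e (f i) (g p))"
      by (rule fun_prodI) (use f in \<open>auto simp: g_def hist_simps strict_mono_less\<close>)
    then show ?thesis using coh_reindex[OF coh[of "f i"], of g] by simp
  qed
  show "teq M (flat ?e') (flat e)"
  proof (rule teqI)
    fix P assume P: "dfn M P" "P (flat ?e')"
    obtain K where K: "\<forall>v\<in>asg. \<forall>w\<in>asg. (\<forall>n<K. v n = w n) \<longrightarrow> P v = P w"
      using dfn_supp[OF P(1)] by blast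
    have agree: "\<forall>n<K. flat q n = hist q K n" for q
    proof (intro allI impI)
      fix n assume "n < K"
      then have "fst (prod_decode n) < K"
        using le_prod_encode_1[of "fst (prod_decode n)" "snd (prod_decode n)"] by simp
      then show "flat q n = hist q K n" by (simp add: hist_def flat_def)
    qed
    have mor: "morley K ?e'" using coh' by (simp add: morley_def)
    have asg: "flat q \<in> asg" "hist q K \<in> asg" if "\<And>l. q l \<in> asg" for q
      using that by (auto intro: asg_flat hist_asg)
    have "P (hist ?e' K)" using K asg[of ?e'] agree[of ?e'] easg P(2) by blast
    then have "P (hist e K)" using teqD[OF morley_unique[OF mor e] P(1)] by simp
    then show "P (flat e)" using K asg[of e] agree[of e] easg by blast
  qed
qed

text \<open>Wide types do not divide along Morley sequences: a fibre given by a formula in the type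
  of \<open>a\<close> over \<open>M\<close> and \<open>cs\<close> is outside the ideal, so by
  \<open>S1_many\<close> its copies over \<open>n\<close> terms have a common point, and saturation
  treats all formulas at once.\<close>

lemma wide_nondividing:
  assumes e: "morley n e" and a: "wide (M \<union> range cs) a"
  shows "\<exists>b\<in>U. \<forall>i<n. teq M (b ## e i) (a ## cs)"
proof -
  define D where "D = {P. dfn M P \<and> P (a ## cs)}"
  define X where "X = (\<lambda>P. {y \<in> U. \<forall>i<n. P (y ## e i)})"
  have aU: "a \<in> U" by (rule wide_in[OF a])
  have easg: "hist e n \<in> asg" using morley_hist_asg[OF e] by simp
  have small: "small (M \<union> range (hist e n))" using smallM easg by (intro small_Un small_range)
  have ei: "e i = (\<lambda>k. hist e n (prod_encode (i, k)))" if "i < n" for i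
    using that by (auto simp: hist_simps)
  have Q: "dfn M (\<lambda>w. \<forall>i<n. P (w 0 ## (\<lambda>k. w (Suc (prod_encode (i, k))))))" if P: "dfn M P" for P
  proof (rule dfn_Ball_less[OF MU])
    fix i
    have t: "dtm M (\<lambda>w. (w 0 ## (\<lambda>k. w (Suc (prod_encode (i, k))))) j)" for j
      by (cases j) (auto intro: dtm_var[OF MU])
    from dfn_sub[OF P t] show "dfn M (\<lambda>w. P (w 0 ## (\<lambda>k. w (Suc (prod_encode (i, k))))))" by simp
  qed
  have Xdef: "X P = {y \<in> U. \<forall>i<n. P ((y ## hist e n) 0 ## (\<lambda>k. (y ## hist e n) (Suc (prod_encode (i, k)))))}" for P
    unfolding X_def using ei by auto
  have ne: "\<exists>y\<in>U. y \<in> X P" if P: "P \<in> D" for P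
  proof -
    have dP: "dfn M P" "P (a ## cs)" using P by (simp_all add: D_def)
    \<comment> \<open>\<open>e\<close> is controlled only below \<open>n\<close>, while
      \<open>S1_many\<close> wants an infinite indiscernible sequence. The argument runs on a full
      Morley sequence and is carried over to \<open>e\<close> by uniqueness of the type.\<close>
    obtain m where m: "\<And>n. morley n m" using morley_ex by blast
    have m0: "coh (hist m 0) (m 0)" using m[of 1] by (simp add: morley_def)
    have "\<not> J {y \<in> U. P (y ## cs)}"
      using wideD[OF a definable_fiber[OF dP(1) cs]] dP(2) aU by blast
    then have "\<not> J {y \<in> U. P (y ## m 0)}"
      using J_teq[OF smallM dP(1) cs coh_asg[OF m0] coh_type[OF m0]] by simp
    from S1_many[OF morley_indisc[OF m] dP(1) this, of n]
    obtain y where y: "y \<in> U" "\<forall>l<2 ^ n. P (y ## m l)" by blast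
    have mh: "m i = (\<lambda>k. hist m n (prod_encode (i, k)))" if "i < n" for i
      using that by (auto simp: hist_simps)
    have "\<forall>i<n. P (y ## m i)" using y(2) less_exp[of n] by (meson less_trans)
    then have "\<exists>y\<in>U. \<forall>i<n. P ((y ## hist m n) 0 ## (\<lambda>k. (y ## hist m n) (Suc (prod_encode (i, k)))))"
      using y(1) mh by (intro bexI[of _ y]) auto
    then have "\<exists>y\<in>U. \<forall>i<n. P ((y ## hist e n) 0 ## (\<lambda>k. (y ## hist e n) (Suc (prod_encode (i, k)))))"
      using teqD[OF morley_unique[OF m e] dfn_exs[OF Q[OF dP(1)]]] by simp
    then show ?thesis unfolding Xdef by blast
  qed
  have "\<exists>g\<in>U. \<forall>Y\<in>X ` D. g \<in> Y"
  proof (rule saturation[OF small])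
    fix Y assume "Y \<in> X ` D"
    then obtain P where "P \<in> D" "Y = X P" by blast
    then have P: "dfn M P" "Y = X P" by (simp_all add: D_def)
    show "definable L \<M> (M \<union> range (hist e n)) Y"
      unfolding P(2) Xdef by (rule definable_fiber[OF Q[OF P(1)] easg])
  next
    fix F assume "finite F" "F \<subseteq> X ` D"
    from finite_subset_image[OF this] obtain S where S: "S \<subseteq> D" "finite S" "F = X ` S" by blast
    have dS: "dfn M P" "P (a ## cs)" if "P \<in> S" for P using S(1) that by (auto simp: D_def)
    have "(\<lambda>v. \<forall>P\<in>S. P v) \<in> D"
    proof -
      have "\<forall>P\<in>S. P (a ## cs)"
      proof
        fix P assume "P \<in> S"
        from dS(2)[OF this] show "P (a ## cs)" .
      qed
      with dfn_Ball[of S M "\<lambda>P. P", OF S(2) MU dS(1)] show ?thesis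
        unfolding D_def by (intro CollectI conjI)
    qed
    from ne[OF this] show "\<exists>g\<in>U. \<forall>Y\<in>F. g \<in> Y" unfolding S(3) by (auto simp: X_def)
  qed
  then obtain b where b: "b \<in> U" "\<forall>Y\<in>X ` D. b \<in> Y" by blast
  have "teq M (a ## cs) (b ## e i)" if i: "i < n" for i
  proof (rule teqI)
    fix P assume "dfn M P" "P (a ## cs)"
    then have "b \<in> X P" using b(2) by (simp add: D_def)
    then show "P (b ## e i)" using i by (simp add: X_def)
  qed
  then have "\<forall>i<n. teq M (b ## e i) (a ## cs)" using teq_sym by blast
  with b(1) show ?thesis by blast
qed

end

context s1_model
begin

text \<open>By Tarski-Vaught the type of \<open>c\<close> over \<open>M\<close> is finitely
  satisfiable in \<open>M\<close>, so the solution sets in \<open>M\<close> extend to an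
  ultrafilter.\<close>

lemma coheir_ex:
  assumes c: "c \<in> asg" and z: "z \<in> M" shows "\<exists>W. coheir L \<M> \<kappa> I M W c z"
proof -
  define D where "D = {P. dfn M P \<and> P c}"
  define g where "g = (\<lambda>P. {m :: nat \<Rightarrow> 'a. range m \<subseteq> M \<and> P m})"
  have fip: "\<Inter>F \<noteq> {}" if F: "finite F" "F \<subseteq> g ` D" for F
  proof -
    from finite_subset_image[OF F] obtain S where S: "S \<subseteq> D" "finite S" "F = g ` S" by blast
    have dS: "dfn M P" "P c" if "P \<in> S" for P using S(1) that by (auto simp: D_def)
    have "\<exists>m. range m \<subseteq> M \<and> (\<forall>P\<in>S. P m)"
    proof -
      have "\<forall>P\<in>S. P c"
      proof
        fix P assume "P \<in> S"
        from dS(2)[OF this] show "P c" .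
      qed
      from tarski_vaught[OF elem dfn_Ball[of S M "\<lambda>P. P", OF S(2) MU dS(1)] c this] show ?thesis .
    qed
    then obtain m where m: "range m \<subseteq> M" "\<forall>P\<in>S. P m" by (elim exE conjE)
    have "m \<in> Y" if Y: "Y \<in> F" for Y
    proof -
      obtain P where P: "P \<in> S" "Y = g P" using Y unfolding S(3) by (rule imageE)
      from bspec[OF m(2) P(1)] show ?thesis using m(1) by (simp add: P(2) g_def)
    qed
    then show ?thesis by blast
  qed
  have "\<exists>W. g ` D \<subseteq> W \<and> (\<forall>A. A \<in> W \<or> - A \<in> W) \<and> (\<forall>F. finite F \<longrightarrow> F \<subseteq> W \<longrightarrow> \<Inter>F \<noteq> {})"
    by (rule ultrafilter_ex) (rule fip)
  then obtain W where W: "g ` D \<subseteq> W" "\<forall>A. A \<in> W \<or> - A \<in> W" "\<forall>F. finite F \<longrightarrow> F \<subseteq> W \<longrightarrow> \<Inter>F \<noteq> {}"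
    by (elim exE conjE)
  have "{m. range m \<subseteq> M \<and> P m} \<in> W" if "dfn M P" "P c" for P
  proof -
    have "P \<in> D" using that by (simp add: D_def)
    then have "g P \<in> W" using subsetD[OF W(1) imageI] by simp
    then show ?thesis by (simp add: g_def)
  qed
  then have "coheir L \<M> \<kappa> I M W c z"
    using c z W(2,3) by unfold_locales auto
  then show ?thesis by blast
qed

text \<open>
  If the conclusion fails, one builds \<open>a\<^sub>n\<close> and \<open>c\<^sub>n\<close> such that \<open>(a\<^sub>n, c\<^sub>i)\<close> has the type of
  \<open>(a, c)\<close> for \<open>i < n\<close>, while \<open>c\<^sub>n\<close> realizes the coheir over \<open>a\<^sub>n\<close> and everything earlier. The
  fibres over \<open>(a\<^sub>n, c\<^sub>n)\<close> are then wide, but any two of them meet in a set of the ideal, against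
  \<open>S\<^sub>1\<close>. That the fibres are wide uses that \<open>a\<close> has the type of the entry \<open>c 0\<close>.
\<close>

theorem wide_amalgam:
  assumes c: "c \<in> asg" and \<psi>: "dfn M \<psi>" and \<chi>: "dfn M (\<lambda>v. \<chi> (v 0) (v 1))"
    and nJ: "\<not> J {y \<in> U. \<psi> (y ## c) \<and> \<chi> y (c 0)}"
    and a: "teq M (\<lambda>_. a) (\<lambda>_. c 0)" "wide (M \<union> range c) a"
  shows "\<not> J {y \<in> U. \<psi> (y ## c) \<and> \<chi> y (c 0) \<and> \<chi> y a}"
proof
  assume Ja: "J {y \<in> U. \<psi> (y ## c) \<and> \<chi> y (c 0) \<and> \<chi> y a}"
  obtain z where z: "z \<in> M" using elementary_nonempty[OF elem] by blast
  obtain W where "coheir L \<M> \<kappa> I M W c z" using coheir_ex[OF c z] by blast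
  then interpret coheir L \<M> \<kappa> I M W c z .
  have aU: "a \<in> U" by (rule wide_in[OF a(2)])
  define \<Psi> where "\<Psi> = (\<lambda>v. \<psi> v \<and> \<chi> (v 0) (v 1))"
  define \<Theta> where "\<Theta> = (\<lambda>v. \<Psi> (\<lambda>n. v (if n = 0 then 0 else Suc n)) \<and> \<chi> (v 0) (v 1))"
  have \<Psi>: "dfn M \<Psi>" unfolding \<Psi>_def by (rule dfn_conj[OF \<psi> \<chi>])
  have \<Theta>: "dfn M \<Theta>" unfolding \<Theta>_def by (rule dfn_conj[OF dfn_reindex[OF \<Psi>] \<chi>])
  have \<Psi>_simp: "\<Psi> (y ## d) \<longleftrightarrow> \<psi> (y ## d) \<and> \<chi> y (d 0)" for y d by (simp add: \<Psi>_def)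
  have "(\<lambda>n. (y ## x ## d) (if n = 0 then 0 else Suc n)) = y ## d" for y x :: 'a and d
    by (auto simp: scons_def fun_eq_iff split: nat.splits)
  then have \<Theta>_simp: "\<Theta> (y ## x ## d) \<longleftrightarrow> \<Psi> (y ## d) \<and> \<chi> y x" for y x d
    by (simp add: \<Theta>_def)
  \<comment> \<open>A term \<open>r\<close> holds \<open>a_n\<close> as entry 0 and
    \<open>c_n\<close> as the remaining entries. The separate clause on the type of
    \<open>r 0\<close> matters at \<open>n = 0\<close>, where no earlier \<open>c_i\<close> enforces
    it.\<close>
  define P where "P = (\<lambda>e n r. r \<in> asg \<and> (\<forall>i<n. teq M (r 0 ## (\<lambda>k. e i (Suc k))) (a ## c))
    \<and> teq M (\<lambda>_. r 0) (\<lambda>_. a) \<and> coh (r 0 ## hist e n) (\<lambda>k. r (Suc k)))"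
  have "\<exists>e. \<forall>n. P e n (e n)"
  proof (rule dependent_wellorder_choice)
    show "P f x r = P g x r" if "\<And>y. y < x \<Longrightarrow> f y = g y" for r f g x
      using hist_cong[of x f g] that by (simp add: P_def)
    show "\<exists>r. P e n r" if Pe: "\<And>i. i < n \<Longrightarrow> P e i (e i)" for n e
    proof -
      define c' where "c' = (\<lambda>i k. e i (Suc k))"
      have "coh (hist c' i) (c' i)" if i: "i < n" for i
      proof -
        have coh: "coh (e i 0 ## hist e i) (c' i)" using Pe[OF i] by (simp add: P_def c'_def)
        define f where "f = (\<lambda>p. let (l, k) = prod_decode p in Suc (prod_encode (l, Suc k)))"
        have "hist c' i = (\<lambda>p. (e i 0 ## hist e i) (f p))"
          by (rule fun_prodI) (auto simp: f_def hist_simps c'_def)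
        then show ?thesis using coh_reindex[OF coh, of f] by simp
      qed
      then have mor: "morley n c'" by (simp add: morley_def)
      have "\<exists>b\<in>U. (\<forall>i<n. teq M (b ## c' i) (a ## c)) \<and> teq M (\<lambda>_. b) (\<lambda>_. a)"
      proof (cases "n = 0")
        case False
        obtain b where b: "b \<in> U" "\<forall>i<n. teq M (b ## c' i) (a ## c)"
          using wide_nondividing[OF mor a(2)] by blast
        then have "teq M (b ## c' 0) (a ## c)" using False by blast
        from teq_reindex[OF this, of "\<lambda>_. 0"] have "teq M (\<lambda>_. b) (\<lambda>_. a)" by simp
        with b show ?thesis by blast
      qed (use aU in \<open>auto intro!: bexI[of _ a]\<close>)
      then obtain b where b: "b \<in> U" "\<forall>i<n. teq M (b ## c' i) (a ## c)" "teq M (\<lambda>_. b) (\<lambda>_. a)"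
        by blast
      have "hist e n \<in> asg" using Pe by (intro hist_asg) (simp add: P_def)
      then obtain d where d: "coh (b ## hist e n) d" using coh_ex b(1) asg_scons by blast
      have "P e n (b ## d)" using b d coh_asg[OF d] by (simp add: P_def c'_def)
      then show ?thesis by blast
    qed
  qed
  then obtain e where e: "\<And>n. P e n (e n)" by blast
  have e_eta: "e n = e n 0 ## (\<lambda>k. e n (Suc k))" for n
    by (auto simp: scons_def fun_eq_iff split: nat.splits)
  have easg: "e n \<in> asg" for n using e by (simp add: P_def)
  have coh0: "coh (\<lambda>_. e n 0) (\<lambda>k. e n (Suc k))" for n
    using coh_reindex[of "e n 0 ## hist e n" "\<lambda>k. e n (Suc k)" "\<lambda>_. 0"] e[of n] by (simp add: P_def)
  have ty: "teq M (e n) (x ## d)" if d: "coh (\<lambda>_. x) d" and x: "teq M (\<lambda>_. e n 0) (\<lambda>_. x)" for n x d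
  proof -
    define f where "f = (\<lambda>n :: nat. if n = 0 then Suc 0 else 2 * (n - 1))"
    have f: "(\<lambda>n. (d \<bowtie> (\<lambda>_. x)) (f n)) = x ## d" for d and x :: 'a
      by (auto simp: f_def fun_eq_iff scons_def ileave_def split: nat.splits)
    from teq_reindex[OF coh_teq[OF coh0[of n] d x], of f] show ?thesis
      unfolding f using e_eta[of n] by simp
  qed
  have ea: "teq M (\<lambda>_. e n 0) (\<lambda>_. a)" for n using e[of n] by (simp add: P_def)
  have en0: "teq M (e n) (e 0)" for n
  proof -
    have "teq M (\<lambda>_. e n 0) (\<lambda>_. e 0 0)" by (rule teq_trans[OF ea teq_sym[OF ea]])
    from ty[OF coh0 this] show ?thesis using e_eta[of 0] by simp
  qed
  \<comment> \<open>The start of a Morley sequence of \<open>c\<close> gives a copy of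
    \<open>e 0\<close>: the entry \<open>m 0 0\<close> has the type of \<open>c 0\<close>, hence of
    \<open>a\<close>, and \<open>m 1\<close> realizes the coheir over it. By S1 the fibres of
    \<open>\<Psi>\<close> over \<open>m 0\<close> and \<open>m 1\<close> meet outside the ideal, and
    their intersection lies in the fibre of \<open>\<Theta>\<close> over that copy.\<close>
  have nJ0: "\<not> J {y \<in> U. \<Theta> (y ## e 0)}"
  proof -
    obtain m where m: "\<And>n. morley n m" using morley_ex by blast
    have coh_m: "coh (hist m i) (m i)" for i using m[of "Suc i"] by (simp add: morley_def)
    have masg: "m i \<in> asg" for i by (rule coh_asg[OF coh_m])
    have "\<not> J {y \<in> U. \<Psi> (y ## c)}" using nJ by (simp add: \<Psi>_simp)
    then have "\<not> J {y \<in> U. \<Psi> (y ## m 0)}"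
      using J_teq[OF smallM \<Psi> c masg coh_type[OF coh_m]] by simp
    then have nJ2: "\<not> J ({y \<in> U. \<Psi> (y ## m 0)} \<inter> {y \<in> U. \<Psi> (y ## m 1)})"
      using S1_indisc[OF morley_indisc[OF m] \<Psi>] by blast
    have "coh (\<lambda>_. m 0 0) (m 1)"
      using coh_reindex[OF coh_m[of 1], of "\<lambda>_. prod_encode (0, 0)"] by (simp add: hist_simps)
    moreover have "teq M (\<lambda>_. e 0 0) (\<lambda>_. m 0 0)"
    proof -
      have "teq M (\<lambda>_. c 0) (\<lambda>_. m 0 0)"
        using teq_reindex[OF coh_type[OF coh_m[of 0]], of "\<lambda>_. 0"] .
      then show ?thesis using teq_trans[OF ea teq_trans[OF a(1)]] by blast
    qed
    ultimately have tm: "teq M (e 0) (m 0 0 ## m 1)" by (rule ty)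
    have mm: "m 0 0 ## m 1 \<in> asg" using masg asgD by simp
    have "{y \<in> U. \<Psi> (y ## m 0)} \<inter> {y \<in> U. \<Psi> (y ## m 1)} \<subseteq> {y \<in> U. \<Theta> (y ## m 0 0 ## m 1)}"
      by (auto simp: \<Theta>_simp \<Psi>_simp)
    moreover have "definable L \<M> U ({y \<in> U. \<Psi> (y ## m 0)} \<inter> {y \<in> U. \<Psi> (y ## m 1)})"
    proof -
    have *: "definable L \<M> U {y \<in> U. \<Psi> (y ## m i)}" for i
        using definable_mono[OF definable_fiber[OF \<Psi> masg[of i]], of U] MU masg[of i]
        by (auto simp: asg_range)
    show ?thesis by (rule definable_Int[OF order_refl * *])
    qed
    ultimately have "\<not> J {y \<in> U. \<Theta> (y ## m 0 0 ## m 1)}" using nJ2 J_mono by blast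
    then show ?thesis using J_teq[OF smallM \<Theta> easg mm tm] by simp
  qed
  \<comment> \<open>The \<open>a_n\<close> were arbitrary choices, so \<open>e\<close> itself need
    not be indiscernible. Extraction keeps what is used below: the type of a single term, and the
    type of a later \<open>a_n\<close> with an earlier \<open>c_i\<close>.\<close>
  from extract_indisc[of M e, OF smallM easg] obtain e' where e': "indisc M e'"
    and EM0: "\<forall>P. dfn M P \<longrightarrow> (\<forall>f. strict_mono f \<longrightarrow> P (flat (\<lambda>l. e (f l)))) \<longrightarrow> P (flat e')"
    by (elim exE conjE)
  have EM: "P (flat e')" if "dfn M P" "\<And>f. strict_mono f \<Longrightarrow> P (flat (\<lambda>l. e (f l)))" for P
    using EM0[rule_format, of P, OF that(1) that(2)] .
  have e'asg: "e' l \<in> asg" for l using e' by (simp add: indisc_def)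
  have t0: "teq M (e 0) (e' 0)"
  proof (rule teqI)
    fix P assume P: "dfn M P" "P (e 0)"
    have "P (\<lambda>k. flat e' (prod_encode (0, k)))"
    proof (rule EM[OF dfn_reindex[OF P(1)]])
      fix f :: "nat \<Rightarrow> nat"
      have "P (e (f 0))" using teqD[OF en0 P(1)] P(2) by simp
      then show "P (\<lambda>k. flat (\<lambda>l. e (f l)) (prod_encode (0, k)))" by simp
    qed
    then show "P (e' 0)" by simp
  qed
  have t1: "teq M (a ## c) (e' 1 0 ## (\<lambda>k. e' 0 (Suc k)))"
  proof (rule teqI)
    fix P assume P: "dfn M P" "P (a ## c)"
    define r where "r = (\<lambda>n. if n = 0 then prod_encode (1, 0) else prod_encode (0, n))"
    have r: "(\<lambda>k. flat q (r k)) = q 1 0 ## (\<lambda>k. q 0 (Suc k))" for q :: "nat \<Rightarrow> nat \<Rightarrow> 'a"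
      by (auto simp: r_def scons_def fun_eq_iff split: nat.splits)
    have "P (\<lambda>k. flat e' (r k))"
    proof (rule EM[OF dfn_reindex[OF P(1)]])
      fix f :: "nat \<Rightarrow> nat" assume "strict_mono f"
      then have "f 0 < f 1" by (simp add: strict_mono_less)
      then have "teq M (e (f 1) 0 ## (\<lambda>k. e (f 0) (Suc k))) (a ## c)"
        using e[of "f 1"] by (simp add: P_def)
      from teqD[OF this P(1)] show "P (\<lambda>k. flat (\<lambda>l. e (f l)) (r k))" using P(2) by (simp add: r)
    qed
    then show "P (e' 1 0 ## (\<lambda>k. e' 0 (Suc k)))" by (simp add: r)
  qed
  have casg': "e' 1 0 ## (\<lambda>k. e' 0 (Suc k)) \<in> asg"
    unfolding asg_scons using asgD[OF e'asg] by (auto intro: asgI)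
  have "J {y \<in> U. \<Theta> (y ## a ## c)}" using Ja by (simp add: \<Theta>_simp \<Psi>_simp conj_assoc)
  then have J1: "J {y \<in> U. \<Theta> (y ## e' 1 0 ## (\<lambda>k. e' 0 (Suc k)))}"
    using J_teq[OF smallM \<Theta> _ casg' t1] aU c by simp
  have e'_eta: "e' n = e' n 0 ## (\<lambda>k. e' n (Suc k))" for n
    by (auto simp: scons_def fun_eq_iff split: nat.splits)
  have "\<Theta> (y ## e' n) \<longleftrightarrow> \<Psi> (y ## (\<lambda>k. e' n (Suc k))) \<and> \<chi> y (e' n 0)" for y n
    by (subst e'_eta) (simp add: \<Theta>_simp)
  \<comment> \<open>A point of both fibres satisfies \<open>\<Psi>\<close> at the
    \<open>c\<close>-part of term 0 and \<open>\<chi>\<close> at the \<open>a\<close>-part of term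
    1. Together these parts have the type of \<open>(a, c)\<close>, for which the fibre is in the
    ideal by assumption.\<close>
  then have "{y \<in> U. \<Theta> (y ## e' 0)} \<inter> {y \<in> U. \<Theta> (y ## e' 1)}
      \<subseteq> {y \<in> U. \<Theta> (y ## e' 1 0 ## (\<lambda>k. e' 0 (Suc k)))}" by (auto simp: \<Theta>_simp)
  moreover have "definable L \<M> U ({y \<in> U. \<Theta> (y ## e' 0)} \<inter> {y \<in> U. \<Theta> (y ## e' 1)})"
  proof -
    have *: "definable L \<M> U {y \<in> U. \<Theta> (y ## e' i)}" for i
      using definable_mono[OF definable_fiber[OF \<Theta> e'asg[of i]], of U] MU e'asg[of i]
      by (auto simp: asg_range)
    show ?thesis by (rule definable_Int[OF order_refl * *])
  qed
  ultimately have "J ({y \<in> U. \<Theta> (y ## e' 0)} \<inter> {y \<in> U. \<Theta> (y ## e' 1)})" using J1 J_mono by blast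
  then have "J {y \<in> U. \<Theta> (y ## e' 0)}" by (rule S1_indisc[OF e' \<Theta>])
  then show False using nJ0 J_teq[OF smallM \<Theta> easg e'asg t0] by simp
qed

end

section \<open>Stationarity\<close>

lemma map_upt_Suc: "map g [1..<Suc (Suc k)] = map g [1..<Suc k] @ [g (Suc k)]"
  by simp

context s1_model
begin

definition tpeq :: "'a \<Rightarrow> 'a \<Rightarrow> bool" where
  "tpeq a b \<longleftrightarrow> (\<forall>X. definable L \<M> M X \<longrightarrow> (a \<in> X \<longleftrightarrow> b \<in> X))"

lemma tpeq_refl [simp]: "tpeq a a" by (simp add: tpeq_def)

lemma tpeq_sym: "tpeq a b \<Longrightarrow> tpeq b a" by (simp add: tpeq_def)

lemma tpeq_trans: "tpeq a b \<Longrightarrow> tpeq b c \<Longrightarrow> tpeq a c" by (simp add: tpeq_def)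

lemma tpeqD: "tpeq a b \<Longrightarrow> definable L \<M> M X \<Longrightarrow> a \<in> X \<longleftrightarrow> b \<in> X" by (simp add: tpeq_def)

lemma tpeq_teq: assumes "tpeq a b" "a \<in> U" shows "teq M (\<lambda>_. a) (\<lambda>_. b)"
proof (rule teqI)
  fix P assume P: "dfn M P" "P (\<lambda>_. a)"
  have "definable L \<M> M {y \<in> U. P (\<lambda>_. y)}"
    using dfn_reindex[OF P(1), of "\<lambda>_. 0"] by (rule definableI)
  from tpeqD[OF assms(1) this] show "P (\<lambda>_. b)" using P(2) assms(2) by simp
qed

lemma tpeq_in: "tpeq a b \<Longrightarrow> a \<in> U \<Longrightarrow> b \<in> U"
  using tpeqD definable_U[OF MU] by blast

lemma wide_tpeq: "wide M a \<Longrightarrow> tpeq a b \<Longrightarrow> wide M b"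
  using tpeq_in unfolding wide_def tpeq_def by blast

lemma small_insert: "small B \<Longrightarrow> x \<in> U \<Longrightarrow> small (insert x B)"
  using small_Un[OF small_finite[of "{x}"]] by simp

lemma small_Mset: "set xs \<subseteq> U \<Longrightarrow> small (M \<union> set xs)"
  using smallM small_Un small_finite by blast

definition windep :: "'a list \<Rightarrow> bool" where
  "windep cs \<longleftrightarrow> (\<forall>i<length cs. wide (M \<union> set (take i cs)) (cs ! i))"

lemma windep_Nil [simp]: "windep []" by (simp add: windep_def)

lemma windep_snoc: "windep (cs @ [x]) \<longleftrightarrow> windep cs \<and> wide (M \<union> set cs) x"
  unfolding windep_def by (auto simp: less_Suc_eq nth_append)

lemma windep_in: "windep cs \<Longrightarrow> set cs \<subseteq> U"
proof
  fix x assume "windep cs" "x \<in> set cs"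
  then show "x \<in> U" unfolding windep_def in_set_conv_nth using wide_in by blast
qed

lemma wide_realize:
  assumes b: "wide M b" and B: "small B" "M \<subseteq> B"
  shows "\<exists>b'. tpeq b b' \<and> wide B b'"
proof -
  let ?X = "{X. definable L \<M> M X \<and> b \<in> X}"
  have "\<exists>b'. wide B b' \<and> (\<forall>X\<in>?X. b' \<in> X)"
  proof (rule wide_ext[OF B(1)])
    show "definable L \<M> B X" if "X \<in> ?X" for X using that definable_mono B(2) by blast
    fix F assume "finite F" "F \<subseteq> ?X"
    then have "definable L \<M> M {y \<in> U. \<forall>X\<in>F. y \<in> X}" "b \<in> {y \<in> U. \<forall>X\<in>F. y \<in> X}"
      using wide_in[OF b] by (auto intro: definable_Ball[OF _ MU])
    then show "\<not> J {y \<in> U. \<forall>X\<in>F. y \<in> X}" using wideD[OF b] by blast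
  qed
  then obtain b' where b': "wide B b'" "\<And>X. definable L \<M> M X \<Longrightarrow> b \<in> X \<Longrightarrow> b' \<in> X" by blast
  have "b \<in> X" if "definable L \<M> M X" "b' \<in> X" for X
    using b'(2)[of "U - X"] that definable_Diff[OF MU definable_U[OF MU] that(1)] wide_in[OF b] by blast
  then show ?thesis using b' unfolding tpeq_def by blast
qed

section \<open>Iterated amalgamation and ladders\<close>

lemma amalgam_set:
  assumes R: "dfn M (\<lambda>v. R (v 0) (v 1))" and ab: "a \<in> U" "wide (M \<union> {a}) b" "R b a"
  shows "windep as \<Longrightarrow> (\<And>x. x \<in> set as \<Longrightarrow> tpeq a x) \<Longrightarrow>
    dfn M (\<lambda>v. \<theta> (v 0)) \<Longrightarrow> \<theta> b \<Longrightarrow> \<not> J {y \<in> U. \<theta> y \<and> (\<forall>x\<in>set as. R y x)}"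
proof (induction as rule: rev_induct)
  case Nil
  have "definable L \<M> (M \<union> {a}) {y \<in> U. \<theta> y}"
    using definable_mono[OF definableI[OF Nil(3)]] by blast
  then show ?case using wideD[OF ab(2)] Nil(4) wide_in[OF ab(2)] by simp
next
  case (snoc x as)
  have as: "windep as" "wide (M \<union> set as) x" using snoc.prems(1) by (auto simp: windep_snoc)
  have IH: "\<not> J {y \<in> U. \<theta> y \<and> (\<forall>x\<in>set as. R y x)}" using snoc as by auto
  have xU: "x \<in> U" by (rule wide_in[OF as(2)])
  have ax: "tpeq a x" using snoc.prems(2) by simp
  show ?case
  proof (cases "as = []")
    case True
    have P: "dfn M (\<lambda>v. \<theta> (v 0) \<and> R (v 0) (v 1))" by (rule dfn_conj[OF snoc.prems(3) R])
    have "definable L \<M> (M \<union> {a}) {y \<in> U. \<theta> y \<and> R y a}"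
      using definable_fiber[OF P, of "\<lambda>_. a"] ab(1) by simp
    then have "\<not> J {y \<in> U. \<theta> y \<and> R y a}"
      using wideD[OF ab(2)] snoc.prems(4) ab(3) wide_in[OF ab(2)] by blast
    then show ?thesis
      using J_teq[OF smallM P _ _ tpeq_teq[OF ax ab(1)]] ab(1) xU True by simp
  next
    case False
    \<comment> \<open>The finite list becomes an infinite tuple padded with its first element. Entry
      0 is a conjugate of the new element \<open>x\<close>, as \<open>wide_amalgam\<close> requires,
      and \<open>\<psi>\<close> records the relation to the whole list.\<close>
    define c where "c = (\<lambda>n. if n < length as then as ! n else as ! 0)"
    have rc: "range c = set as"
      using False unfolding c_def set_conv_nth by (auto simp: image_iff)
    have casg: "c \<in> asg" using windep_in[OF as(1)] rc asg_range by blast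
    define \<psi> where "\<psi> = (\<lambda>v. \<theta> (v 0) \<and> (\<forall>i<length as. R (v 0) (v (Suc i))))"
    have "dfn M (\<lambda>v. R (v 0) (v (Suc i)))" for i
      using dfn_reindex[OF R, of "\<lambda>n. if n = 0 then 0 else Suc i"] by simp
    then have \<psi>: "dfn M \<psi>" unfolding \<psi>_def by (intro dfn_conj snoc.prems(3) dfn_Ball_less MU)
    have c0: "c 0 \<in> set as" using rc by blast
    have \<psi>c: "\<psi> (y ## c) \<longleftrightarrow> \<theta> y \<and> (\<forall>x\<in>set as. R y x)" for y
      by (auto simp: \<psi>_def c_def all_set_conv_all_nth)
    have "teq M (\<lambda>_. x) (\<lambda>_. c 0)"
      using c0 snoc.prems(2)[of "c 0"] ax xU by (intro tpeq_teq) (auto intro: tpeq_trans tpeq_sym)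
    moreover have "\<not> J {y \<in> U. \<psi> (y ## c) \<and> R y (c 0)}"
      using IH c0 unfolding \<psi>c by (auto elim!: back_subst[of "\<lambda>X. \<not> J X"])
    ultimately have "\<not> J {y \<in> U. \<psi> (y ## c) \<and> R y (c 0) \<and> R y x}"
      using as(2) rc by (intro wide_amalgam[OF casg \<psi> R]) auto
    moreover have "{y \<in> U. \<psi> (y ## c) \<and> R y (c 0) \<and> R y x} = {y \<in> U. \<theta> y \<and> (\<forall>x\<in>set (as @ [x]). R y x)}"
      using c0 unfolding \<psi>c by auto
    ultimately show ?thesis by simp
  qed
qed

text \<open>To keep the whole type of \<open>b\<close>, \<open>amalgam_set\<close> is applied with
  \<open>\<theta>\<close> a conjunction of finitely many formulas of that type;
  \<open>wide_ext\<close> then finds one point for all of them.\<close>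

lemma amalgam_step:
  assumes R: "dfn M (\<lambda>v. R (v 0) (v 1))" and ab: "a \<in> U" "wide (M \<union> {a}) b" "R b a"
    and as: "windep as" "\<And>x. x \<in> set as \<Longrightarrow> tpeq a x"
    and B: "small B" "M \<union> set as \<subseteq> B"
  shows "\<exists>b'. wide B b' \<and> tpeq b b' \<and> (\<forall>x\<in>set as. R b' x)"
proof -
  let ?X = "{X. definable L \<M> M X \<and> b \<in> X}" and ?Y = "(\<lambda>x. {y \<in> U. R y x}) ` set as"
  have BU: "B \<subseteq> U" by (rule smallD[OF B(1)])
  have defR: "definable L \<M> (M \<union> set as) {y \<in> U. R y x}" if x: "x \<in> set as" for x
  proof -
    have xU: "x \<in> U" using x B(2) BU by blast
    show ?thesis
      using definable_mono[OF definable_fiber[OF R, of "\<lambda>_. x"], of "M \<union> set as"] xU x by simp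
  qed
  have "\<exists>b'. wide B b' \<and> (\<forall>X\<in>?X \<union> ?Y. b' \<in> X)"
  proof (rule wide_ext[OF B(1)])
    show "definable L \<M> B X" if "X \<in> ?X \<union> ?Y" for X
    proof -
      have "definable L \<M> (M \<union> set as) X" using that defR definable_mono[of M X "M \<union> set as"] by blast
      then show ?thesis using definable_mono B(2) by blast
    qed
    fix F assume F: "finite F" "F \<subseteq> ?X \<union> ?Y"
    define \<theta> where "\<theta> = (\<lambda>y. \<forall>X\<in>F \<inter> ?X. y \<in> X)"
    have \<theta>: "dfn M (\<lambda>v. \<theta> (v 0))" unfolding \<theta>_def
      using F(1) by (intro dfn_Ball) (auto intro: definable_dfn[OF _ MU] simp: MU)
    let ?S = "{y \<in> U. \<theta> y \<and> (\<forall>x\<in>set as. R y x)}"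
    have nJ: "\<not> J ?S" by (rule amalgam_set[OF R ab as \<theta>]) (auto simp: \<theta>_def)
    have MB: "M \<union> set as \<subseteq> U" using B(2) BU by blast
    have "definable L \<M> (M \<union> set as) {y \<in> U. \<forall>X\<in>?Y. y \<in> X}"
      using defR MB by (intro definable_Ball) auto
    from definable_Int[OF MB definable_mono[OF definableI[OF \<theta>] Un_upper1] this]
    have "definable L \<M> (M \<union> set as) ({y \<in> U. \<theta> y} \<inter> {y \<in> U. \<forall>X\<in>?Y. y \<in> X})" .
    moreover have "{y \<in> U. \<theta> y} \<inter> {y \<in> U. \<forall>X\<in>?Y. y \<in> X} = ?S" by auto
    ultimately have "definable L \<M> (M \<union> set as) ?S" by (simp only:)
    moreover have "?S \<subseteq> {y \<in> U. \<forall>X\<in>F. y \<in> X}" using F(2) unfolding \<theta>_def by blast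
    ultimately show "\<not> J {y \<in> U. \<forall>X\<in>F. y \<in> X}" using nJ J_mono' B(2) BU by blast
  qed
  then obtain b' where b0: "wide B b'" "\<forall>X\<in>?X \<union> ?Y. b' \<in> X" by blast
  have b': "wide B b'" "definable L \<M> M X \<Longrightarrow> b \<in> X \<Longrightarrow> b' \<in> X" for X using b0 by auto
  have Rb': "R b' x" if "x \<in> set as" for x
  proof -
    have "{y \<in> U. R y x} \<in> ?X \<union> ?Y" using that by blast
    from bspec[OF b0(2) this] show ?thesis by simp
  qed
  have "b \<in> X" if "definable L \<M> M X" "b' \<in> X" for X
    using b'(2)[of "U - X"] that definable_Diff[OF MU definable_U[OF MU] that(1)] wide_in[OF ab(2)] by blast
  then show ?thesis using b' Rb' unfolding tpeq_def by blast
qed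

definition chain :: "('a \<Rightarrow> 'a \<Rightarrow> bool) \<Rightarrow> nat \<Rightarrow> (nat \<Rightarrow> 'a) \<Rightarrow> (nat \<Rightarrow> 'a) \<Rightarrow> bool" where
  "chain R k \<alpha> \<beta> \<longleftrightarrow> windep (concat (map (\<lambda>i. [\<alpha> i, \<beta> i]) [1..<Suc k])) \<and>
     (\<forall>i\<in>{1..k}. \<forall>j\<in>{1..k}. R (\<beta> j) (\<alpha> i) \<longleftrightarrow> i \<le> j)"

text \<open>Each new rung is found in two moves. A copy of \<open>a'\<close> with \<open>R\<close>
  false at all earlier \<open>\<beta> j\<close> comes from the pair in which \<open>a'\<close> is
  wide over \<open>b'\<close>; then a copy of \<open>b\<close> with \<open>R\<close> true at all
  \<open>\<alpha> i\<close>, the new one included, comes from the pair in which \<open>b\<close> is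
  wide over \<open>a\<close>. Amalgamation requires the \<open>\<alpha> i\<close> alone and the
  \<open>\<beta> j\<close> alone to be independent, hence the stronger induction statement.\<close>

lemma chain_ex:
  assumes R: "dfn M (\<lambda>v. R (v 0) (v 1))"
    and ab: "a \<in> U" "wide (M \<union> {a}) b" "R b a"
    and ab': "b' \<in> U" "wide (M \<union> {b'}) a'" "\<not> R b' a'"
    and eq: "tpeq a a'" "tpeq b b'"
  shows "\<exists>\<alpha> \<beta>. chain R k \<alpha> \<beta>"
proof -
  have R': "dfn M (\<lambda>v. \<not> R (v 1) (v 0))"
    using dfn_not[OF dfn_reindex[OF R, of "\<lambda>n. if n = 0 then 1 else 0"]] by simp
  have "\<exists>\<alpha> \<beta>. chain R k \<alpha> \<beta> \<and> windep (map \<alpha> [1..<Suc k]) \<and> windep (map \<beta> [1..<Suc k])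
    \<and> (\<forall>i\<in>{1..k}. tpeq a (\<alpha> i) \<and> tpeq b (\<beta> i))" for k
  proof (induction k)
    case 0
    show ?case by (auto simp: chain_def)
  next
    case (Suc k)
    then obtain \<alpha> \<beta> where ch: "chain R k \<alpha> \<beta>" and as: "windep (map \<alpha> [1..<Suc k])"
      and bs: "windep (map \<beta> [1..<Suc k])" and ty: "\<And>i. i \<in> {1..k} \<Longrightarrow> tpeq a (\<alpha> i) \<and> tpeq b (\<beta> i)" by blast
    let ?cs = "concat (map (\<lambda>i. [\<alpha> i, \<beta> i]) [1..<Suc k])"
    have cs: "windep ?cs" using ch by (simp add: chain_def)
    have sets: "set ?cs = \<alpha> ` {1..k} \<union> \<beta> ` {1..k}" "set (map \<alpha> [1..<Suc k]) = \<alpha> ` {1..k}"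
      "set (map \<beta> [1..<Suc k]) = \<beta> ` {1..k}" by auto
    have small1: "small (M \<union> set ?cs)" using windep_in[OF cs] by (rule small_Mset)
    have "\<exists>x. wide (M \<union> set ?cs) x \<and> tpeq a' x \<and> (\<forall>y\<in>set (map \<beta> [1..<Suc k]). \<not> R y x)"
    proof (rule amalgam_step[OF R' ab' bs _ small1])
      show "tpeq b' x" if "x \<in> set (map \<beta> [1..<Suc k])" for x
        using that ty eq(2) unfolding sets by (auto intro: tpeq_trans tpeq_sym)
    qed (auto simp: sets)
    then obtain x where x: "wide (M \<union> set ?cs) x" "tpeq a' x" "\<And>j. j \<in> {1..k} \<Longrightarrow> \<not> R (\<beta> j) x"
      unfolding sets by auto
    have ax: "tpeq a x" using eq(1) x(2) by (rule tpeq_trans)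
    have as': "windep (map \<alpha> [1..<Suc k] @ [x])"
      unfolding windep_snoc using as x(1) by (auto simp: sets elim: wide_mono)
    have small2: "small (M \<union> set (?cs @ [x]))"
      using windep_in[OF cs] wide_in[OF x(1)] by (intro small_Mset) auto
    have "\<exists>y. wide (M \<union> set (?cs @ [x])) y \<and> tpeq b y \<and> (\<forall>z\<in>set (map \<alpha> [1..<Suc k] @ [x]). R y z)"
    proof (rule amalgam_step[OF R ab as' _ small2])
      show "tpeq a z" if "z \<in> set (map \<alpha> [1..<Suc k] @ [x])" for z
        using that ty ax by auto
    qed (auto simp: sets)
    then obtain y where y: "wide (M \<union> set (?cs @ [x])) y" "tpeq b y"
      and Ry: "\<forall>z\<in>set (map \<alpha> [1..<Suc k] @ [x]). R y z" by blast
    have y': "R y x" "i \<in> {1..k} \<Longrightarrow> R y (\<alpha> i)" for i using Ry unfolding set_append sets by auto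
    define \<alpha>' where "\<alpha>' = \<alpha>(Suc k := x)"
    define \<beta>' where "\<beta>' = \<beta>(Suc k := y)"
    have maps: "map \<alpha>' [1..<Suc (Suc k)] = map \<alpha> [1..<Suc k] @ [x]"
      "map \<beta>' [1..<Suc (Suc k)] = map \<beta> [1..<Suc k] @ [y]"
      "concat (map (\<lambda>i. [\<alpha>' i, \<beta>' i]) [1..<Suc (Suc k)]) = (?cs @ [x]) @ [y]"
    proof -
      have "map (\<lambda>i. [\<alpha>' i, \<beta>' i]) [1..<Suc k] = map (\<lambda>i. [\<alpha> i, \<beta> i]) [1..<Suc k]"
        "map \<alpha>' [1..<Suc k] = map \<alpha> [1..<Suc k]" "map \<beta>' [1..<Suc k] = map \<beta> [1..<Suc k]"
        by (simp_all add: \<alpha>'_def \<beta>'_def del: upt_Suc)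
      moreover have "\<alpha>' (Suc k) = x" "\<beta>' (Suc k) = y" by (simp_all add: \<alpha>'_def \<beta>'_def)
      ultimately show "map \<alpha>' [1..<Suc (Suc k)] = map \<alpha> [1..<Suc k] @ [x]"
        "map \<beta>' [1..<Suc (Suc k)] = map \<beta> [1..<Suc k] @ [y]"
        "concat (map (\<lambda>i. [\<alpha>' i, \<beta>' i]) [1..<Suc (Suc k)]) = (?cs @ [x]) @ [y]"
        by (simp_all only: map_upt_Suc concat_append concat.simps append_Nil2 append_assoc append.simps)
    qed
    have "windep ((?cs @ [x]) @ [y])"
      unfolding windep_snoc[of "?cs @ [x]"] windep_snoc[of ?cs] using cs x(1) y(1) by blast
    moreover have "R (\<beta>' j) (\<alpha>' i) \<longleftrightarrow> i \<le> j" if "i \<in> {1..Suc k}" "j \<in> {1..Suc k}" for i j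
    proof -
      have "R (\<beta> j) (\<alpha> i) \<longleftrightarrow> i \<le> j" if "i \<in> {1..k}" "j \<in> {1..k}" for i j
        using ch that unfolding chain_def by blast
      then show ?thesis using that x(3) y' by (auto simp: \<alpha>'_def \<beta>'_def le_Suc_eq)
    qed
    ultimately have "chain R (Suc k) \<alpha>' \<beta>'" unfolding chain_def maps by blast
    moreover have "windep (map \<beta>' [1..<Suc (Suc k)])"
      unfolding maps windep_snoc using bs y(1) by (auto simp: sets elim: wide_mono)
    moreover have "windep (map \<alpha>' [1..<Suc (Suc k)])" unfolding maps by (rule as')
    moreover have "\<forall>i\<in>{1..Suc k}. tpeq a (\<alpha>' i) \<and> tpeq b (\<beta>' i)"
      using ty ax y(2) by (auto simp: \<alpha>'_def \<beta>'_def le_Suc_eq)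
    ultimately show ?case by blast
  qed
  then show ?thesis by blast
qed

end

text \<open>The two assumptions correspond to the two orders in the definition of stability: a
  ladder for the relation with exchanged arguments, relabelled backwards, is a ladder for the
  relation itself whose reversed listing is independent.\<close>

locale stable_rel = s1_model L \<M> \<kappa> I M
  for L :: "('f, 'r) language" and \<M> :: "('f, 'r, 'a) struct" and \<kappa> :: "'k rel" and I M +
  fixes R :: "'a \<Rightarrow> 'a \<Rightarrow> bool" and k :: nat
  assumes R: "dfn M (\<lambda>v. R (v 0) (v 1))"
    and nochain: "\<not> chain R k \<alpha> \<beta>" "\<not> chain (\<lambda>y x. R x y) k \<alpha> \<beta>"
begin

text \<open>A disagreement supplies the two pairs between which \<open>chain_ex\<close> alternates.
  Which of the two excluded ladders results depends on which pair satisfies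
  \<open>R\<close>.\<close>

lemma stationary_mixed:
  assumes "wide (M \<union> {a}) b" "wide (M \<union> {b'}) a'" "tpeq a a'" "tpeq b b'"
  shows "R b a \<longleftrightarrow> R b' a'"
proof -
  have U: "a \<in> U" "b \<in> U" "a' \<in> U" "b' \<in> U"
    using assms wide_in tpeq_in tpeq_sym by blast+
  have "False" if "R b a" "\<not> R b' a'"
    using chain_ex[OF R U(1) assms(1) that(1) U(4) assms(2) that(2) assms(3,4)] nochain(1) by blast
  moreover have False if "\<not> R b a" "R b' a'"
  proof -
    have R': "dfn M (\<lambda>v. R (v 1) (v 0))"
      using dfn_reindex[OF R, of "\<lambda>n. if n = 0 then 1 else 0"] by simp
    from chain_ex[where R = "\<lambda>y x. R x y", OF R' U(4) assms(2) that(2) U(1) assms(1) that(1)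
        tpeq_sym[OF assms(4)] tpeq_sym[OF assms(3)]]
    show False using nochain(2) by blast
  qed
  ultimately show ?thesis by blast
qed

definition free :: "'a \<Rightarrow> 'a \<Rightarrow> bool" where
  "free a b \<longleftrightarrow> wide M a \<and> wide M b \<and> (wide (M \<union> {a}) b \<or> wide (M \<union> {b}) a)"

lemma freeI1: "wide M a \<Longrightarrow> wide (M \<union> {a}) b \<Longrightarrow> free a b"
  unfolding free_def using wide_mono by blast

lemma freeI2: "wide M b \<Longrightarrow> wide (M \<union> {b}) a \<Longrightarrow> free a b"
  unfolding free_def using wide_mono by blast

text \<open>Opposite orientations are covered by \<open>stationary_mixed\<close>. Two pairs of the
  same orientation are each compared with an auxiliary pair of the opposite one.\<close>

lemma stationary:
  assumes f: "free a b" "free a' b'" and eq: "tpeq a a'" "tpeq b b'"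
  shows "R b a \<longleftrightarrow> R b' a'"
proof -
  have w: "wide M a" "wide M b" "wide M a'" "wide M b'" using f by (auto simp: free_def)
  consider (m1) "wide (M \<union> {a}) b" "wide (M \<union> {b'}) a'" | (m2) "wide (M \<union> {b}) a" "wide (M \<union> {a'}) b'"
    | (s1) "wide (M \<union> {a}) b" "wide (M \<union> {a'}) b'" | (s2) "wide (M \<union> {b}) a" "wide (M \<union> {b'}) a'"
    using f by (auto simp: free_def)
  then show ?thesis
  proof cases
    case m1
    then show ?thesis using stationary_mixed eq by blast
  next
    case m2
    then show ?thesis using stationary_mixed eq tpeq_sym by blast
  next
    case s1
    have "small (M \<union> {b})" using small_insert[OF smallM wide_in[OF w(2)]] by simp
    then obtain c where c: "tpeq a c" "wide (M \<union> {b}) c" using wide_realize[OF w(1)] by blast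
    then have "R b a = R b c" using stationary_mixed[OF s1(1) c(2) c(1)] by simp
    moreover have "R b' a' = R b c"
      by (rule stationary_mixed[OF s1(2) c(2)]) (use eq c(1) tpeq_sym tpeq_trans in blast)+
    ultimately show ?thesis by simp
  next
    case s2
    have "small (M \<union> {a})" using small_insert[OF smallM wide_in[OF w(1)]] by simp
    then obtain c where c: "tpeq b c" "wide (M \<union> {a}) c" using wide_realize[OF w(2)] by blast
    have "R c a = R b a"
      by (rule stationary_mixed[OF c(2) s2(1)]) (use eq c(1) tpeq_sym in auto)
    moreover have "R c a = R b' a'"
      by (rule stationary_mixed[OF c(2) s2(2)]) (use eq c(1) tpeq_sym tpeq_trans in blast)+
    ultimately show ?thesis by simp
  qed
qed

text \<open>The truth value of \<open>R\<close> on independent realizations of the types of \<open>b\<close> and \<open>a\<close>.\<close>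

definition F :: "'a \<Rightarrow> 'a \<Rightarrow> bool" where
  "F a b \<longleftrightarrow> (\<exists>b'. tpeq b b' \<and> wide (M \<union> {a}) b' \<and> R b' a)"

lemma F_eq:
  assumes "free a b" shows "F a b \<longleftrightarrow> R b a"
proof -
  have w: "wide M a" "wide M b" using assms by (auto simp: free_def)
  have "small (M \<union> {a})" using small_insert[OF smallM wide_in[OF w(1)]] by simp
  then obtain c where c: "tpeq b c" "wide (M \<union> {a}) c" using wide_realize[OF w(2)] by blast
  have "R b' a = R b a" if "tpeq b b'" "wide (M \<union> {a}) b'" for b'
    by (rule stationary[OF freeI1[OF w(1) that(2)] assms]) (use that tpeq_sym in auto)
  then show ?thesis using c unfolding F_def by blast
qed

lemma free_ex: "wide M a \<Longrightarrow> wide M b \<Longrightarrow> \<exists>b'. tpeq b b' \<and> wide (M \<union> {a}) b'"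
  using wide_realize[of b "M \<union> {a}"] small_insert[OF smallM wide_in[of M a]] by auto

lemma F_tpeq:
  assumes "wide M a" "wide M b" "tpeq a a'" "tpeq b b'"
  shows "F a b \<longleftrightarrow> F a' b'"
proof -
  have w: "wide M a'" "wide M b'" using assms wide_tpeq by blast+
  obtain c where c: "tpeq b c" "wide (M \<union> {a}) c" using free_ex assms(1,2) by blast
  obtain d where d: "tpeq b' d" "wide (M \<union> {a'}) d" using free_ex w by blast
  have cd: "tpeq c d" "tpeq c b" "tpeq b' d" using c d assms(4) tpeq_trans tpeq_sym by blast+
  have F: "F a e \<longleftrightarrow> F a f" if "tpeq e f" for a e f
    unfolding F_def using that tpeq_trans tpeq_sym by meson
  have fc: "free a c" "free a' d" using freeI1 c(2) d(2) assms(1) w(1) by blast+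
  have "F a b = F a c" using F c(1) .
  also have "\<dots> = R c a" using F_eq fc by blast
  also have "\<dots> = R d a'" by (rule stationary[OF fc assms(3) cd(1)])
  also have "\<dots> = F a' d" using F_eq fc by blast
  also have "\<dots> = F a' b'" using F d(1) by blast
  finally show ?thesis .
qed

text \<open>The types of the ladder are realized by an independent sequence in the order of the
  rungs. Any \<open>\<alpha> i\<close> and \<open>\<beta> j\<close> are then free in one orientation
  or the other, so \<open>F\<close> can be read as \<open>R\<close> and an excluded chain
  appears.\<close>

lemma F_no_ladder:
  assumes "\<And>i. i \<in> {1..k} \<Longrightarrow> wide M (a i) \<and> wide M (b i)"
    and lad: "\<And>i j. i \<in> {1..k} \<Longrightarrow> j \<in> {1..k} \<Longrightarrow> F (a i) (b j) \<longleftrightarrow> i \<le> j"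
  shows False
proof -
  have "\<exists>\<alpha> \<beta>. windep (concat (map (\<lambda>i. [\<alpha> i, \<beta> i]) [1..<Suc n])) \<and>
    (\<forall>i\<in>{1..n}. tpeq (a i) (\<alpha> i) \<and> tpeq (b i) (\<beta> i)) \<and> (\<forall>i\<in>{1..n}. \<forall>j\<in>{1..n}. free (\<alpha> i) (\<beta> j))"
    if "n \<le> k" for n
    using that
  proof (induction n)
    case 0
    show ?case by auto
  next
    case (Suc n)
    let ?cs = "\<lambda>\<alpha> \<beta>. concat (map (\<lambda>i. [\<alpha> i, \<beta> i]) [1..<Suc n])"
    from Suc obtain \<alpha> \<beta> where cs: "windep (?cs \<alpha> \<beta>)"
      and ty: "\<And>i. i \<in> {1..n} \<Longrightarrow> tpeq (a i) (\<alpha> i) \<and> tpeq (b i) (\<beta> i)"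
      and fr: "\<And>i j. i \<in> {1..n} \<Longrightarrow> j \<in> {1..n} \<Longrightarrow> free (\<alpha> i) (\<beta> j)" by auto
    have w: "wide M (a (Suc n))" "wide M (b (Suc n))" using assms(1) Suc.prems by auto
    obtain x where x: "tpeq (a (Suc n)) x" "wide (M \<union> set (?cs \<alpha> \<beta>)) x"
      using wide_realize[OF w(1) small_Mset[OF windep_in[OF cs]]] by blast
    have cs1: "windep (?cs \<alpha> \<beta> @ [x])" using cs x by (simp only: windep_snoc)
    obtain y where y: "tpeq (b (Suc n)) y" "wide (M \<union> set (?cs \<alpha> \<beta> @ [x])) y"
      using wide_realize[OF w(2) small_Mset[OF windep_in[OF cs1]]] by blast
    have cs2: "windep ((?cs \<alpha> \<beta> @ [x]) @ [y])" using cs1 y by (simp only: windep_snoc)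
    define \<alpha>' where "\<alpha>' = \<alpha>(Suc n := x)"
    define \<beta>' where "\<beta>' = \<beta>(Suc n := y)"
    have "map (\<lambda>i. [\<alpha>' i, \<beta>' i]) [1..<Suc n] = map (\<lambda>i. [\<alpha> i, \<beta> i]) [1..<Suc n]"
      by (simp add: \<alpha>'_def \<beta>'_def del: upt_Suc)
    moreover have "\<alpha>' (Suc n) = x" "\<beta>' (Suc n) = y" by (simp_all add: \<alpha>'_def \<beta>'_def)
    ultimately have "concat (map (\<lambda>i. [\<alpha>' i, \<beta>' i]) [1..<Suc (Suc n)]) = (?cs \<alpha> \<beta> @ [x]) @ [y]"
      by (simp only: map_upt_Suc concat_append concat.simps append_Nil2 append_assoc append.simps)
    then have cs3: "windep (concat (map (\<lambda>i. [\<alpha>' i, \<beta>' i]) [1..<Suc (Suc n)]))"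
      using cs2 by (simp only:)
    have "free (\<alpha>' i) (\<beta>' j)" if "i \<in> {1..Suc n}" "j \<in> {1..Suc n}" for i j
    proof -
      have wab: "wide M (\<alpha>' i)" "wide M (\<beta>' j)" if "i \<in> {1..Suc n}" "j \<in> {1..Suc n}" for i j
      proof -
        have "tpeq (a i) (\<alpha>' i)" "tpeq (b j) (\<beta>' j)"
          using that ty x(1) y(1) by (auto simp: \<alpha>'_def \<beta>'_def le_Suc_eq)
        then show "wide M (\<alpha>' i)" "wide M (\<beta>' j)"
          using wide_tpeq assms(1)[of i] assms(1)[of j] that Suc.prems by auto
      qed
      have ins: "M \<union> {z} \<subseteq> M \<union> S" if "z \<in> S" for z and S :: "'a set" using that by blast
      consider "i \<in> {1..n}" "j \<in> {1..n}" | "j = Suc n" | "i = Suc n" "j \<in> {1..n}" using \<open>i \<in> {1..Suc n}\<close> \<open>j \<in> {1..Suc n}\<close> by force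
      then show ?thesis
      proof cases
        case 1
        then show ?thesis using fr by (auto simp: \<alpha>'_def \<beta>'_def)
      next
        case 2
        have "\<alpha>' i \<in> set (?cs \<alpha> \<beta> @ [x])" using \<open>i \<in> {1..Suc n}\<close> by (auto simp: \<alpha>'_def le_Suc_eq)
        then have "wide (M \<union> {\<alpha>' i}) y" by (rule wide_mono[OF y(2) ins])
        then show ?thesis using freeI1 wab(1)[OF that] 2 by (simp add: \<beta>'_def)
      next
        case 3
        have "\<beta>' j = \<beta> j" using 3 by (auto simp: \<beta>'_def)
        moreover have "j \<in> set [1..<Suc n]" using 3(2) by auto
        then have "\<beta> j \<in> set (?cs \<alpha> \<beta>)" by (auto simp del: upt_Suc set_upt)
        ultimately have "\<beta>' j \<in> set (?cs \<alpha> \<beta>)" by (simp only:)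
        then have "wide (M \<union> {\<beta>' j}) x" by (rule wide_mono[OF x(2) ins])
        then show ?thesis using freeI2 wab(2)[OF that] 3 by (simp add: \<alpha>'_def)
      qed
    qed
    moreover have "\<forall>i\<in>{1..Suc n}. tpeq (a i) (\<alpha>' i) \<and> tpeq (b i) (\<beta>' i)"
      using ty x(1) y(1) by (auto simp: \<alpha>'_def \<beta>'_def le_Suc_eq)
    ultimately show ?case using cs3 by blast
  qed
  from this[of k] obtain \<alpha> \<beta> where cs: "windep (concat (map (\<lambda>i. [\<alpha> i, \<beta> i]) [1..<Suc k]))"
    and ty: "\<And>i. i \<in> {1..k} \<Longrightarrow> tpeq (a i) (\<alpha> i) \<and> tpeq (b i) (\<beta> i)"
    and fr: "\<And>i j. i \<in> {1..k} \<Longrightarrow> j \<in> {1..k} \<Longrightarrow> free (\<alpha> i) (\<beta> j)" by auto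
  have "R (\<beta> j) (\<alpha> i) \<longleftrightarrow> i \<le> j" if "i \<in> {1..k}" "j \<in> {1..k}" for i j
  proof -
    have "R (\<beta> j) (\<alpha> i) = F (\<alpha> i) (\<beta> j)" using F_eq fr that by blast
    also have "\<dots> = F (a i) (b j)" using F_tpeq[of "a i" "b j"] assms(1) ty that by blast
    finally show ?thesis using lad that by blast
  qed
  then have "chain R k \<alpha> \<beta>" using cs by (simp add: chain_def)
  then show False using nochain(1) by blast
qed

text \<open>Definability of types from stationarity and compactness. Two points wide over
  \<open>M\<close> and \<open>a\<close> with the same type over \<open>M\<close> agree on
  \<open>R\<close> with \<open>a\<close>, so finitely many \<open>M\<close>-definable sets
  \<open>Xs\<close> decide \<open>R x a\<close> for all \<open>x\<close> outside finitely many ideal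
  sets \<open>Zs\<close>.\<close>

lemma F_definable:
  assumes a: "wide M a"
  shows "\<exists>X. definable L \<M> M X \<and> (\<forall>b. wide M b \<longrightarrow> (b \<in> X \<longleftrightarrow> F a b))"
proof -
  have aU: "a \<in> U" by (rule wide_in[OF a])
  define B where "B = M \<union> {a}"
  have B: "small B" unfolding B_def using small_insert[OF smallM aU] by simp
  have BU: "B \<subseteq> U" by (rule smallD[OF B])
  define h where "h = (\<lambda>(X::'a set) v. (v (0::nat) \<in> X) \<longleftrightarrow> (v 1 \<in> X))"
  define h' where "h' = (\<lambda>(Z::'a set) v. v (0::nat) \<notin> Z \<and> v 1 \<notin> Z)"
  define r where "r = (\<lambda>v. R (v (0::nat)) a \<and> \<not> R (v 1) a)"
  let ?D = "{X. definable L \<M> M X}" and ?D' = "{Z. definable L \<M> B Z \<and> J Z}"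
  have "\<not> (\<forall>E. finite E \<longrightarrow> E \<subseteq> h ` ?D \<union> h' ` ?D' \<union> {r} \<longrightarrow> (\<exists>v\<in>asg. \<forall>P\<in>E. P v))"
  proof
    assume fip: "\<forall>E. finite E \<longrightarrow> E \<subseteq> h ` ?D \<union> h' ` ?D' \<union> {r} \<longrightarrow> (\<exists>v\<in>asg. \<forall>P\<in>E. P v)"
    have "\<exists>v\<in>asg. \<forall>P\<in>h ` ?D \<union> h' ` ?D' \<union> {r}. P v"
    proof (rule realize[OF B])
      fix P assume "P \<in> h ` ?D \<union> h' ` ?D' \<union> {r}"
      then consider X where "definable L \<M> M X" "P = h X" | Z where "definable L \<M> B Z" "P = h' Z" | "P = r"
        by blast
      then show "dfn B P"
      proof cases
        case 1
        then have "definable L \<M> B X" using definable_mono B_def by blast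
        then show ?thesis unfolding 1(2) h_def by (intro dfn_iff definable_dfn BU)
      next
        case 2
        then show ?thesis unfolding 2(2) h'_def by (intro dfn_conj dfn_not definable_dfn BU)
      next
        case 3
        have RB: "dfn B (\<lambda>v. R (v 0) (v 1))" using dfn_mono[OF R] BU B_def by blast
        have t: "dtm B (\<lambda>v. if n = 0 then v i else a)" for n i :: nat
          using BU by (cases "n = 0") (auto simp: B_def intro: dtm_var dtm_const)
        have "dfn B (\<lambda>v. R (v i) a)" for i
          using dfn_sub[OF RB, of "\<lambda>n v. if n = 0 then v i else a", OF t[of _ i]] by simp
        then show ?thesis unfolding 3 r_def by (intro dfn_conj dfn_not)
      qed
    qed (use fip in blast)
    then obtain v where v: "v \<in> asg" "\<forall>P\<in>h ` ?D \<union> h' ` ?D' \<union> {r}. P v" by (rule bexE)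
    have "h X v" if "definable L \<M> M X" for X using bspec[OF v(2), of "h X"] that by simp
    then have eq: "tpeq (v 0) (v 1)" unfolding tpeq_def h_def by blast
    have "h' Z v" if "definable L \<M> B Z" "J Z" for Z using bspec[OF v(2), of "h' Z"] that by simp
    then have w: "wide B (v 0)" "wide B (v 1)" unfolding wide_def h'_def using asgD[OF v(1)] by blast+
    have "r v" using bspec[OF v(2), of r] by simp
    then have "R (v 0) a" "\<not> R (v 1) a" by (auto simp: r_def)
    then show False
      using stationary[of a "v 0" a "v 1"] freeI1[OF a] w eq by (auto simp: B_def)
  qed
  then obtain E where F0: "finite E" "E \<subseteq> h ` ?D \<union> h' ` ?D' \<union> {r}" "\<not> (\<exists>v\<in>asg. \<forall>P\<in>E. P v)"
    unfolding not_all not_imp by (elim exE conjE)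
  obtain Xs where Xs: "Xs \<subseteq> ?D" "finite Xs" "E \<inter> h ` ?D = h ` Xs"
    using finite_subset_image[of "E \<inter> h ` ?D" h ?D] F0(1) by blast
  obtain Zs where Zs: "Zs \<subseteq> ?D'" "finite Zs" "E \<inter> h' ` ?D' = h' ` Zs"
    using finite_subset_image[of "E \<inter> h' ` ?D'" h' ?D'] F0(1) by blast
  have contra: False if xy: "x \<in> U" "y \<in> U" "\<And>X. X \<in> Xs \<Longrightarrow> x \<in> X \<longleftrightarrow> y \<in> X"
    "\<And>Z. Z \<in> Zs \<Longrightarrow> x \<notin> Z \<and> y \<notin> Z" "R x a" "\<not> R y a" for x y
  proof -
    have asg: "x ## (\<lambda>_. y) \<in> asg" using xy by simp
    have "P (x ## (\<lambda>_. y))" if P: "P \<in> E" for P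
    proof -
      have "P \<in> h ` ?D \<union> h' ` ?D' \<union> {r}" by (rule subsetD[OF F0(2) P])
      then have "P \<in> (E \<inter> h ` ?D) \<union> (E \<inter> h' ` ?D') \<union> {r}"
        using P by (simp only: Un_iff Int_iff simp_thms)
      then have "P \<in> h ` Xs \<union> h' ` Zs \<union> {r}" unfolding Xs(3) Zs(3) .
      then show ?thesis
      proof (elim UnE imageE singletonE)
        fix X assume "P = h X" "X \<in> Xs"
        then show ?thesis using xy(3) by (simp add: h_def)
      next
        fix Z assume "P = h' Z" "Z \<in> Zs"
        then show ?thesis using xy(4) by (simp add: h'_def)
      next
        assume "P = r"
        then show ?thesis using xy(5,6) by (simp add: r_def)
      qed
    qed
    then show False using F0(3) asg by blast
  qed
  \<comment> \<open>\<open>\<S>\<close> collects the patterns on \<open>Xs\<close> that occur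
    outside \<open>Zs\<close> together with \<open>R x a\<close>. The sets in \<open>Zs\<close> may
    use \<open>a\<close> as a parameter, but \<open>Y\<close> is described by \<open>Xs\<close>
    alone and is therefore definable over \<open>M\<close>.\<close>
  define \<S> where "\<S> = {S \<in> Pow Xs. \<exists>x\<in>U. (\<forall>Z\<in>Zs. x \<notin> Z) \<and> R x a \<and> (\<forall>X\<in>Xs. x \<in> X \<longleftrightarrow> X \<in> S)}"
  define Y where "Y = {y \<in> U. \<exists>S\<in>\<S>. \<forall>X\<in>Xs. y \<in> X \<longleftrightarrow> X \<in> S}"
  have "definable L \<M> M Y" unfolding Y_def
  proof (intro definableI dfn_Bex dfn_Ball MU)
    show "finite \<S>" "finite Xs" using Xs(2) by (auto simp: \<S>_def)
    show "dfn M (\<lambda>v. (v 0 \<in> X) = (X \<in> S))" if "X \<in> Xs" for X S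
      using that Xs(1) by (intro dfn_iff dfn_bool definable_dfn MU) auto
  qed
  moreover have "b \<in> Y \<longleftrightarrow> F a b" if b: "wide M b" for b
  proof -
    \<comment> \<open>\<open>b\<close> itself may lie in a member of \<open>Zs\<close>; its copy
      \<open>c\<close>, wide over \<open>B\<close>, does not.\<close>
    obtain c where c: "tpeq b c" "wide B c" using free_ex[OF a b] B_def by blast
    have cU: "c \<in> U" and cZ: "c \<notin> Z" if "Z \<in> Zs" for Z
      using c(2) Zs(1) that unfolding wide_def by auto
    have cU: "c \<in> U" by (rule wide_in[OF c(2)])
    have fc: "free a c" using freeI1[OF a] c(2) by (simp add: B_def)
    have "F a b = F a c" using F_tpeq[OF a b tpeq_refl c(1)] .
    then have Fb: "F a b = R c a" using F_eq[OF fc] by simp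
    have bc: "b \<in> Y \<longleftrightarrow> c \<in> Y" by (rule tpeqD[OF c(1)]) fact
    show ?thesis
    proof
      assume "F a b"
      then have "{X \<in> Xs. c \<in> X} \<in> \<S>" using cU cZ Fb by (auto simp: \<S>_def)
      then have "\<exists>S\<in>\<S>. \<forall>X\<in>Xs. c \<in> X \<longleftrightarrow> X \<in> S" by (rule rev_bexI) simp
      then have "c \<in> Y" using cU by (simp add: Y_def)
      then show "b \<in> Y" using bc by simp
    next
      assume "b \<in> Y"
      then obtain x where "x \<in> U" "\<forall>Z\<in>Zs. x \<notin> Z" "R x a" "\<forall>X\<in>Xs. x \<in> X \<longleftrightarrow> c \<in> X"
        unfolding bc by (auto simp: Y_def \<S>_def)
      then have "R c a" using contra[of x c] cU cZ by blast
      then show "F a b" using Fb by simp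
    qed
  qed
  ultimately show ?thesis by blast
qed

end

section \<open>Stable relations have isolated points\<close>

text \<open>This says that Shelah's 2-rank of \<open>X\<close> is at least \<open>n\<close>: there
  is a full binary tree of height \<open>n\<close> with nodes in \<open>S\<close> all of whose
  branches are realized in \<open>X\<close>.\<close>

fun splits :: "('p \<Rightarrow> 'q \<Rightarrow> bool) \<Rightarrow> nat \<Rightarrow> 'p set \<Rightarrow> 'q set \<Rightarrow> bool" where
  "splits F 0 S X \<longleftrightarrow> X \<noteq> {}"
| "splits F (Suc n) S X \<longleftrightarrow> (\<exists>a\<in>S. splits F n S {b \<in> X. F a b} \<and> splits F n S {b \<in> X. \<not> F a b})"

lemma splits_mono: "splits F n S X \<Longrightarrow> S \<subseteq> S' \<Longrightarrow> X \<subseteq> X' \<Longrightarrow> splits F n S' X'"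
proof (induction n arbitrary: X X')
  case (Suc n)
  then obtain a where a: "a \<in> S" "splits F n S {b \<in> X. F a b}" "splits F n S {b \<in> X. \<not> F a b}" by auto
  have "splits F n S' {b \<in> X'. F a b}" "splits F n S' {b \<in> X'. \<not> F a b}"
    using Suc.IH[OF a(2), of "{b \<in> X'. F a b}"] Suc.IH[OF a(3), of "{b \<in> X'. \<not> F a b}"] Suc.prems by auto
  then show ?case using a(1) Suc.prems(2) by auto
qed auto

lemma splits_nonempty: "splits F n S X \<Longrightarrow> X \<noteq> {}"
  by (induction n arbitrary: X) fastforce+

text \<open>A Ramsey property of trees. If the root lies in \<open>S\<close>, either both halves
  carry a tree of height \<open>n - 1\<close> with nodes in \<open>S\<close>, which the root
  completes, or one half carries a tree of height \<open>m\<close> with nodes in \<open>S'\<close>;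
  the other case is symmetric.\<close>

lemma splits_Un: "splits F (n + m) (S \<union> S') X \<Longrightarrow> splits F n S X \<or> splits F m S' X"
proof (induction "n + m" arbitrary: n m X)
  case 0
  then show ?case by simp
next
  case (Suc k)
  show ?case
  proof (cases "n = 0 \<or> m = 0")
    case True
    then show ?thesis using splits_nonempty[OF Suc.prems] by auto
  next
    case False
    then obtain n' m' where nm: "n = Suc n'" "m = Suc m'" using not0_implies_Suc by blast
    have k: "n + m = Suc k" using Suc.hyps(2) by simp
    obtain a where a: "a \<in> S \<union> S'" "splits F k (S \<union> S') {b \<in> X. F a b}" "splits F k (S \<union> S') {b \<in> X. \<not> F a b}"
      using Suc.prems unfolding k by auto
    have sub: "splits F i T {b \<in> X. F a b} \<Longrightarrow> splits F i T X"
      "splits F i T {b \<in> X. \<not> F a b} \<Longrightarrow> splits F i T X" for i T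
      by (auto elim: splits_mono)
    show ?thesis
    proof (cases "a \<in> S")
      case True
      have "k = n' + m" using k nm by simp
      then have "splits F n' S {b \<in> X. F a b} \<or> splits F m S' {b \<in> X. F a b}"
        "splits F n' S {b \<in> X. \<not> F a b} \<or> splits F m S' {b \<in> X. \<not> F a b}"
        using Suc.hyps(1)[of n' m] a by auto
      then show ?thesis using sub True nm(1) by auto
    next
      case False
      have "k = n + m'" using k nm by simp
      then have "splits F n S {b \<in> X. F a b} \<or> splits F m' S' {b \<in> X. F a b}"
        "splits F n S {b \<in> X. \<not> F a b} \<or> splits F m' S' {b \<in> X. \<not> F a b}"
        using Suc.hyps(1)[of n m'] a by auto
      then show ?thesis using sub False a(1) nm(2) by auto
    qed
  qed
qed

definition ladder :: "('p \<Rightarrow> 'q \<Rightarrow> bool) \<Rightarrow> (nat \<Rightarrow> nat \<Rightarrow> bool) \<Rightarrow> nat \<Rightarrow> 'p set \<Rightarrow> 'q set \<Rightarrow> bool" where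
  "ladder F r n S X \<longleftrightarrow> (\<exists>a b. (\<forall>s<n. a s \<in> S \<and> b s \<in> X) \<and> (\<forall>s<n. \<forall>t<n. F (a s) (b t) \<longleftrightarrow> r s t))"

lemma ladder_mono: "ladder F r n S X \<Longrightarrow> S \<subseteq> S' \<Longrightarrow> X \<subseteq> X' \<Longrightarrow> ladder F r n S' X'"
  unfolding ladder_def by (elim exE conjE, rule exI, rule exI, rule conjI) auto

lemma ladder_Cons:
  assumes l: "ladder F r n S' X'" and ab: "a \<in> S" "b \<in> X" and sub: "S' \<subseteq> S" "X' \<subseteq> X"
    and r: "F a b \<longleftrightarrow> r 0 0" "\<And>x t. x \<in> X' \<Longrightarrow> F a x \<longleftrightarrow> r 0 (Suc t)" "\<And>y s. y \<in> S' \<Longrightarrow> F y b \<longleftrightarrow> r (Suc s) 0"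
    and rS: "\<And>s t. r (Suc s) (Suc t) \<longleftrightarrow> r s t"
  shows "ladder F r (Suc n) S X"
proof -
  obtain a' b' where l': "\<forall>s<n. a' s \<in> S' \<and> b' s \<in> X'" "\<forall>s<n. \<forall>t<n. F (a' s) (b' t) \<longleftrightarrow> r s t"
    using l by (auto simp: ladder_def)
  define a'' where "a'' = case_nat a a'"
  define b'' where "b'' = case_nat b b'"
  have "a'' s \<in> S \<and> b'' s \<in> X" if "s < Suc n" for s
    using that l'(1) ab sub by (cases s) (auto simp: a''_def b''_def)
  moreover have "F (a'' s) (b'' t) \<longleftrightarrow> r s t" if "s < Suc n" "t < Suc n" for s t
    using that l' r rS by (cases s; cases t) (auto simp: a''_def b''_def)
  ultimately show ?thesis unfolding ladder_def by blast
qed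

text \<open>Cutting \<open>Suc h + Suc h\<close> in half by \<open>splits_Un\<close> leaves
  \<open>Suc h\<close>: one level for the root, which joins the new rung, and \<open>h\<close>
  levels for the induction.\<close>

fun tree_height :: "nat \<Rightarrow> nat" where
  "tree_height 0 = 0"
| "tree_height (Suc n) = Suc (tree_height n) + Suc (tree_height n)"

text \<open>
  Fix \<open>b\<close> and split the nodes of the tree according to \<open>F a b\<close>. Half of the height survives on
  one side, and the root \<open>a\<close> of the surviving tree forms a new rung with \<open>b\<close>, below or above the
  rungs found in that tree.
\<close>

lemma splits_ladder:
  "splits F (tree_height (i + j)) S X \<Longrightarrow> ladder F (<) i S X \<or> ladder F (\<lambda>s t. t \<le> s) j S X"
proof (induction "i + j" arbitrary: i j S X)
  case 0
  then show ?case by (auto simp: ladder_def)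
next
  case (Suc n)
  show ?case
  proof (cases "i = 0 \<or> j = 0")
    case True
    then show ?thesis by (auto simp: ladder_def)
  next
    case False
    then obtain i' j' where ij: "i = Suc i'" "j = Suc j'" using not0_implies_Suc by blast
    have n: "i + j = Suc n" using Suc.hyps(2) by simp
    obtain b where b: "b \<in> X" using splits_nonempty[OF Suc.prems] by blast
    let ?S0 = "{a \<in> S. \<not> F a b}" and ?S1 = "{a \<in> S. F a b}"
    have "?S0 \<union> ?S1 = S" by blast
    then have "splits F (Suc (tree_height n)) ?S0 X \<or> splits F (Suc (tree_height n)) ?S1 X"
      using Suc.prems splits_Un[of F "Suc (tree_height n)" "Suc (tree_height n)" ?S0 ?S1 X]
      unfolding n tree_height.simps by metis
    then show ?thesis
    proof
      assume "splits F (Suc (tree_height n)) ?S0 X"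
      then obtain a where a: "a \<in> ?S0" "splits F (tree_height n) ?S0 {x \<in> X. F a x}" by auto
      have "n = i' + j" using n ij by simp
      then consider "ladder F (<) i' ?S0 {x \<in> X. F a x}" | "ladder F (\<lambda>s t. t \<le> s) j ?S0 {x \<in> X. F a x}"
        using Suc.hyps(1)[of i' j ?S0 "{x \<in> X. F a x}"] a(2) by blast
      then show ?thesis
      proof cases
        case 1
        have "ladder F (<) (Suc i') S X"
          by (rule ladder_Cons[OF 1, of a _ b]) (use a(1) b in auto)
        then show ?thesis using ij by simp
      next
        case 2
        then have "ladder F (\<lambda>s t. t \<le> s) j S X" by (rule ladder_mono) auto
        then show ?thesis by simp
      qed
    next
      assume "splits F (Suc (tree_height n)) ?S1 X"
      then obtain a where a: "a \<in> ?S1" "splits F (tree_height n) ?S1 {x \<in> X. \<not> F a x}" by auto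
      have "n = i + j'" using n ij by simp
      then consider "ladder F (<) i ?S1 {x \<in> X. \<not> F a x}" | "ladder F (\<lambda>s t. t \<le> s) j' ?S1 {x \<in> X. \<not> F a x}"
        using Suc.hyps(1)[of i j' ?S1 "{x \<in> X. \<not> F a x}"] a(2) by blast
      then show ?thesis
      proof cases
        case 1
        then have "ladder F (<) i S X" by (rule ladder_mono) auto
        then show ?thesis by simp
      next
        case 2
        have "ladder F (\<lambda>s t. t \<le> s) (Suc j') S X"
          by (rule ladder_Cons[OF 2, of a _ b]) (use a(1) b in auto)
        then show ?thesis using ij by simp
      qed
    qed
  qed
qed

text \<open>Without an isolated point, any nonempty subset of \<open>Q\<close> given by finitely
  many conditions contains two points separated by some \<open>a\<close> in \<open>P\<close>, so it
  splits again. This produces trees of every height and hence a ladder.\<close>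

lemma isolated_point:
  assumes no: "\<And>a b. (\<And>i. i \<in> {1..k::nat} \<Longrightarrow> a i \<in> P \<and> b i \<in> Q) \<Longrightarrow>
      (\<And>i j. i \<in> {1..k} \<Longrightarrow> j \<in> {1..k} \<Longrightarrow> F (a i) (b j) \<longleftrightarrow> i \<le> j) \<Longrightarrow> False"
    and Q: "Q \<noteq> {}"
  shows "\<exists>E b. finite E \<and> E \<subseteq> P \<times> UNIV \<and> b \<in> Q \<and> (\<forall>(a, \<epsilon>)\<in>E. F a b = \<epsilon>) \<and>
    (\<forall>c\<in>Q. (\<forall>(a, \<epsilon>)\<in>E. F a c = \<epsilon>) \<longrightarrow> (\<forall>a\<in>P. F a c = F a b))"
proof (rule ccontr)
  assume neg: "\<not> ?thesis"
  define X where "X = (\<lambda>E. {b \<in> Q. \<forall>(a, \<epsilon>)\<in>E. F a b = \<epsilon>})"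
  have "splits F n P (X E)" if "finite E" "E \<subseteq> P \<times> UNIV" "X E \<noteq> {}" for n E
    using that
  proof (induction n arbitrary: E)
    case (Suc n)
    obtain b where b: "b \<in> X E" using Suc.prems(3) by blast
    then have bb: "b \<in> Q" "\<forall>(a, \<epsilon>)\<in>E. F a b = \<epsilon>" by (auto simp: X_def)
    have "\<exists>c\<in>Q. (\<forall>(a, \<epsilon>)\<in>E. F a c = \<epsilon>) \<and> (\<exists>a\<in>P. F a c \<noteq> F a b)"
    proof (rule ccontr)
      assume "\<not> (\<exists>c\<in>Q. (\<forall>(a, \<epsilon>)\<in>E. F a c = \<epsilon>) \<and> (\<exists>a\<in>P. F a c \<noteq> F a b))"
      then have "\<forall>c\<in>Q. (\<forall>(a, \<epsilon>)\<in>E. F a c = \<epsilon>) \<longrightarrow> (\<forall>a\<in>P. F a c = F a b)"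
        by (intro ballI impI) blast
      with Suc.prems(1,2) bb have "\<exists>E b. finite E \<and> E \<subseteq> P \<times> UNIV \<and> b \<in> Q
        \<and> (\<forall>(a, \<epsilon>)\<in>E. F a b = \<epsilon>) \<and> (\<forall>c\<in>Q. (\<forall>(a, \<epsilon>)\<in>E. F a c = \<epsilon>) \<longrightarrow> (\<forall>a\<in>P. F a c = F a b))"
        by (intro exI[of _ E] exI[of _ b] conjI)
      with neg show False by (rule notE)
    qed
    then obtain c a where c: "c \<in> X E" and a: "a \<in> P" "F a c \<noteq> F a b" by (auto simp: X_def)
    have X: "X (insert (a, \<epsilon>) E) = {y \<in> X E. F a y = \<epsilon>}" for \<epsilon> by (auto simp: X_def)
    have "splits F n P (X (insert (a, \<epsilon>) E))" for \<epsilon>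
      using Suc.prems a b c by (intro Suc.IH) (auto simp: X)
    from this[of True] this[of False] show ?case using a(1) by (auto simp: X)
  qed auto
  \<comment> \<open>Both kinds of ladder must yield one of shape \<open>i \<le> j\<close> with
    \<open>k\<close> rungs. The strict kind loses a rung when its \<open>a\<close> are shifted by
    one, hence \<open>Suc k\<close>; the other kind is read backwards.\<close>
  from this[of "{}" "tree_height (Suc k + k)"]
  have "splits F (tree_height (Suc k + k)) P Q" using Q by (simp add: X_def)
  then consider "ladder F (<) (Suc k) P Q" | "ladder F (\<lambda>s t. t \<le> s) k P Q"
    using splits_ladder by blast
  then show False
  proof cases
    case 1
    then obtain a b where ab: "\<forall>s<Suc k. a s \<in> P \<and> b s \<in> Q" "\<forall>s<Suc k. \<forall>t<Suc k. F (a s) (b t) \<longleftrightarrow> s < t"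
      by (auto simp: ladder_def)
    show False
    proof (rule no[of "\<lambda>i. a (i - 1)" b])
      show "a (i - 1) \<in> P \<and> b i \<in> Q" if "i \<in> {1..k}" for i
        using ab(1) that by auto
      show "F (a (i - 1)) (b j) \<longleftrightarrow> i \<le> j" if "i \<in> {1..k}" "j \<in> {1..k}" for i j
      proof -
        have "F (a (i - 1)) (b j) \<longleftrightarrow> i - 1 < j" using ab(2)[rule_format, of "i - 1" j] that by auto
        then show ?thesis using that by auto
      qed
    qed
  next
    case 2
    then obtain a b where ab: "\<forall>s<k. a s \<in> P \<and> b s \<in> Q" "\<forall>s<k. \<forall>t<k. F (a s) (b t) \<longleftrightarrow> t \<le> s"
      by (auto simp: ladder_def)
    show False
    proof (rule no[of "\<lambda>i. a (k - i)" "\<lambda>i. b (k - i)"])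
      show "a (k - i) \<in> P \<and> b (k - i) \<in> Q" if "i \<in> {1..k}" for i using ab(1) that by auto
      show "F (a (k - i)) (b (k - j)) \<longleftrightarrow> i \<le> j" if "i \<in> {1..k}" "j \<in> {1..k}" for i j
      proof -
        have "F (a (k - i)) (b (k - j)) \<longleftrightarrow> k - j \<le> k - i" using ab(2) that by auto
        then show ?thesis using that by auto
      qed
    qed
  qed
qed

section \<open>Translations and the action on a partition\<close>

locale ideal_group = s1_model L \<M> \<kappa> I M + group G
  for L :: "('f, 'r) language" and \<M> :: "('f, 'r, 'a) struct" and \<kappa> :: "'k rel" and I M
    and G :: "('a, 'm) monoid_scheme" (structure) +
  fixes mul :: 'f
  assumes carrier_eq: "carrier G = univ \<M>" and mul: "mul \<in> funs L" "farity L mul = 2"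
    and mult: "a \<in> carrier G \<Longrightarrow> b \<in> carrier G \<Longrightarrow> a \<otimes> b = fun_of \<M> mul [a, b]"
    and trans: "translation_invariant L \<M> G I"
begin

lemma mult_in_U [simp]: "x \<in> U \<Longrightarrow> y \<in> U \<Longrightarrow> x \<otimes> y \<in> U" and inv_in_U [simp]: "x \<in> U \<Longrightarrow> inv x \<in> U"
  and one_in_U [simp]: "\<one> \<in> U"
  using carrier_eq m_closed inv_closed one_closed by auto

lemma assoc_U: "x \<in> U \<Longrightarrow> y \<in> U \<Longrightarrow> z \<in> U \<Longrightarrow> x \<otimes> y \<otimes> z = x \<otimes> (y \<otimes> z)"
  using m_assoc carrier_eq by auto

lemma dtm_mult: "dtm B s \<Longrightarrow> dtm B t \<Longrightarrow> dtm B (\<lambda>v. s v \<otimes> t v)"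
proof -
  assume "dtm B s" "dtm B t"
  then obtain s' t' where st: "B \<subseteq> U" "tm_over L B s'" "\<forall>v\<in>asg. s v = val \<M> v s'"
    "tm_over L B t'" "\<forall>v\<in>asg. t v = val \<M> v t'" by (auto simp: dtm_def)
  have "tm_over L B (Fn mul [s', t'])" using st mul by (auto simp: tm_over_def)
  moreover have "s v \<otimes> t v = val \<M> v (Fn mul [s', t'])" if v: "v \<in> asg" for v
  proof -
    have "s v \<in> U" "t v \<in> U" using st v by (auto simp: tm_over_def intro!: val_in)
    then show ?thesis using mult[of "s v" "t v"] carrier_eq st v by simp
  qed
  ultimately show ?thesis unfolding dtm_def using st(1) by blast
qed

lemma rtrans_def: "definable L \<M> B X \<Longrightarrow> B \<subseteq> U \<Longrightarrow> g \<in> B \<Longrightarrow> definable L \<M> B {y \<in> U. y \<otimes> g \<in> X}"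
  by (intro definableI definable_tm dtm_mult dtm_var dtm_const)

lemma ltrans_def: "definable L \<M> B X \<Longrightarrow> B \<subseteq> U \<Longrightarrow> g \<in> B \<Longrightarrow> definable L \<M> B {y \<in> U. g \<otimes> y \<in> X}"
  by (intro definableI definable_tm dtm_mult dtm_var dtm_const)

lemma J_rcoset:
  assumes J: "J X" and g: "g \<in> U" and d: "definable L \<M> U Y" and Y: "Y = X #> g"
  shows "J Y"
proof -
  obtain \<phi> where \<phi>: "\<phi> \<in> I" "solutions \<M> \<phi> = X" using J by (auto simp: in_ideal_def)
  obtain \<psi> where \<psi>: "\<psi> \<in> formulas L U {0}" "solutions \<M> \<psi> = Y" using d by (auto simp: definable_def)
  have "\<psi> \<in> I" using trans \<phi> \<psi> g Y carrier_eq unfolding translation_invariant_def by blast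
  then show ?thesis using \<psi>(2) by (auto simp: in_ideal_def)
qed

lemma J_lcoset:
  assumes J: "J X" and g: "g \<in> U" and d: "definable L \<M> U Y" and Y: "Y = g <# X"
  shows "J Y"
proof -
  obtain \<phi> where \<phi>: "\<phi> \<in> I" "solutions \<M> \<phi> = X" using J by (auto simp: in_ideal_def)
  obtain \<psi> where \<psi>: "\<psi> \<in> formulas L U {0}" "solutions \<M> \<psi> = Y" using d by (auto simp: definable_def)
  have "\<psi> \<in> I" using trans \<phi> \<psi> g Y carrier_eq unfolding translation_invariant_def by blast
  then show ?thesis using \<psi>(2) by (auto simp: in_ideal_def)
qed

lemma cancel [simp]:
  "x \<in> U \<Longrightarrow> g \<in> U \<Longrightarrow> x \<otimes> inv g \<otimes> g = x" "x \<in> U \<Longrightarrow> g \<in> U \<Longrightarrow> x \<otimes> g \<otimes> inv g = x"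
  "x \<in> U \<Longrightarrow> g \<in> U \<Longrightarrow> inv g \<otimes> (g \<otimes> x) = x" "x \<in> U \<Longrightarrow> g \<in> U \<Longrightarrow> g \<otimes> (inv g \<otimes> x) = x"
  using carrier_eq by (simp_all add: assoc_U m_assoc[symmetric])

lemma J_rtrans: assumes "J X" "g \<in> U" shows "J {y \<in> U. y \<otimes> g \<in> X}"
proof (rule J_rcoset[OF assms(1), of "inv g"])
  show "definable L \<M> U {y \<in> U. y \<otimes> g \<in> X}"
    by (rule rtrans_def[OF J_definable[OF assms(1)]]) (use assms(2) in auto)
  show "{y \<in> U. y \<otimes> g \<in> X} = X #> inv g"
    using J_subset[OF assms(1)] assms(2) unfolding r_coset_def
    by (auto intro!: bexI[of _ "_ \<otimes> g"])
qed (use assms(2) in simp)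

lemma J_ltrans: assumes "J X" "g \<in> U" shows "J {y \<in> U. g \<otimes> y \<in> X}"
proof (rule J_lcoset[OF assms(1), of "inv g"])
  show "definable L \<M> U {y \<in> U. g \<otimes> y \<in> X}"
    by (rule ltrans_def[OF J_definable[OF assms(1)]]) (use assms(2) in auto)
  show "{y \<in> U. g \<otimes> y \<in> X} = inv g <# X"
    using J_subset[OF assms(1)] assms(2) unfolding l_coset_def
    by (auto intro!: bexI[of _ "g \<otimes> _"])
qed (use assms(2) in simp)

lemma wide_rmult: assumes "wide B b" "g \<in> B" "B \<subseteq> U" shows "wide B (b \<otimes> g)"
  unfolding wide_def
proof (intro conjI allI impI notI)
  show "b \<otimes> g \<in> U" using wide_in[OF assms(1)] assms by auto
  fix X assume X: "definable L \<M> B X" "J X" "b \<otimes> g \<in> X"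
  have "b \<in> {y \<in> U. y \<otimes> g \<in> X}" using X wide_in[OF assms(1)] by simp
  then show False
    using wideD[OF assms(1) rtrans_def[OF X(1) assms(3,2)]] J_rtrans[OF X(2)] assms by blast
qed

lemma wide_lmult: assumes "wide B b" "g \<in> B" "B \<subseteq> U" shows "wide B (g \<otimes> b)"
  unfolding wide_def
proof (intro conjI allI impI notI)
  show "g \<otimes> b \<in> U" using wide_in[OF assms(1)] assms by auto
  fix X assume X: "definable L \<M> B X" "J X" "g \<otimes> b \<in> X"
  have "b \<in> {y \<in> U. g \<otimes> y \<in> X}" using X wide_in[OF assms(1)] by simp
  then show False
    using wideD[OF assms(1) ltrans_def[OF X(1) assms(3,2)]] J_ltrans[OF X(2)] assms by blast
qed

text \<open>
  Right translations permute the pieces \<open>V q\<close> modulo \<open>I\<close>; the subgroup \<open>N\<close> below is the kernel of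
  this action.
\<close>

definition moves :: "('q \<Rightarrow> 'a set) \<Rightarrow> 'a \<Rightarrow> 'q \<Rightarrow> 'q \<Rightarrow> bool" where
  "moves V g q r \<longleftrightarrow> (\<exists>b\<in>V q. b \<otimes> g \<in> V r)"

text \<open>No piece is covered by two translates of \<open>Z\<close>, so a composition of
  translations can be followed along a single point (\<open>pick\<close>), and \<open>func0\<close>
  makes the target piece unique. Hence \<open>moves\<close> is an action on a finite set, and its
  kernel is normal of finite index. The last conclusion says that, outside \<open>Z\<close>, each
  piece is a union of cosets.\<close>

lemma partition_subgroup:
  fixes V :: "'q \<Rightarrow> 'a set"
  assumes fin: "finite \<Q>" and V0: "\<forall>q\<in>\<Q>. definable L \<M> M (V q) \<and> \<not> J (V q)"
    and Z: "J Z" "U - Z = (\<Union>q\<in>\<Q>. V q)"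
    and func0: "\<forall>g\<in>U. \<forall>q\<in>\<Q>. \<forall>r\<in>\<Q>. \<forall>s\<in>\<Q>. \<forall>b\<in>V q. \<forall>b'\<in>V q. b \<otimes> g \<in> V r \<longrightarrow> b' \<otimes> g \<in> V s \<longrightarrow> r = s"
  defines "N \<equiv> {g \<in> U. \<forall>q\<in>\<Q>. moves V g q q}"
  shows "definable L \<M> M N" "N \<lhd> G" "finite (rcosets N)"
    and "\<And>b b' q. \<lbrakk>b' \<in> U - Z; inv b \<otimes> b' \<in> N; q \<in> \<Q>; b \<in> V q\<rbrakk> \<Longrightarrow> b' \<in> V q"
proof -
  have V: "q \<in> \<Q> \<Longrightarrow> definable L \<M> M (V q)" "q \<in> \<Q> \<Longrightarrow> \<not> J (V q)" for q using V0 by auto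
  have func: "r = s" if "g \<in> U" "q \<in> \<Q>" "r \<in> \<Q>" "s \<in> \<Q>" "b \<in> V q" "b' \<in> V q" "b \<otimes> g \<in> V r" "b' \<otimes> g \<in> V s"
    for g b b' q r s using func0 that by blast
  have VU: "V q \<subseteq> U" "V q \<inter> Z = {}" if "q \<in> \<Q>" for q using that Z(2) by blast+
  have func': "r = s" if "moves V g q r" "moves V g q s" "g \<in> U" "q \<in> \<Q>" "r \<in> \<Q>" "s \<in> \<Q>" for g q r s
    using that func unfolding moves_def by blast
  have pick: "\<exists>b\<in>V q. b \<otimes> g \<notin> Z \<and> b \<otimes> g \<otimes> h \<notin> Z" if "q \<in> \<Q>" "g \<in> U" "h \<in> U" for q g h
  proof (rule ccontr)
    assume neg: "\<not> ?thesis"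
    let ?Y = "{y \<in> U. y \<otimes> g \<in> Z} \<union> {y \<in> U. y \<otimes> (g \<otimes> h) \<in> Z}"
    have "J ?Y" using J_Un J_rtrans[OF Z(1)] that by simp
    moreover have "V q \<subseteq> ?Y" using neg VU(1)[OF that(1)] that assoc_U by fastforce
    ultimately show False using J_mono'[OF _ V(1)] V(2) that(1) MU by blast
  qed
  have total: "\<exists>r\<in>\<Q>. moves V g q r" if q: "q \<in> \<Q>" "g \<in> U" for q g
  proof -
    obtain b where b: "b \<in> V q" "b \<otimes> g \<notin> Z" using pick[OF q q(2)] by blast
    then have "b \<otimes> g \<in> (\<Union>q\<in>\<Q>. V q)" using Z(2) VU(1)[OF q(1)] q(2) by (metis DiffI mult_in_U subsetD)
    then show ?thesis using b(1) unfolding moves_def by blast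
  qed
  have comp: "moves V (g \<otimes> h) q s" if a: "moves V g q r" "moves V h r s" "g \<in> U" "h \<in> U" "q \<in> \<Q>" "r \<in> \<Q>" "s \<in> \<Q>" for g h q r s
  proof -
    obtain b where b: "b \<in> V q" "b \<otimes> g \<notin> Z" "b \<otimes> g \<otimes> h \<notin> Z" using pick[OF a(5,3,4)] by blast
    have bU: "b \<in> U" using b(1) VU(1)[OF a(5)] by blast
    then obtain r' s' where rs: "r' \<in> \<Q>" "b \<otimes> g \<in> V r'" "s' \<in> \<Q>" "b \<otimes> g \<otimes> h \<in> V s'"
      using Z(2) b a(3,4) by (metis DiffI UN_E mult_in_U)
    have "r' = r" using func'[OF _ a(1) a(3,5) rs(1) a(6)] b(1) rs(2) unfolding moves_def by blast
    then have "s' = s" using func'[OF _ a(2) a(4,6) rs(3) a(7)] rs unfolding moves_def by blast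
    then show ?thesis using b(1) rs(4) assoc_U[OF bU a(3,4)] unfolding moves_def by metis
  qed
  have one: "moves V \<one> q q" if "q \<in> \<Q>" for q
  proof -
    have "V q \<noteq> {}" using V(2)[OF that] J_empty by metis
    then obtain b where "b \<in> V q" by blast
    then show ?thesis using VU(1)[OF that] carrier_eq r_one unfolding moves_def by (metis subsetD)
  qed
  have inv: "moves V (inv g) r q" if a: "moves V g q r" "g \<in> U" "q \<in> \<Q>" "r \<in> \<Q>" for g q r
  proof -
    obtain s where s: "s \<in> \<Q>" "moves V (inv g) r s" using total[OF a(4), of "inv g"] a(2) by auto
    have "moves V (g \<otimes> inv g) q s" using comp[OF a(1) s(2)] a s(1) by simp
    then have "moves V \<one> q s" using r_inv carrier_eq a(2) by simp
    then show ?thesis using func'[OF _ one[OF a(3)]] s a(3) one_in_U by metis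
  qed
  have sub: "subgroup N G"
  proof (rule subgroupI)
    show "N \<subseteq> carrier G" unfolding N_def carrier_eq by blast
    show "N \<noteq> {}" using one unfolding N_def by (auto intro!: exI[of _ "\<one>"])
    show "inv g \<in> N" if "g \<in> N" for g using that inv unfolding N_def by auto
    show "g \<otimes> h \<in> N" if "g \<in> N" "h \<in> N" for g h using that comp unfolding N_def by auto
  qed
  show normal: "N \<lhd> G"
  proof (rule normal_invI[OF sub])
    fix x h assume x: "x \<in> carrier G" and h: "h \<in> N"
    have xU: "x \<in> U" "h \<in> U" using x h carrier_eq unfolding N_def by auto
    have "moves V (x \<otimes> h \<otimes> inv x) q q" if q: "q \<in> \<Q>" for q
    proof -
      obtain r where r: "r \<in> \<Q>" "moves V x q r" using total[OF q xU(1)] by blast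
      have "moves V h r r" using h r(1) unfolding N_def by blast
      then have "moves V (x \<otimes> h) q r" using comp[OF r(2)] xU q r(1) by blast
      then show ?thesis using comp[OF _ inv[OF r(2)]] xU q r(1) by simp
    qed
    then show "x \<otimes> h \<otimes> inv x \<in> N" using xU unfolding N_def by simp
  qed
  show "definable L \<M> M N"
  proof -
    have "dfn M (\<lambda>v. \<exists>x\<in>U. x \<in> V q \<and> x \<otimes> v 0 \<in> V q)" if q: "q \<in> \<Q>" for q
    proof -
      have "dfn M (\<lambda>w. w 0 \<in> V q \<and> w 0 \<otimes> w (Suc 0) \<in> V q)"
        using V(1)[OF q] MU by (intro dfn_conj definable_dfn definable_tm dtm_mult dtm_var)
      from dfn_exs[OF this] show ?thesis by simp
    qed
    then have "definable L \<M> M {g \<in> U. \<forall>q\<in>\<Q>. \<exists>x\<in>U. x \<in> V q \<and> x \<otimes> g \<in> V q}"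
      by (intro definableI dfn_Ball fin MU)
    moreover have "{g \<in> U. \<forall>q\<in>\<Q>. \<exists>x\<in>U. x \<in> V q \<and> x \<otimes> g \<in> V q} = N"
      using VU(1) unfolding N_def moves_def by blast
    ultimately show ?thesis by simp
  qed
  show "finite (rcosets N)"
  proof -
    \<comment> \<open>\<open>\<tau> g\<close> is the graph of the permutation induced by
      \<open>g\<close>. Finitely many graphs are possible, and equal graphs force equal
      cosets.\<close>
    define \<tau> where "\<tau> = (\<lambda>g. {(q, r). q \<in> \<Q> \<and> r \<in> \<Q> \<and> moves V g q r})"
    have eq: "N #> g = N #> h" if gh: "g \<in> U" "h \<in> U" "\<tau> g = \<tau> h" for g h
    proof -
      have "moves V (g \<otimes> inv h) q q" if q: "q \<in> \<Q>" for q
      proof -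
        obtain r where r: "r \<in> \<Q>" "moves V g q r" using total[OF q gh(1)] by blast
        then have "(q, r) \<in> \<tau> h" using q gh(3) by (auto simp: \<tau>_def)
        then have "moves V h q r" by (simp add: \<tau>_def)
        then show ?thesis using comp[OF r(2) inv] gh q r(1) by simp
      qed
      then have "g \<otimes> inv h \<in> N" using gh unfolding N_def by simp
      then have "N #> (g \<otimes> inv h) = N" using coset_join2 sub gh carrier_eq by simp
      then show ?thesis using coset_mult_inv1 gh carrier_eq subgroup.subset[OF sub] by metis
    qed
    have "\<tau> ` U \<subseteq> Pow (\<Q> \<times> \<Q>)" by (auto simp: \<tau>_def)
    then have fin: "finite (\<tau> ` U)" using fin by (meson finite_Pow_iff finite_SigmaI finite_subset)
    have "rcosets N \<subseteq> (\<lambda>t. N #> (SOME g. g \<in> U \<and> \<tau> g = t)) ` (\<tau> ` U)"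
    proof
      fix C assume "C \<in> rcosets N"
      then obtain g where g: "g \<in> U" "C = N #> g" unfolding RCOSETS_def carrier_eq by blast
      let ?h = "SOME h. h \<in> U \<and> \<tau> h = \<tau> g"
      have "?h \<in> U \<and> \<tau> ?h = \<tau> g" by (rule someI[of _ g]) (use g in simp)
      then have "C = N #> ?h" using eq g by metis
      then show "C \<in> (\<lambda>t. N #> (SOME g. g \<in> U \<and> \<tau> g = t)) ` (\<tau> ` U)" using g(1) by blast
    qed
    then show ?thesis using fin finite_subset by blast
  qed
  fix b b' q assume a: "b' \<in> U - Z" "inv b \<otimes> b' \<in> N" "q \<in> \<Q>" "b \<in> V q"
  have bU: "b \<in> U" using a VU by blast
  obtain r where r: "r \<in> \<Q>" "b' \<in> V r" using a(1) Z(2) by blast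
  have "moves V (inv b \<otimes> b') q r" unfolding moves_def using a bU r(2) by (intro bexI[of _ b]) auto
  moreover have "moves V (inv b \<otimes> b') q q" using a(2,3) unfolding N_def by blast
  ultimately have "r = q" using func' a bU r(1) by (metis DiffD1 inv_in_U mult_in_U)
  then show "b' \<in> V q" using r(2) by simp
qed

end

section \<open>Classes of wide types\<close>

locale stable_group = stable_rel L \<M> \<kappa> I M R k + ideal_group L \<M> \<kappa> I M G mul
  for L :: "('f, 'r) language" and \<M> :: "('f, 'r, 'a) struct" and \<kappa> :: "'k rel" and I M R k
    and G :: "('a, 'm) monoid_scheme" (structure) and mul +
  fixes A :: "'a set"
  assumes R_def: "R = (\<lambda>y x. y \<otimes> x \<in> A)" and A: "definable L \<M> {} A" and not_J_U: "\<not> J U"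
begin

lemma R_iff: "R y x \<longleftrightarrow> y \<otimes> x \<in> A" by (simp add: R_def)

definition sim :: "'a \<Rightarrow> 'a \<Rightarrow> bool" where
  "sim b c \<longleftrightarrow> (\<forall>a. wide M a \<longrightarrow> F a b = F a c)"

lemma wideM_ex: "\<exists>a. wide M a"
  using wide_in_set[OF smallM definable_U[OF MU] not_J_U] by blast

lemma wide_M: "wide B a \<Longrightarrow> M \<subseteq> B \<Longrightarrow> wide M a" by (rule wide_mono)

lemma F_eq_wide_left: "wide B a \<Longrightarrow> M \<subseteq> B \<Longrightarrow> b \<in> B \<Longrightarrow> wide M b \<Longrightarrow> F a b \<longleftrightarrow> b \<otimes> a \<in> A"
  using F_eq[OF freeI2[of b a]] wide_mono[of B a "M \<union> {b}"] by (simp add: R_iff)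

lemma F_eq_wide_right: "wide B b \<Longrightarrow> M \<subseteq> B \<Longrightarrow> a \<in> B \<Longrightarrow> wide M a \<Longrightarrow> F a b \<longleftrightarrow> b \<otimes> a \<in> A"
  using F_eq[OF freeI1[of a b]] wide_mono[of B b "M \<union> {a}"] by (simp add: R_iff)

lemma small_Un_finite: "finite C \<Longrightarrow> C \<subseteq> U \<Longrightarrow> small (M \<union> C)"
  by (intro small_Un smallM small_finite)

text \<open>For a copy \<open>a'\<close> of \<open>a\<close> wide over all elements involved,
  \<open>F a (d g)\<close> and \<open>F (g a') d\<close> both say that \<open>d g a'\<close> is in
  \<open>A\<close>. Wideness of the products over \<open>M\<close> is a separate hypothesis because
  \<open>g\<close> may lie outside \<open>M\<close>.\<close>

lemma sim_mult:
  assumes w: "wide M b" "wide M c" "wide M (b \<otimes> g)" "wide M (c \<otimes> g)" and g: "g \<in> U" and s: "sim b c"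
  shows "sim (b \<otimes> g) (c \<otimes> g)"
  unfolding sim_def
proof (intro allI impI)
  fix a assume a: "wide M a"
  define B where "B = M \<union> {b, c, g, b \<otimes> g, c \<otimes> g}"
  have U: "b \<in> U" "c \<in> U" using w wide_in by blast+
  have B: "small B" unfolding B_def using U g by (intro small_Un_finite) auto
  have MB: "M \<subseteq> B" by (auto simp: B_def)
  obtain a' where a': "tpeq a a'" "wide B a'" using wide_realize[OF a B MB] by blast
  have a'U: "a' \<in> U" by (rule wide_in[OF a'(2)])
  have ga: "wide B (g \<otimes> a')" using wide_lmult[OF a'(2) _ smallD[OF B]] by (simp add: B_def)
  have "F a (d \<otimes> g) = F (g \<otimes> a') d" if d: "d \<in> {b, c}" for d
  proof -
    have dw: "wide M d" "wide M (d \<otimes> g)" "d \<in> B" "d \<otimes> g \<in> B" "d \<in> U" using d w U by (auto simp: B_def)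
    have "F a (d \<otimes> g) = F a' (d \<otimes> g)" by (rule F_tpeq[OF a dw(2) a'(1) tpeq_refl])
    also have "\<dots> \<longleftrightarrow> d \<otimes> g \<otimes> a' \<in> A" by (rule F_eq_wide_left[OF a'(2) MB dw(4,2)])
    also have "\<dots> \<longleftrightarrow> d \<otimes> (g \<otimes> a') \<in> A" using assoc_U dw(5) g a'U by simp
    also have "\<dots> \<longleftrightarrow> F (g \<otimes> a') d" using F_eq_wide_left[OF ga MB dw(3,1)] by simp
    finally show ?thesis .
  qed
  moreover have "F (g \<otimes> a') b = F (g \<otimes> a') c" using s wide_M[OF ga MB] unfolding sim_def by blast
  ultimately show "F a (b \<otimes> g) = F a (c \<otimes> g)" by simp
qed

text \<open>
  Every class of \<open>sim\<close> is a translate of an isolated one, because \<open>G\<close> acts transitively on the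
  wide types modulo \<open>sim\<close>; hence every class is definable.
\<close>

lemma class_definable:
  assumes c: "wide M c"
  shows "\<exists>D. definable L \<M> M D \<and> c \<in> D \<and> (\<forall>b. wide M b \<longrightarrow> (b \<in> D \<longleftrightarrow> sim b c))"
proof -
  have "\<exists>E b. finite E \<and> E \<subseteq> {a. wide M a} \<times> UNIV \<and> b \<in> {a. wide M a} \<and> (\<forall>(a, \<epsilon>)\<in>E. F a b = \<epsilon>) \<and>
    (\<forall>c\<in>{a. wide M a}. (\<forall>(a, \<epsilon>)\<in>E. F a c = \<epsilon>) \<longrightarrow> (\<forall>a\<in>{a. wide M a}. F a c = F a b))"
  proof (rule isolated_point[where k = k])
    show False if "\<And>i. i \<in> {1..k} \<Longrightarrow> a i \<in> {a. wide M a} \<and> b i \<in> {a. wide M a}"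
      "\<And>i j. i \<in> {1..k} \<Longrightarrow> j \<in> {1..k} \<Longrightarrow> F (a i) (b j) \<longleftrightarrow> i \<le> j" for a b
      by (rule F_no_ladder[of a b]) (use that in auto)
    show "{a. wide M a} \<noteq> {}" using wideM_ex by blast
  qed
  then obtain E b0 where E: "finite E" "E \<subseteq> {a. wide M a} \<times> UNIV" and b0': "b0 \<in> {a. wide M a}"
    and E0: "\<forall>(a, \<epsilon>)\<in>E. F a b0 = \<epsilon>"
    and iso0: "\<forall>c\<in>{a. wide M a}. (\<forall>(a, \<epsilon>)\<in>E. F a c = \<epsilon>) \<longrightarrow> (\<forall>a\<in>{a. wide M a}. F a c = F a b0)"
    by (elim exE conjE)
  have b0: "wide M b0" using b0' by simp
  have Ew: "wide M a" if "(a, \<epsilon>) \<in> E" for a \<epsilon> using E(2) that by blast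
  have iso: "F a d = F a b0" if d: "wide M d" "\<And>a \<epsilon>. (a, \<epsilon>) \<in> E \<Longrightarrow> F a d = \<epsilon>" and a: "wide M a" for a d
  proof -
    have "\<forall>(a, \<epsilon>)\<in>E. F a d = \<epsilon>" using d(2) by blast
    then show ?thesis using iso0 d(1) a by simp
  qed
  \<comment> \<open>Right translation by \<open>h\<close> takes \<open>c\<close> to
    \<open>b0\<close>, and \<open>g\<close> is the inverse of \<open>h\<close>. The conditions
    isolating \<open>b0\<close> are pulled back along this translation.\<close>
  define g where "g = inv b0 \<otimes> c"
  define h where "h = inv c \<otimes> b0"
  have U: "b0 \<in> U" "c \<in> U" using b0 c wide_in by blast+
  have gh: "g \<in> U" "h \<in> U" "c \<otimes> h = b0" using U by (auto simp: g_def h_def)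
  have hg: "h \<otimes> (g \<otimes> x) = x" if "x \<in> U" for x
    using that U unfolding g_def h_def by (simp add: assoc_U)
  define B where "B = M \<union> {b0, c, g, h}"
  have B: "small B" unfolding B_def using U gh by (intro small_Un_finite) auto
  have BU: "B \<subseteq> U" by (rule smallD[OF B])
  have MB: "M \<subseteq> B" and inB: "b0 \<in> B" "c \<in> B" "g \<in> B" "h \<in> B" by (auto simp: B_def)
  define p where "p = (\<lambda>a. SOME a'. tpeq a a' \<and> wide B a')"
  have p: "tpeq a (p a)" "wide B (p a)" if "wide M a" for a
    using someI_ex[OF wide_realize[OF that B MB]] unfolding p_def by blast+
  \<comment> \<open>\<open>F (q a)\<close> at \<open>d\<close> plays the part of \<open>F a\<close>
    at \<open>d \<otimes> h\<close>. The copy \<open>p a\<close> is wide over the translating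
    elements, so \<open>h \<otimes> p a\<close> is wide as well.\<close>
  define q where "q = (\<lambda>a. h \<otimes> p a)"
  have q: "wide B (q a)" if "wide M a" for a
    unfolding q_def by (rule wide_lmult[OF p(2)[OF that] inB(4) BU])
  have qM: "wide M (q a)" if "wide M a" for a using wide_M[OF q[OF that] MB] .
  have qc: "F (q a) c = \<epsilon>" if "(a, \<epsilon>) \<in> E" for a \<epsilon>
  proof -
    have a: "wide M a" using Ew that .
    have pU: "p a \<in> U" using p(2)[OF a] wide_in by blast
    have "F (q a) c \<longleftrightarrow> c \<otimes> (h \<otimes> p a) \<in> A"
      using F_eq_wide_left[OF q[OF a] MB inB(2) c] by (simp add: q_def)
    also have "\<dots> \<longleftrightarrow> b0 \<otimes> p a \<in> A" using assoc_U[OF U(2) gh(2) pU] gh(3) by simp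
    also have "\<dots> \<longleftrightarrow> F (p a) b0" using F_eq_wide_left[OF p(2)[OF a] MB inB(1) b0] by simp
    also have "\<dots> \<longleftrightarrow> F a b0" using F_tpeq[OF a b0 p(1)[OF a] tpeq_refl] by simp
    also have "\<dots> = \<epsilon>" using E0 that by blast
    finally show ?thesis .
  qed
  have sim: "sim d c" if d: "wide M d" "\<And>a \<epsilon>. (a, \<epsilon>) \<in> E \<Longrightarrow> F (q a) d = \<epsilon>" for d
    unfolding sim_def
  proof (intro allI impI)
    fix a assume a: "wide M a"
    obtain a1 where a1: "tpeq a a1" "wide B a1" using wide_realize[OF a B MB] by blast
    have a1U: "a1 \<in> U" by (rule wide_in[OF a1(2)])
    have a1M: "wide M a1" by (rule wide_M[OF a1(2) MB])
    have ga1: "wide M (g \<otimes> a1)" using wide_lmult[OF a1(2) inB(3) BU] MB by (rule wide_M)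
    define C where "C = M \<union> ({b0, c, g, h, a1, g \<otimes> a1} \<union> p ` fst ` E \<union> q ` fst ` E)"
    have pqU: "p x \<in> U" "q x \<in> U" if "x \<in> fst ` E" for x
      using that Ew p(2) q wide_in by force+
    have C: "small C" unfolding C_def
      using U gh a1U E(1) pqU by (intro small_Un_finite) auto
    have CU: "C \<subseteq> U" by (rule smallD[OF C])
    have MC: "M \<subseteq> C" and inC: "h \<in> C" "a1 \<in> C" "g \<otimes> a1 \<in> C" by (auto simp: C_def)
    \<comment> \<open>A generic copy of \<open>e\<close> is moved to \<open>e1 \<otimes> h\<close>,
      where it satisfies the conditions \<open>E\<close> and hence behaves like \<open>b0\<close>;
      the shift is undone by \<open>h \<otimes> (g \<otimes> a1) = a1\<close>. As the right-hand
      side does not mention \<open>e\<close>, the elements \<open>d\<close> and \<open>c\<close>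
      agree.\<close>
    have "F a e = F (g \<otimes> a1) b0" if e: "wide M e" "\<And>a \<epsilon>. (a, \<epsilon>) \<in> E \<Longrightarrow> F (q a) e = \<epsilon>" for e
    proof -
      obtain e1 where e1: "tpeq e e1" "wide C e1" using wide_realize[OF e(1) C MC] by blast
      have e1U: "e1 \<in> U" by (rule wide_in[OF e1(2)])
      have eh: "wide C (e1 \<otimes> h)" by (rule wide_rmult[OF e1(2) inC(1) CU])
      have ehM: "wide M (e1 \<otimes> h)" by (rule wide_M[OF eh MC])
      have "F x (e1 \<otimes> h) = \<epsilon>" if x: "(x, \<epsilon>) \<in> E" for x \<epsilon>
      proof -
        have w: "wide M x" "wide M (p x)" "wide M (q x)"
          using Ew[OF x] wide_M[OF p(2)[OF Ew[OF x]] MB] qM[OF Ew[OF x]] by auto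
        have in': "p x \<in> C" "q x \<in> C" using x by (force simp: C_def)+
        have pU: "p x \<in> U" using in' CU by blast
        have "F x (e1 \<otimes> h) = F (p x) (e1 \<otimes> h)" by (rule F_tpeq[OF w(1) ehM p(1)[OF w(1)] tpeq_refl])
        also have "\<dots> \<longleftrightarrow> e1 \<otimes> h \<otimes> p x \<in> A" by (rule F_eq_wide_right[OF eh MC in'(1) w(2)])
        also have "\<dots> \<longleftrightarrow> e1 \<otimes> q x \<in> A" using assoc_U[OF e1U gh(2) pU] by (simp add: q_def)
        also have "\<dots> \<longleftrightarrow> F (q x) e1" using F_eq_wide_right[OF e1(2) MC in'(2) w(3)] by simp
        also have "\<dots> = F (q x) e" using F_tpeq[OF w(3) e(1) tpeq_refl e1(1)] by simp
        also have "\<dots> = \<epsilon>" by (rule e(2)[OF x])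
        finally show ?thesis .
      qed
      then have "F (g \<otimes> a1) (e1 \<otimes> h) = F (g \<otimes> a1) b0" by (rule iso[OF ehM _ ga1])
      moreover have "F (g \<otimes> a1) (e1 \<otimes> h) = F a e"
      proof -
        have "F (g \<otimes> a1) (e1 \<otimes> h) \<longleftrightarrow> e1 \<otimes> h \<otimes> (g \<otimes> a1) \<in> A" by (rule F_eq_wide_right[OF eh MC inC(3) ga1])
        also have "\<dots> \<longleftrightarrow> e1 \<otimes> a1 \<in> A" using assoc_U[OF e1U gh(2), of "g \<otimes> a1"] hg[OF a1U] gh(1) a1U by simp
        also have "\<dots> \<longleftrightarrow> F a1 e1" using F_eq_wide_right[OF e1(2) MC inC(2) a1M] by simp
        also have "\<dots> = F a e" using F_tpeq[OF a e(1) a1(1) e1(1)] by simp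
        finally show ?thesis .
      qed
      ultimately show ?thesis by simp
    qed
    from this[OF d] this[OF c qc] show "F a d = F a c" by simp
  qed
  define D0 where "D0 = (\<lambda>a. SOME X. definable L \<M> M X \<and> (\<forall>b. wide M b \<longrightarrow> (b \<in> X \<longleftrightarrow> F (q a) b)))"
  have D0: "definable L \<M> M (D0 a)" "\<And>b. wide M b \<Longrightarrow> b \<in> D0 a \<longleftrightarrow> F (q a) b" if "wide M a" for a
    using someI_ex[OF F_definable[OF qM[OF that]]] unfolding D0_def by blast+
  define D where "D = {y \<in> U. \<forall>x\<in>E. y \<in> D0 (fst x) \<longleftrightarrow> snd x}"
  have "definable L \<M> M D" unfolding D_def
    using E(1) D0(1) Ew by (intro definableI dfn_Ball dfn_iff dfn_bool definable_dfn MU) auto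
  moreover have D: "b \<in> D \<longleftrightarrow> (\<forall>(a, \<epsilon>)\<in>E. F (q a) b = \<epsilon>)" if b: "wide M b" for b
    unfolding D_def using D0(2)[OF Ew b] wide_in[OF b] by (auto split: prod.splits)
  moreover have "c \<in> D" using D[OF c] qc by blast
  moreover have "b \<in> D \<longleftrightarrow> sim b c" if b: "wide M b" for b
  proof
    assume "b \<in> D"
    then show "sim b c" using D[OF b] by (intro sim[OF b]) auto
  next
    assume s: "sim b c"
    have "F (q a) b = \<epsilon>" if x: "(a, \<epsilon>) \<in> E" for a \<epsilon>
      using s qc[OF x] qM[OF Ew[OF x]] unfolding sim_def by simp
    then show "b \<in> D" using D[OF b] by blast
  qed
  ultimately show ?thesis by blast
qed

text \<open>If no finitely many classes covered \<open>G\<close> up to the ideal,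
  \<open>wide_ext\<close> would give a wide element outside every class, yet it belongs to its own.
  A class \<open>q\<close> is kept as a set of wide elements, while \<open>V q\<close> is a
  definable set with the same wide elements.\<close>

lemma finite_classes:
  "\<exists>\<Q> V. finite \<Q> \<and> (\<forall>q\<in>\<Q>. definable L \<M> M (V q) \<and> q \<noteq> {} \<and> {b \<in> V q. wide M b} = q
      \<and> (\<forall>b\<in>q. \<forall>c. wide M c \<longrightarrow> (c \<in> q \<longleftrightarrow> sim c b)))
    \<and> (\<forall>b. wide M b \<longrightarrow> (\<exists>q\<in>\<Q>. b \<in> q))"
proof -
  define D where "D = (\<lambda>c. SOME D. definable L \<M> M D \<and> c \<in> D \<and> (\<forall>b. wide M b \<longrightarrow> (b \<in> D \<longleftrightarrow> sim b c)))"
  have D: "definable L \<M> M (D c)" "c \<in> D c" "\<And>b. wide M b \<Longrightarrow> b \<in> D c \<longleftrightarrow> sim b c" if "wide M c" for c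
    using someI_ex[OF class_definable[OF that]] unfolding D_def by blast+
  have "\<exists>C. finite C \<and> C \<subseteq> {c. wide M c} \<and> J {y \<in> U. \<forall>X\<in>(\<lambda>c. U - D c) ` C. y \<in> X}"
  proof (rule ccontr)
    assume neg: "\<not> ?thesis"
    have "\<exists>b. wide M b \<and> (\<forall>X\<in>(\<lambda>c. U - D c) ` {c. wide M c}. b \<in> X)"
    proof (rule wide_ext[OF smallM])
      show "definable L \<M> M X" if "X \<in> (\<lambda>c. U - D c) ` {c. wide M c}" for X
        using that D(1) definable_Diff[OF MU definable_U[OF MU]] by auto
      fix F assume "finite F" "F \<subseteq> (\<lambda>c. U - D c) ` {c. wide M c}"
      from finite_subset_image[OF this] obtain C where "C \<subseteq> {c. wide M c}" "finite C" "F = (\<lambda>c. U - D c) ` C"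
        by blast
      then show "\<not> J {y \<in> U. \<forall>X\<in>F. y \<in> X}" using neg by simp
    qed
    then obtain b where b: "wide M b" "\<forall>X\<in>(\<lambda>c. U - D c) ` {c. wide M c}. b \<in> X" by (elim exE conjE)
    have "b \<in> U - D b" using bspec[OF b(2), of "U - D b"] b(1) by simp
    then show False using D(2)[OF b(1)] by simp
  qed
  then obtain C where C: "finite C" "C \<subseteq> {c. wide M c}" "J {y \<in> U. \<forall>X\<in>(\<lambda>c. U - D c) ` C. y \<in> X}" by blast
  define cl where "cl = (\<lambda>c. {b \<in> D c. wide M b})"
  define \<Q> where "\<Q> = cl ` C"
  define V where "V = (\<lambda>q. D (SOME c. c \<in> C \<and> cl c = q))"
  have V: "\<exists>c\<in>C. cl c = q \<and> V q = D c" if "q \<in> \<Q>" for q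
  proof -
    have "\<exists>c. c \<in> C \<and> cl c = q" using that unfolding \<Q>_def by blast
    from someI_ex[OF this] show ?thesis unfolding V_def by blast
  qed
  have sim_sym: "sim a b \<Longrightarrow> sim b a" and sim_trans: "sim a b \<Longrightarrow> sim b c \<Longrightarrow> sim a c" for a b c
    unfolding sim_def by auto
  have f1: "definable L \<M> M (V q) \<and> q \<noteq> {} \<and> {b \<in> V q. wide M b} = q
      \<and> (\<forall>b\<in>q. \<forall>c. wide M c \<longrightarrow> (c \<in> q \<longleftrightarrow> sim c b))" if q: "q \<in> \<Q>" for q
  proof -
    obtain c where c: "c \<in> C" "cl c = q" "V q = D c" using V[OF q] by blast
    have w: "wide M c" using c(1) C(2) by blast
    have "c \<in> q" using c(2) D(2)[OF w] w unfolding cl_def by blast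
    moreover have "x \<in> q \<longleftrightarrow> sim x b" if "b \<in> q" "wide M x" for b x
      using that D(3)[OF w] sim_sym sim_trans unfolding c(2)[symmetric] cl_def by blast
    ultimately show ?thesis using D(1)[OF w] c(2,3) unfolding cl_def by auto
  qed
  have f2: "\<exists>q\<in>\<Q>. b \<in> q" if b: "wide M b" for b
  proof -
    have "definable L \<M> M {y \<in> U. \<forall>X\<in>(\<lambda>c. U - D c) ` C. y \<in> X}"
      using C(1,2) D(1) definable_Diff[OF MU definable_U[OF MU]] by (intro definable_Ball MU) auto
    then have "b \<notin> {y \<in> U. \<forall>X\<in>(\<lambda>c. U - D c) ` C. y \<in> X}" using wideD[OF b] C(3) by blast
    then obtain c where c: "c \<in> C" "b \<in> D c" using wide_in[OF b] by blast
    have "cl c \<in> \<Q>" unfolding \<Q>_def using c(1) by (rule imageI)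
    moreover have "b \<in> cl c" unfolding cl_def using c(2) b by simp
    ultimately show ?thesis by (rule bexI[rotated])
  qed
  have "finite \<Q>" using C(1) unfolding \<Q>_def by simp
  then show ?thesis by (intro exI[of _ \<Q>] exI[of _ V] conjI ballI[OF f1] allI impI f2)
qed

text \<open>Compactness turns \<open>sim_mult\<close> into a statement about definable sets.\<close>

lemma separating_set:
  assumes V: "definable L \<M> M V1" "definable L \<M> M V2" "definable L \<M> M V3"
    and no: "\<And>g b c. \<lbrakk>g \<in> U; wide M b; wide M c; wide M (b \<otimes> g); wide M (c \<otimes> g);
      b \<in> V1; c \<in> V1; b \<otimes> g \<in> V2; c \<otimes> g \<in> V3\<rbrakk> \<Longrightarrow> False"
  shows "\<exists>Z. definable L \<M> M Z \<and> J Z \<and> (\<forall>g\<in>U. \<forall>b\<in>V1 - Z. \<forall>c\<in>V1 - Z. b \<otimes> g \<in> V2 - Z \<longrightarrow> c \<otimes> g \<in> V3 - Z \<longrightarrow> False)"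
proof -
  define h where "h = (\<lambda>(Z :: 'a set) v. v (1::nat) \<notin> Z \<and> v 2 \<notin> Z \<and> v 1 \<otimes> v 0 \<notin> Z \<and> v 2 \<otimes> v 0 \<notin> Z)"
  define t where "t = (\<lambda>v. v (1::nat) \<in> V1 \<and> v 2 \<in> V1 \<and> v 1 \<otimes> v 0 \<in> V2 \<and> v 2 \<otimes> v 0 \<in> V3)"
  let ?D = "{Z. definable L \<M> M Z \<and> J Z}"
  have "\<not> (\<forall>E. finite E \<longrightarrow> E \<subseteq> h ` ?D \<union> {t} \<longrightarrow> (\<exists>v\<in>asg. \<forall>P\<in>E. P v))"
  proof
    assume fip: "\<forall>E. finite E \<longrightarrow> E \<subseteq> h ` ?D \<union> {t} \<longrightarrow> (\<exists>v\<in>asg. \<forall>P\<in>E. P v)"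
    have "\<exists>v\<in>asg. \<forall>P\<in>h ` ?D \<union> {t}. P v"
    proof (rule realize[OF smallM])
      fix P assume "P \<in> h ` ?D \<union> {t}"
      then consider Z where "definable L \<M> M Z" "P = h Z" | "P = t" by blast
      then show "dfn M P"
      proof cases
        case 1
        then show ?thesis unfolding 1(2) h_def
          by (intro dfn_conj dfn_not definable_tm[OF 1(1)] dtm_mult dtm_var MU)
      next
        case 2
        then show ?thesis unfolding 2 t_def
          by (intro dfn_conj definable_tm[OF V(1)] definable_tm[OF V(2)] definable_tm[OF V(3)] dtm_mult dtm_var MU)
      qed
    qed (use fip in blast)
    then obtain v where v: "v \<in> asg" "\<forall>P\<in>h ` ?D \<union> {t}. P v" by (rule bexE)
    have vU: "v n \<in> U" for n by (rule asgD[OF v(1)])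
    have "h Z v" if "definable L \<M> M Z" "J Z" for Z using bspec[OF v(2), of "h Z"] that by simp
    then have "wide M (v 1)" "wide M (v 2)" "wide M (v 1 \<otimes> v 0)" "wide M (v 2 \<otimes> v 0)"
      unfolding wide_def h_def using vU by auto
    moreover have "t v" using bspec[OF v(2), of t] by simp
    ultimately show False using no[of "v 0" "v 1" "v 2"] vU unfolding t_def by blast
  qed
  then obtain E where E: "finite E" "E \<subseteq> h ` ?D \<union> {t}" "\<not> (\<exists>v\<in>asg. \<forall>P\<in>E. P v)"
    unfolding not_all not_imp by (elim exE conjE)
  obtain Zs where Zs: "Zs \<subseteq> ?D" "finite Zs" "E \<inter> h ` ?D = h ` Zs"
    using finite_subset_image[of "E \<inter> h ` ?D" h ?D] E(1) by blast
  have d1: "definable L \<M> M (\<Union>Zs)" using Zs by (intro definable_UN MU) auto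
  have "J (\<Union>Z\<in>Zs. Z)" using Zs by (intro J_UN) auto
  then have d2: "J (\<Union>Zs)" by simp
  have d3: False if x: "g \<in> U" "b \<in> V1 - \<Union>Zs" "c \<in> V1 - \<Union>Zs" "b \<otimes> g \<in> V2 - \<Union>Zs" "c \<otimes> g \<in> V3 - \<Union>Zs" for g b c
  proof -
    let ?v = "g ## b ## (\<lambda>_. c)"
    have v: "?v 0 = g" "?v 1 = b" "?v 2 = c" by (simp_all add: numeral_2_eq_2)
    have "?v \<in> asg" using x definable_subset[OF V(1)] by auto
    moreover have "P ?v" if P: "P \<in> E" for P
    proof -
      have "P \<in> h ` ?D \<union> {t}" by (rule subsetD[OF E(2) P])
      then have "P \<in> (E \<inter> h ` ?D) \<union> {t}" using P by (simp only: Un_iff Int_iff simp_thms)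
      then have "P \<in> h ` Zs \<union> {t}" unfolding Zs(3) .
      then show ?thesis
      proof (elim UnE imageE singletonE)
        fix Z assume "P = h Z" "Z \<in> Zs"
        then show ?thesis using x by (simp add: h_def v)
      next
        assume "P = t"
        then show ?thesis using x by (simp add: t_def v)
      qed
    qed
    ultimately show False using E(3) by blast
  qed
  show ?thesis by (intro exI[of _ "\<Union>Zs"] conjI d1 d2 ballI impI) (rule d3)
qed

section \<open>Assembling the subgroup and the union of cosets\<close>

theorem union_of_cosets:
  "\<exists>H B. definable L \<M> M H \<and> H \<lhd> G \<and> finite (rcosets H) \<and>
     (\<exists>\<C>. finite \<C> \<and> \<C> \<subseteq> rcosets H \<and> B = \<Union>\<C>) \<and> J ((A - B) \<union> (B - A))"
proof -
  obtain \<Q> V0 where Q1: "finite \<Q>"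
    and Q2: "\<forall>q\<in>\<Q>. definable L \<M> M (V0 q) \<and> q \<noteq> {} \<and> {b \<in> V0 q. wide M b} = q
      \<and> (\<forall>b\<in>q. \<forall>c. wide M c \<longrightarrow> (c \<in> q \<longleftrightarrow> sim c b))"
    and Q3: "\<forall>b. wide M b \<longrightarrow> (\<exists>q\<in>\<Q>. b \<in> q)"
    using finite_classes by (elim exE conjE)
  have Q: "finite \<Q>" "q \<in> \<Q> \<Longrightarrow> definable L \<M> M (V0 q)" "q \<in> \<Q> \<Longrightarrow> q \<noteq> {}"
    "q \<in> \<Q> \<Longrightarrow> {b \<in> V0 q. wide M b} = q" "q \<in> \<Q> \<Longrightarrow> b \<in> q \<Longrightarrow> wide M c \<Longrightarrow> c \<in> q \<longleftrightarrow> sim c b"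
    "wide M b \<Longrightarrow> \<exists>q\<in>\<Q>. b \<in> q" for q b c
    using Q1 bspec[OF Q2, of q] Q3 by blast+
  have qw: "b \<in> q \<longleftrightarrow> b \<in> V0 q" if "q \<in> \<Q>" "wide M b" for q b using Q(4)[OF that(1)] that(2) by blast
  have qwide: "wide M b" if "q \<in> \<Q>" "b \<in> q" for q b using Q(4)[OF that(1)] that(2) by blast
  have sim_sym: "sim a b \<Longrightarrow> sim b a" and sim_trans: "sim a b \<Longrightarrow> sim b c \<Longrightarrow> sim a c" for a b c
    unfolding sim_def by auto
  have same: "q = r" if "q \<in> \<Q>" "r \<in> \<Q>" "b \<in> q" "c \<in> r" "sim b c" for q r b c
  proof -
    have "x \<in> q \<longleftrightarrow> x \<in> r" if "wide M x" for x
      using Q(5)[OF \<open>q \<in> \<Q>\<close> \<open>b \<in> q\<close> that] Q(5)[OF \<open>r \<in> \<Q>\<close> \<open>c \<in> r\<close> that] \<open>sim b c\<close> sim_sym sim_trans by blast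
    then show ?thesis using qwide that(1,2) by blast
  qed
  have "\<exists>Z. definable L \<M> M Z \<and> J Z \<and> (\<forall>g\<in>U. \<forall>b\<in>V0 q - Z. \<forall>c\<in>V0 q - Z.
      b \<otimes> g \<in> V0 r - Z \<longrightarrow> c \<otimes> g \<in> V0 s - Z \<longrightarrow> False)"
    if qrs: "q \<in> \<Q>" "r \<in> \<Q>" "s \<in> \<Q>" "r \<noteq> s" for q r s
  proof (rule separating_set[OF Q(2)[OF qrs(1)] Q(2)[OF qrs(2)] Q(2)[OF qrs(3)]])
    fix g b c assume a: "g \<in> U" "wide M b" "wide M c" "wide M (b \<otimes> g)" "wide M (c \<otimes> g)"
      "b \<in> V0 q" "c \<in> V0 q" "b \<otimes> g \<in> V0 r" "c \<otimes> g \<in> V0 s"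
    have "b \<in> q" "c \<in> q" "b \<otimes> g \<in> r" "c \<otimes> g \<in> s" using a qrs qw by auto
    moreover from this have "sim b c" using Q(5)[OF qrs(1), of c b] a by blast
    then have "sim (b \<otimes> g) (c \<otimes> g)" using sim_mult a by blast
    ultimately show False using same qrs by blast
  qed
  then have "\<forall>q r s. \<exists>Z. q \<in> \<Q> \<and> r \<in> \<Q> \<and> s \<in> \<Q> \<and> r \<noteq> s \<longrightarrow> definable L \<M> M Z \<and> J Z \<and>
    (\<forall>g\<in>U. \<forall>b\<in>V0 q - Z. \<forall>c\<in>V0 q - Z. b \<otimes> g \<in> V0 r - Z \<longrightarrow> c \<otimes> g \<in> V0 s - Z \<longrightarrow> False)"
    by blast
  then obtain Zf where Zf: "\<And>q r s. q \<in> \<Q> \<Longrightarrow> r \<in> \<Q> \<Longrightarrow> s \<in> \<Q> \<Longrightarrow> r \<noteq> s \<Longrightarrow> definable L \<M> M (Zf q r s) \<and> J (Zf q r s) \<and>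
    (\<forall>g\<in>U. \<forall>b\<in>V0 q - Zf q r s. \<forall>c\<in>V0 q - Zf q r s.
      b \<otimes> g \<in> V0 r - Zf q r s \<longrightarrow> c \<otimes> g \<in> V0 s - Zf q r s \<longrightarrow> False)"
    by metis
  define T where "T = {(q, r, s). q \<in> \<Q> \<and> r \<in> \<Q> \<and> s \<in> \<Q> \<and> r \<noteq> s}"
  define T2 where "T2 = {(q, r). q \<in> \<Q> \<and> r \<in> \<Q> \<and> q \<noteq> r}"
  have finT: "finite T" "finite T2"
  proof -
    have "T \<subseteq> \<Q> \<times> \<Q> \<times> \<Q>" "T2 \<subseteq> \<Q> \<times> \<Q>" by (auto simp: T_def T2_def)
    then show "finite T" "finite T2" using Q(1) by (meson finite_SigmaI finite_subset)+
  qed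
  \<comment> \<open>Three kinds of exceptions are removed to get an honest partition on which
    translations act as functions: those from \<open>separating_set\<close>, the overlaps of two
    pieces, and the points in no piece. Each is \<open>M\<close>-definable and in the ideal.\<close>
  define Zs where "Zs = (\<lambda>(q, r, s). Zf q r s) ` T \<union> (\<lambda>(q, r). V0 q \<inter> V0 r) ` T2 \<union> {U - \<Union>(V0 ` \<Q>)}"
  define Z where "Z = \<Union>Zs"
  have JM: "J X" if X: "definable L \<M> M X" "\<And>b. wide M b \<Longrightarrow> b \<notin> X" for X
    using wide_in_set[OF smallM X(1)] X(2) by blast
  have Zs1: "definable L \<M> M X \<and> J X" if "X \<in> Zs" for X
  proof -
    have VU: "definable L \<M> M (\<Union>(V0 ` \<Q>))" using Q(1,2) by (intro definable_UN MU) auto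
    have "definable L \<M> M (V0 q \<inter> V0 r) \<and> J (V0 q \<inter> V0 r)" if qr: "q \<in> \<Q>" "r \<in> \<Q>" "q \<noteq> r" for q r
    proof (intro conjI)
      show d: "definable L \<M> M (V0 q \<inter> V0 r)" using Q(2) qr by (intro definable_Int MU) auto
      show "J (V0 q \<inter> V0 r)"
      proof (rule JM[OF d])
        fix b assume b: "wide M b"
        show "b \<notin> V0 q \<inter> V0 r"
        proof
          assume "b \<in> V0 q \<inter> V0 r"
          then have "b \<in> q" "b \<in> r" using qw qr b by auto
          moreover have "sim b b" by (simp add: sim_def)
          ultimately show False using same[OF qr(1,2)] qr(3) by blast
        qed
      qed
    qed
    moreover have "J (U - \<Union>(V0 ` \<Q>))"
    proof (rule JM[OF definable_Diff[OF MU definable_U[OF MU] VU]])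
      show "b \<notin> U - \<Union>(V0 ` \<Q>)" if b: "wide M b" for b using Q(6)[OF b] qw b by blast
    qed
    ultimately show ?thesis
      using that Zf definable_Diff[OF MU definable_U[OF MU] VU] unfolding Zs_def T_def T2_def by fast
  qed
  have finZ: "finite Zs" using finT by (simp add: Zs_def)
  have Zdef: "definable L \<M> M Z" unfolding Z_def using Zs1 finZ by (intro definable_UN MU) auto
  have "J (\<Union>X\<in>Zs. X)" using Zs1 finZ by (intro J_UN) auto
  then have JZ: "J Z" by (simp add: Z_def)
  define V where "V = (\<lambda>q. V0 q - Z)"
  have Vdef: "definable L \<M> M (V q)" if "q \<in> \<Q>" for q
    unfolding V_def by (rule definable_Diff[OF MU Q(2)[OF that] Zdef])
  have Vwide: "b \<in> V q \<longleftrightarrow> b \<in> q" if "q \<in> \<Q>" "wide M b" for q b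
    using qw[OF that] wideD[OF that(2) Zdef] JZ unfolding V_def by blast
  have VJ: "\<not> J (V q)" if q: "q \<in> \<Q>" for q
  proof -
    obtain b where "b \<in> q" using Q(3)[OF q] by blast
    then show ?thesis using wideD[OF qwide[OF q] Vdef[OF q]] Vwide[OF q] qwide[OF q] by blast
  qed
  have Vdisj: "q = r" if "q \<in> \<Q>" "r \<in> \<Q>" "b \<in> V q" "b \<in> V r" for q r b
  proof (rule ccontr)
    assume "q \<noteq> r"
    then have "(q, r) \<in> T2" using that by (simp add: T2_def)
    then have "V0 q \<inter> V0 r \<in> Zs" unfolding Zs_def by blast
    then have "b \<in> Z" using that unfolding V_def Z_def by blast
    then show False using that(3) by (simp add: V_def)
  qed
  have VUn: "U - Z = (\<Union>q\<in>\<Q>. V q)"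
  proof -
    have "U - \<Union>(V0 ` \<Q>) \<subseteq> Z" unfolding Z_def Zs_def by blast
    moreover have "V0 q \<subseteq> U" if "q \<in> \<Q>" for q using definable_subset[OF Q(2)[OF that]] .
    ultimately show ?thesis unfolding V_def by blast
  qed
  have VU: "V q \<subseteq> U" if "q \<in> \<Q>" for q using VUn that by blast
  have func: "r = s" if a: "g \<in> U" "q \<in> \<Q>" "r \<in> \<Q>" "s \<in> \<Q>" "b \<in> V q" "b' \<in> V q" "b \<otimes> g \<in> V r" "b' \<otimes> g \<in> V s"
    for g b b' q r s
  proof (rule ccontr)
    assume "r \<noteq> s"
    then have "(q, r, s) \<in> T" using a by (simp add: T_def)
    then have "Zf q r s \<in> Zs" unfolding Zs_def by force
    then have sub: "Zf q r s \<subseteq> Z" unfolding Z_def by blast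
    then have "b \<in> V0 q - Zf q r s" "b' \<in> V0 q - Zf q r s" "b \<otimes> g \<in> V0 r - Zf q r s" "b' \<otimes> g \<in> V0 s - Zf q r s"
      using a(5-8) unfolding V_def by blast+
    then show False using Zf[OF a(2-4) \<open>r \<noteq> s\<close>] a(1) by blast
  qed
  define N where "N = {g \<in> U. \<forall>q\<in>\<Q>. moves V g q q}"
  have V': "\<forall>q\<in>\<Q>. definable L \<M> M (V q) \<and> \<not> J (V q)" using Vdef VJ by simp
  have func': "\<forall>g\<in>U. \<forall>q\<in>\<Q>. \<forall>r\<in>\<Q>. \<forall>s\<in>\<Q>. \<forall>b\<in>V q. \<forall>b'\<in>V q. b \<otimes> g \<in> V r \<longrightarrow> b' \<otimes> g \<in> V s \<longrightarrow> r = s"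
    by (intro ballI impI) (rule func)
  note ps = partition_subgroup[OF Q(1) V' JZ VUn func', folded N_def]
  have N: "definable L \<M> M N" "N \<lhd> G" "finite (rcosets N)"
    using ps(1-3) by auto
  have Ncl: "b' \<in> V q" if "b' \<in> U - Z" "inv b \<otimes> b' \<in> N" "q \<in> \<Q>" "b \<in> V q" for b b' q
    using ps(4) that by blast
  have Nsub: "subgroup N G" using N(2) by (rule normal_imp_subgroup)
  have NU: "N \<subseteq> U" unfolding N_def by blast
  obtain a where a: "wide M a" using wideM_ex by blast
  have aU: "a \<in> U" by (rule wide_in[OF a])
  \<comment> \<open>For \<open>b\<close> wide over \<open>M\<close> and the fixed \<open>a\<close>,
    membership of \<open>b \<otimes> a\<close> in \<open>A\<close> is \<open>F a b\<close>, which
    depends only on the class of \<open>b\<close>. So the union \<open>Y\<close> of the pieces in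
    \<open>Q'\<close> agrees with the translate \<open>A'\<close> of \<open>A\<close> up to the
    ideal.\<close>
  define Q' where "Q' = {q \<in> \<Q>. \<exists>b\<in>q. F a b}"
  define Y where "Y = (\<Union>q\<in>Q'. V q)"
  have Q': "Q' \<subseteq> \<Q>" "finite Q'" using Q(1) by (auto simp: Q'_def)
  have YU: "Y \<subseteq> U" "Y \<inter> Z = {}" using VU Q' unfolding Y_def V_def by blast+
  define Ba where "Ba = M \<union> {a}"
  have Ba: "small Ba" "M \<subseteq> Ba" "a \<in> Ba" unfolding Ba_def using small_Un_finite[of "{a}"] aU by auto
  have BaU: "Ba \<subseteq> U" by (rule smallD[OF Ba(1)])
  define A' where "A' = {y \<in> U. y \<otimes> a \<in> A}"
  define S where "S = (A' - Y) \<union> (Y - A')"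
  have JS: "J S"
  proof (rule ccontr)
    have "definable L \<M> M Y" unfolding Y_def using Q' Vdef by (intro definable_UN[of "V ` Q'"] MU) auto
    then have dY: "definable L \<M> Ba Y" using definable_mono Ba(2) by blast
    have dA: "definable L \<M> Ba A'" unfolding A'_def using definable_mono[OF A] BaU Ba(3) by (intro rtrans_def) auto
    have "definable L \<M> Ba S" unfolding S_def
      by (rule definable_Un[OF BaU definable_Diff[OF BaU dA dY] definable_Diff[OF BaU dY dA]])
    moreover assume "\<not> J S"
    ultimately obtain b where b: "wide Ba b" "b \<in> S" using wide_in_set[OF Ba(1)] by blast
    have bM: "wide M b" by (rule wide_M[OF b(1) Ba(2)])
    have bU: "b \<in> U" by (rule wide_in[OF b(1)])
    obtain q where q: "q \<in> \<Q>" "b \<in> q" using Q(6)[OF bM] by blast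
    have Fb: "F a b \<longleftrightarrow> b \<in> A'" using F_eq_wide_right[OF b(1) Ba(2,3) a] bU by (simp add: A'_def)
    have "b \<in> Y \<longleftrightarrow> F a b"
    proof
      assume "b \<in> Y"
      then obtain r where r: "r \<in> Q'" "b \<in> V r" unfolding Y_def by blast
      then have br: "b \<in> r" using Vwide[OF _ bM] Q'(1) by blast
      obtain c where c: "c \<in> r" "F a c" using r(1) unfolding Q'_def by blast
      have "sim b c" using Q(5)[OF _ c(1) bM] br r(1) Q'(1) by blast
      then show "F a b" using c(2) a unfolding sim_def by blast
    next
      assume "F a b"
      then have "q \<in> Q'" using q unfolding Q'_def by blast
      then show "b \<in> Y" using Vwide[OF q(1) bM] q(2) unfolding Y_def by blast
    qed
    then show False using b(2) Fb unfolding S_def by blast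
  qed
  \<comment> \<open>\<open>A\<close> is recovered from \<open>A'\<close> by right translation with
    \<open>a\<close>. Outside \<open>Z\<close> the set \<open>Y\<close> is a union of left cosets of
    \<open>N\<close>, which by normality are right cosets, and translating these by \<open>a\<close>
    gives the cosets listed here.\<close>
  define \<C> where "\<C> = (\<lambda>b. N #> (b \<otimes> a)) ` Y"
  define B where "B = \<Union>\<C>"
  have C: "\<C> \<subseteq> rcosets N" using YU(1) aU carrier_eq unfolding \<C>_def RCOSETS_def by fastforce
  have finC: "finite \<C>" using C N(3) finite_subset by blast
  have CU: "X \<subseteq> U \<and> definable L \<M> U X" if X: "X \<in> \<C>" for X
  proof -
    obtain b where b: "b \<in> Y" "X = N #> (b \<otimes> a)" using X unfolding \<C>_def by blast
    let ?c = "b \<otimes> a"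
    have c: "?c \<in> U" using b(1) YU(1) aU by auto
    have NUd: "definable L \<M> U N" using definable_mono[OF N(1) MU] .
    have "dfn U (\<lambda>w. w 0 \<in> N \<and> w (Suc 0) = w 0 \<otimes> ?c)"
      using c by (intro dfn_conj definable_dfn[OF NUd] dfn_eq dtm_mult dtm_var dtm_const) auto
    from dfn_exs[OF this] have "definable L \<M> U {y \<in> U. \<exists>x\<in>U. x \<in> N \<and> y = x \<otimes> ?c}"
      by (intro definableI) simp
    moreover have "{y \<in> U. \<exists>x\<in>U. x \<in> N \<and> y = x \<otimes> ?c} = X"
      using NU c unfolding b(2) r_coset_def by auto
    ultimately show ?thesis using definable_subset by auto
  qed
  have BU: "definable L \<M> U B" unfolding B_def using finC CU by (intro definable_UN) auto
  have AU: "definable L \<M> U A" using definable_mono[OF A] by blast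
  have "J ((A - B) \<union> (B - A))"
  proof (rule J_mono)
    let ?W = "{y \<in> U. y \<otimes> inv a \<in> S} \<union> {y \<in> U. y \<otimes> inv a \<in> Z}"
    show "J ?W" using J_Un J_rtrans[OF JS] J_rtrans[OF JZ] aU by simp
    show "definable L \<M> U ((A - B) \<union> (B - A))"
      by (rule definable_Un[OF order_refl definable_Diff[OF order_refl AU BU] definable_Diff[OF order_refl BU AU]])
    show "(A - B) \<union> (B - A) \<subseteq> ?W"
    proof
      fix y assume y: "y \<in> (A - B) \<union> (B - A)"
      have yU: "y \<in> U" using y definable_subset[OF AU] definable_subset[OF BU] by blast
      define x where "x = y \<otimes> inv a"
      have x: "x \<in> U" "x \<otimes> a = y" using yU aU by (auto simp: x_def)
      have "x \<in> S" if xZ: "x \<notin> Z"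
      proof -
        have "x \<in> A' \<longleftrightarrow> y \<in> A" using x by (simp add: A'_def)
        moreover have "x \<in> Y \<longleftrightarrow> y \<in> B"
        proof
          assume "x \<in> Y"
          moreover have "y \<in> N #> (x \<otimes> a)"
            using subgroup.one_closed[OF Nsub] x yU carrier_eq unfolding r_coset_def by force
          ultimately show "y \<in> B" unfolding B_def \<C>_def by blast
        next
          assume "y \<in> B"
          then obtain b n where bn: "b \<in> Y" "n \<in> N" "y = n \<otimes> (b \<otimes> a)"
            unfolding B_def \<C>_def r_coset_def by blast
          have U: "b \<in> U" "n \<in> U" using bn YU NU by blast+
          have "x = n \<otimes> b" unfolding x_def bn(3) using U aU by (simp add: assoc_U[symmetric])
          then have "inv b \<otimes> x = inv b \<otimes> n \<otimes> b" using U by (simp add: assoc_U)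
          then have "inv b \<otimes> x \<in> N" using normal.inv_op_closed1[OF N(2), of b n] U bn(2) carrier_eq by simp
          moreover obtain q where "q \<in> Q'" "b \<in> V q" using bn(1) unfolding Y_def by blast
          ultimately show "x \<in> Y" using Ncl[of x b q] x(1) xZ Q'(1) unfolding Y_def by blast
        qed
        ultimately show ?thesis using y unfolding S_def by blast
      qed
      then show "y \<in> ?W" using yU unfolding x_def by blast
    qed
  qed
  then show ?thesis using N C finC B_def by blast
qed

end

section \<open>Small elementary substructures\<close>

lemma card_nat_le: "Cinfinite r \<Longrightarrow> |X :: nat set| \<le>o r"
proof -
  assume r: "Cinfinite r"
  have "|X| \<le>o |UNIV :: nat set|" by (rule card_of_mono1) simp
  also have "|UNIV :: nat set| =o natLeq" by (rule card_of_nat)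
  also have "natLeq \<le>o r" using r by (simp add: natLeq_ordLeq_cinfinite)
  finally show ?thesis .
qed

lemma card_finite_le: assumes r: "Cinfinite r" and X: "finite X" shows "|X| \<le>o r"
proof -
  obtain f and n :: nat where "f ` X = {i. i < n}" "inj_on f X"
    using finite_imp_inj_to_nat_seg[OF X] by blast
  then have "|X| \<le>o |UNIV :: nat set|" using card_of_ordLeq[of X "UNIV :: nat set"] by blast
  then show ?thesis using card_nat_le[OF r] ordLeq_transitive by blast
qed

lemma card_lists_le:
  assumes r: "Cinfinite r" and X: "|X| \<le>o r" shows "|lists X| \<le>o r"
proof -
  have n: "|{xs \<in> lists X. length xs = n}| \<le>o r" for n
  proof (induction n)
    case 0
    show ?case by (rule card_finite_le[OF r]) simp
  next
    case (Suc n)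
    have "{xs \<in> lists X. length xs = Suc n} \<subseteq> (\<lambda>(x, xs). x # xs) ` (X \<times> {xs \<in> lists X. length xs = n})"
    proof
      fix ys assume "ys \<in> {xs \<in> lists X. length xs = Suc n}"
      then obtain y zs where "ys = y # zs" "y \<in> X" "zs \<in> lists X" "length zs = n"
        by (cases ys) auto
      then show "ys \<in> (\<lambda>(x, xs). x # xs) ` (X \<times> {xs \<in> lists X. length xs = n})" by force
    qed
    then have "|{xs \<in> lists X. length xs = Suc n}| \<le>o |(\<lambda>(x, xs). x # xs) ` (X \<times> {xs \<in> lists X. length xs = n})|"
      by (rule card_of_mono1)
    also have "|(\<lambda>(x, xs). x # xs) ` (X \<times> {xs \<in> lists X. length xs = n})| \<le>o |X \<times> {xs \<in> lists X. length xs = n}|"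
      by (rule card_of_image)
    also have "|X \<times> {xs \<in> lists X. length xs = n}| \<le>o r"
      using r X Suc by (intro card_of_Times_ordLeq_infinite_Field) (auto simp: cinfinite_def)
    finally show ?case .
  qed
  have "lists X = (\<Union>n. {xs \<in> lists X. length xs = n})" by auto
  moreover have "|\<Union>n. {xs \<in> lists X. length xs = n}| \<le>o r"
  proof (rule UNION_Cinfinite_bound)
    have "|UNIV :: nat set| =o natLeq" by (rule card_of_nat)
    also have "natLeq \<le>o r" using r by (simp add: natLeq_ordLeq_cinfinite)
    finally show "|UNIV :: nat set| \<le>o r" .
  qed (use n r in auto)
  ultimately show ?thesis by simp
qed

lemma card_image_le': "|X| \<le>o r \<Longrightarrow> |f ` X| \<le>o r"
  using card_of_image ordLeq_transitive by blast

lemma card_Times_le: "Cinfinite r \<Longrightarrow> |X| \<le>o r \<Longrightarrow> |Y| \<le>o r \<Longrightarrow> |X \<times> Y| \<le>o r"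
  by (rule card_of_Times_ordLeq_infinite_Field) (auto simp: cinfinite_def)

lemma card_UN_nat_le: "Cinfinite r \<Longrightarrow> (\<And>n :: nat. |X n| \<le>o r) \<Longrightarrow> |\<Union>n. X n| \<le>o r"
  by (rule UNION_Cinfinite_bound) (auto intro: card_nat_le)

lemma list_in_UN_chain:
  assumes "\<And>n. T n \<subseteq> T (Suc n)" "set xs \<subseteq> (\<Union>n. T n)"
  shows "\<exists>n :: nat. set xs \<subseteq> T n"
  using assms(2)
proof (induction xs)
  case (Cons x xs)
  then obtain n m where nm: "set xs \<subseteq> T n" "x \<in> T m" by auto
  have "T n \<subseteq> T (max n m)" "T m \<subseteq> T (max n m)"
    by (rule lift_Suc_mono_le[of T]; use assms(1) in auto)+
  then show ?case using nm by (intro exI[of _ "max n m"]) auto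
qed auto

text \<open>Stages by depth let a cardinal bound pass through one constructor at a time and then
  through a countable union; \<open>fm_stage\<close> serves the same purpose for formulas.\<close>

primrec tm_stage :: "('f, 'r) language \<Rightarrow> nat \<Rightarrow> ('f, 'a) tm set" where
  "tm_stage L 0 = {}"
| "tm_stage L (Suc n) = tm_stage L n \<union> range Var \<union> (\<lambda>(f, ts). Fn f ts) ` (funs L \<times> lists (tm_stage L n))"

lemma tm_stage_covers: "wf_tm L t \<Longrightarrow> params_tm t = {} \<Longrightarrow> t \<in> (\<Union>n. tm_stage L n)"
proof (induction t)
  case (Var n)
  then show ?case by (auto intro!: exI[of _ "Suc 0"])
next
  case (Fn f ts)
  then have "set ts \<subseteq> (\<Union>n. tm_stage L n)" by fastforce
  then obtain n where "set ts \<subseteq> tm_stage L n" using list_in_UN_chain[of "tm_stage L" ts] by auto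
  then have "Fn f ts \<in> tm_stage L (Suc n)" using Fn.prems(1) by (auto simp: image_iff)
  then show ?case by blast
qed auto

lemma card_tms:
  assumes r: "Cinfinite r" and f: "|funs L| \<le>o r"
  shows "|{t :: ('f, 'a) tm. wf_tm L t \<and> params_tm t = {}}| \<le>o r"
proof -
  have "|tm_stage L n :: ('f, 'a) tm set| \<le>o r" for n
  proof (induction n)
    case 0
    show ?case by (rule card_finite_le[OF r]) simp
  next
    case (Suc n)
    then show ?case
      using r f by (auto intro!: Un_Cinfinite_bound card_image_le' card_Times_le card_lists_le card_nat_le)
  qed
  then have "|\<Union>n. tm_stage L n :: ('f, 'a) tm set| \<le>o r" by (rule card_UN_nat_le[OF r])
  moreover have "|{t :: ('f, 'a) tm. wf_tm L t \<and> params_tm t = {}}| \<le>o |\<Union>n. tm_stage L n :: ('f, 'a) tm set|"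
    using tm_stage_covers by (intro card_of_mono1) blast
  ultimately show ?thesis using ordLeq_transitive by blast
qed

primrec fm_stage :: "('f, 'r) language \<Rightarrow> nat \<Rightarrow> ('f, 'r, 'a) fm set" where
  "fm_stage L 0 = {}"
| "fm_stage L (Suc n) = fm_stage L n \<union> {Bot}
     \<union> (\<lambda>(s, t). Equal s t) ` ({t. wf_tm L t \<and> params_tm t = {}} \<times> {t. wf_tm L t \<and> params_tm t = {}})
     \<union> (\<lambda>(r, ts). Rel r ts) ` (rels L \<times> lists {t. wf_tm L t \<and> params_tm t = {}})
     \<union> Neg ` fm_stage L n \<union> (\<lambda>(\<phi>, \<psi>). Conj \<phi> \<psi>) ` (fm_stage L n \<times> fm_stage L n)
     \<union> (\<lambda>(\<phi>, \<psi>). Disj \<phi> \<psi>) ` (fm_stage L n \<times> fm_stage L n)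
     \<union> (\<lambda>(k, \<phi>). Exi k \<phi>) ` (UNIV \<times> fm_stage L n)"

lemma fm_stage_mono: "n \<le> m \<Longrightarrow> fm_stage L n \<subseteq> fm_stage L m"
  by (rule lift_Suc_mono_le[of "fm_stage L"]) auto

lemma fm_stage_covers: "wf_fm L \<phi> \<Longrightarrow> params \<phi> = {} \<Longrightarrow> \<exists>n. \<phi> \<in> fm_stage L n"
proof (induction \<phi>)
  case Bot
  then show ?case by (auto intro!: exI[of _ "Suc 0"])
next
  case (Equal s t)
  then show ?case by (auto intro!: exI[of _ "Suc 0"] simp: image_iff)
next
  case (Rel r ts)
  then show ?case by (auto intro!: exI[of _ "Suc 0"] simp: image_iff)
next
  case (Neg \<phi>)
  then obtain n where "\<phi> \<in> fm_stage L n" by auto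
  then show ?case by (auto intro!: exI[of _ "Suc n"] simp: image_iff)
next
  case (Conj \<phi> \<psi>)
  then obtain n m where "\<phi> \<in> fm_stage L n" "\<psi> \<in> fm_stage L m" by auto
  then have "\<phi> \<in> fm_stage L (max n m)" "\<psi> \<in> fm_stage L (max n m)"
    using fm_stage_mono[of _ "max n m"] by (meson max.cobounded1 max.cobounded2 subsetD)+
  then have "Conj \<phi> \<psi> \<in> fm_stage L (Suc (max n m))" by (auto simp: image_iff)
  then show ?case by blast
next
  case (Disj \<phi> \<psi>)
  then obtain n m where "\<phi> \<in> fm_stage L n" "\<psi> \<in> fm_stage L m" by auto
  then have "\<phi> \<in> fm_stage L (max n m)" "\<psi> \<in> fm_stage L (max n m)"
    using fm_stage_mono[of _ "max n m"] by (meson max.cobounded1 max.cobounded2 subsetD)+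
  then have "Disj \<phi> \<psi> \<in> fm_stage L (Suc (max n m))" by (auto simp: image_iff)
  then show ?case by blast
next
  case (Exi k \<phi>)
  then obtain n where "\<phi> \<in> fm_stage L n" by auto
  then show ?case by (auto intro!: exI[of _ "Suc n"] simp: image_iff)
qed

lemma card_formulas:
  assumes r: "Cinfinite r" and f: "|funs L| \<le>o r" and R: "|rels L| \<le>o r"
  shows "|formulas L {} UNIV :: ('f, 'r, 'a) fm set| \<le>o r"
proof -
  have "|fm_stage L n :: ('f, 'r, 'a) fm set| \<le>o r" for n
  proof (induction n)
    case 0
    show ?case by (rule card_finite_le[OF r]) simp
  next
    case (Suc n)
    have "|{Bot} :: ('f, 'r, 'a) fm set| \<le>o r" by (rule card_finite_le[OF r]) simp
    then show ?case
      unfolding fm_stage.simps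
      by (intro Un_Cinfinite_bound card_image_le' card_Times_le card_lists_le card_nat_le card_tms r f R Suc)
  qed
  then have "|\<Union>n. fm_stage L n :: ('f, 'r, 'a) fm set| \<le>o r" by (rule card_UN_nat_le[OF r])
  moreover have "|formulas L {} UNIV :: ('f, 'r, 'a) fm set| \<le>o |\<Union>n. fm_stage L n :: ('f, 'r, 'a) fm set|"
    using fm_stage_covers by (intro card_of_mono1) (auto simp: formulas_def)
  ultimately show ?thesis using ordLeq_transitive by blast
qed

lemma struct_univ:
  "univ (\<M>\<lparr>univ := M\<rparr>) = M" "fun_of (\<M>\<lparr>univ := M\<rparr>) = fun_of \<M>" "rel_of (\<M>\<lparr>univ := M\<rparr>) = rel_of \<M>"
  by simp_all

lemma val_univ: "val (\<M>\<lparr>univ := M\<rparr>) v t = val \<M> v t"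
proof (induction t)
  case (Fn f ts)
  then have "map (val (\<M>\<lparr>univ := M\<rparr>) v) ts = map (val \<M> v) ts" by simp
  then show ?case by (simp only: val.simps struct_univ)
qed auto

section \<open>Downward Loewenheim-Skolem inside a given substructure\<close>

context monster
begin

lemma tarski_vaught_elementary:
  assumes M: "M \<subseteq> U" "M \<noteq> {}"
    and tv: "\<And>\<phi> v n. \<phi> \<in> formulas L {} UNIV \<Longrightarrow> range v \<subseteq> M \<Longrightarrow> \<exists>a\<in>U. sat \<M> (v(n := a)) \<phi> \<Longrightarrow>
      \<exists>a\<in>M. sat \<M> (v(n := a)) \<phi>"
  shows "elementary_substructure L M \<M>"
  unfolding elementary_substructure_def
proof (intro conjI ballI allI impI)
  show "M \<subseteq> U" by fact
  obtain m where m: "m \<in> M" using M(2) by blast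
  show "is_structure L (\<M>\<lparr>univ := M\<rparr>)"
    unfolding is_structure_def struct_univ
  proof (intro conjI ballI allI impI)
    show "M \<noteq> {}" by fact
    fix f as assume f: "f \<in> funs L" and as: "set as \<subseteq> M \<and> length as = farity L f"
    \<comment> \<open>Closure under \<open>f\<close> comes from the criterion applied to an equation
      \<open>x = f as\<close>. The arguments occupy the variables below \<open>length as\<close>, so
      variable \<open>length as\<close> is available for \<open>x\<close>.\<close>
    define \<phi> where "\<phi> = (Equal (Var (length as)) (Fn f (map Var [0..<length as])) :: ('f, 'r, 'a) fm)"
    define v where "v = (\<lambda>i. if i < length as then as ! i else m)"
    have \<phi>: "\<phi> \<in> formulas L {} UNIV" using f as by (auto simp: \<phi>_def formulas_def)
    have sat: "sat \<M> (v(length as := a)) \<phi> \<longleftrightarrow> a = fun_of \<M> f as" for a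
    proof -
      have "map (\<lambda>i. (v(length as := a)) i) [0..<length as] = as"
        by (intro nth_equalityI) (auto simp: v_def)
      then have "map (val \<M> (v(length as := a))) (map Var [0..<length as]) = as" by (simp add: comp_def)
      then show ?thesis unfolding \<phi>_def sat.simps val.simps by simp
    qed
    have "fun_of \<M> f as \<in> U"
      using monster f as M(1) unfolding monster_model_def is_structure_def by blast
    moreover have "range v \<subseteq> M" using as m by (auto simp: v_def)
    ultimately obtain a where "a \<in> M" "sat \<M> (v(length as := a)) \<phi>" using tv[OF \<phi>] sat by blast
    then show "fun_of \<M> f as \<in> M" using sat by simp
  qed
  have "sat (\<M>\<lparr>univ := M\<rparr>) v \<phi> = sat \<M> v \<phi>"
    if "wf_fm L \<phi>" "params \<phi> = {}" "range v \<subseteq> M" for \<phi> v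
    using that
  proof (induction \<phi> arbitrary: v)
    case (Rel r ts)
    have "map (val (\<M>\<lparr>univ := M\<rparr>) v) ts = map (val \<M> v) ts" by (simp add: val_univ)
    then show ?case by (simp only: sat.simps struct_univ)
  next
    case (Exi n \<phi>)
    have \<phi>: "\<phi> \<in> formulas L {} UNIV" using Exi.prems by (auto simp: formulas_def)
    have IH: "sat (\<M>\<lparr>univ := M\<rparr>) (v(n := a)) \<phi> = sat \<M> (v(n := a)) \<phi>" if "a \<in> M" for a
      using Exi.prems that by (intro Exi.IH) auto
    have "(\<exists>a\<in>M. sat \<M> (v(n := a)) \<phi>) \<longleftrightarrow> (\<exists>a\<in>U. sat \<M> (v(n := a)) \<phi>)"
      using tv[OF \<phi> Exi.prems(3)] M(1) by blast
    then show ?case using IH by simp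
  qed (auto simp: val_univ)
  then show "sat (\<M>\<lparr>univ := M\<rparr>) v \<phi> = sat \<M> v \<phi>"
    if "\<phi> \<in> formulas L {} UNIV" "range v \<subseteq> M" for \<phi> v
    using that by (auto simp: formulas_def)
qed

text \<open>The hull of one point under chosen witnesses. They can be taken in \<open>M\<close> by
  \<open>tarski_vaught_step\<close>, and there are few of them since the number of formulas is
  bounded by natural numbers and symbols together, which is below \<open>\<kappa>\<close>.\<close>

lemma small_elementary_substructure:
  assumes M: "elementary_substructure L M \<M>"
  shows "\<exists>M0 \<subseteq> M. elementary_substructure L M0 \<M> \<and> small M0"
proof -
  have MU: "M \<subseteq> U" by (rule elementary_subset[OF M])
  obtain m where m: "m \<in> M" using elementary_nonempty[OF M] by blast
  define X where "X = (UNIV :: nat set) <+> (funs L <+> rels L)"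
  have \<kappa>: "Card_order \<kappa>" "\<not> finite (Field \<kappa>)" using Cinfinite_kappa by (auto simp: cinfinite_def)
  have nat: "|UNIV :: nat set| <o \<kappa>"
    using card_of_nat monster ordIso_ordLess_trans unfolding monster_model_def by blast
  have X\<kappa>: "|X| <o \<kappa>"
    unfolding X_def using monster nat
    by (intro card_of_Plus_ordLess_infinite_Field[OF \<kappa>(2,1)]) (auto simp: monster_model_def)
  have "infinite X" unfolding X_def by (simp add: finite_Plus_iff)
  then have r: "Cinfinite |X|" 
    unfolding cinfinite_def by (intro conjI card_of_Card_order) (simp add: Field_card_of)
  have fr: "|funs L| \<le>o |X|" "|rels L| \<le>o |X|"
    unfolding X_def by (meson card_of_Plus1 card_of_Plus2 ordLeq_transitive)+
  have form: "|formulas L {} UNIV :: ('f, 'r, 'a) fm set| \<le>o |X|" by (rule card_formulas[OF r fr])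
  \<comment> \<open>Assignments are coded by finite lists with default \<open>m\<close>: the lists
    over a set are few enough for the cardinal bound, while the functions from the natural numbers
    may be too many.\<close>
  define as where "as = (\<lambda>xs i. if i < length xs then xs ! i else m)"
  define w where "w = (\<lambda>(\<phi>, n, xs). if \<exists>a\<in>M. sat \<M> ((as xs)(n := a)) \<phi>
    then SOME a. a \<in> M \<and> sat \<M> ((as xs)(n := a)) \<phi> else m)"
  define N where "N = rec_nat {m} (\<lambda>_ S. S \<union> w ` (formulas L {} UNIV \<times> UNIV \<times> lists S))"
  have N: "N 0 = {m}" "N (Suc k) = N k \<union> w ` (formulas L {} UNIV \<times> UNIV \<times> lists (N k))" for k
    by (simp_all add: N_def)
  have wM: "w x \<in> M" for x
  proof -
    obtain \<phi> n xs where x: "x = (\<phi>, n, xs)" by (cases x)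
    show ?thesis
    proof (cases "\<exists>a\<in>M. sat \<M> ((as xs)(n := a)) \<phi>")
      case True
      then have "\<exists>a. a \<in> M \<and> sat \<M> ((as xs)(n := a)) \<phi>" by blast
      from someI_ex[OF this] show ?thesis using True by (simp add: w_def x)
    qed (simp add: w_def x m)
  qed
  have NM: "N k \<subseteq> M" for k by (induction k) (use m wM in \<open>auto simp: N\<close>)
  have card: "|N k| \<le>o |X|" for k
  proof (induction k)
    case 0
    show ?case by (rule card_finite_le[OF r]) (simp add: N)
  next
    case (Suc k)
    show ?case unfolding N
      by (intro Un_Cinfinite_bound card_image_le' card_Times_le card_lists_le card_nat_le form r Suc)
  qed
  define M0 where "M0 = (\<Union>k. N k)"
  have M0M: "M0 \<subseteq> M" using NM by (auto simp: M0_def)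
  have "|M0| \<le>o |X|" unfolding M0_def by (rule card_UN_nat_le[OF r card])
  then have "small M0" using X\<kappa> M0M MU ordLeq_ordLess_trans by (auto simp: small_def)
  moreover have "elementary_substructure L M0 \<M>"
  proof (rule tarski_vaught_elementary)
    show "M0 \<subseteq> U" using M0M MU by blast
    show "M0 \<noteq> {}" using N(1) by (auto simp: M0_def intro!: exI[of _ 0])
    fix \<phi> :: "('f, 'r, 'a) fm" and v n
    assume \<phi>: "\<phi> \<in> formulas L {} UNIV" and v: "range v \<subseteq> M0" and ex: "\<exists>a\<in>U. sat \<M> (v(n := a)) \<phi>"
    obtain K where K: "fv \<phi> \<subseteq> {..<K}" using finite_nat_bounded[OF finite_fv] by blast
    define xs where "xs = map v [0..<K]"
    have sat: "sat \<M> (v(n := a)) \<phi> = sat \<M> ((as xs)(n := a)) \<phi>" for a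
      using K by (intro sat_cong) (auto simp: as_def xs_def)
    have "dfn M (\<lambda>v. sat \<M> v \<phi>)" using \<phi> MU by (auto simp: dfn_def formulas_def)
    then have "\<exists>a\<in>M. sat \<M> (v(n := a)) \<phi>"
      using tarski_vaught_step[OF M, of "\<lambda>v. sat \<M> v \<phi>" v n] v M0M ex by blast
    then have ex': "\<exists>a\<in>M. sat \<M> ((as xs)(n := a)) \<phi>" using sat by simp
    then have "\<exists>a. a \<in> M \<and> sat \<M> ((as xs)(n := a)) \<phi>" by blast
    from someI_ex[OF this] have w: "sat \<M> ((as xs)(n := w (\<phi>, n, xs))) \<phi>" using ex' by (simp add: w_def)
    have "set xs \<subseteq> (\<Union>k. N k)" using v by (auto simp: xs_def M0_def)
    then obtain k where "set xs \<subseteq> N k" using list_in_UN_chain[of N xs] N(2) by blast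
    then have "w (\<phi>, n, xs) \<in> N (Suc k)" unfolding N(2) using \<phi> by blast
    then have "w (\<phi>, n, xs) \<in> M0" unfolding M0_def by blast
    then show "\<exists>a\<in>M0. sat \<M> (v(n := a)) \<phi>" using w sat by blast
  qed
  ultimately show ?thesis using M0M by blast
qed

end

section \<open>Deriving the theorem\<close>

lemma (in s1_model) independent_iff:
  assumes "set cs \<subseteq> U" shows "independent L \<M> I M cs \<longleftrightarrow> windep cs"
proof -
  have "wide_over L \<M> I (M \<union> set (take i cs)) (cs ! i) \<longleftrightarrow> wide (M \<union> set (take i cs)) (cs ! i)"
    if "i < length cs" for i
    using that assms MU by (intro wide_iff) (auto dest: in_set_takeD)
  then show ?thesis by (simp add: independent_def windep_def)
qed

lemma rev_pairs:
  "rev (concat (map (\<lambda>i. [\<alpha> i, \<beta> i]) [1..<Suc k])) = concat (map (\<lambda>i. [\<beta> (Suc k - i), \<alpha> (Suc k - i)]) [1..<Suc k])"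
proof -
  have "rev [1..<Suc k] = map (\<lambda>i. Suc k - i) [1..<Suc k]"
    by (intro nth_equalityI) (auto simp: rev_nth simp del: upt_Suc)
  then show ?thesis by (simp add: rev_concat rev_map comp_def del: upt_Suc)
qed

theorem theorem6p9:
  fixes L :: "('f, 'r) language"
    and \<M> :: "('f, 'r, 'a) struct"
    and \<kappa> :: "'k rel"
    and G :: "('a, 'm) monoid_scheme" (structure)
    and mul :: 'f
    and I :: "('f, 'r, 'a) fm set"
    and A M :: "'a set"
  assumes "monster_model L \<M> \<kappa>"
    and "group G" and "carrier G = univ \<M>"
    and "mul \<in> funs L" and "farity L mul = 2"
    and "\<forall>a \<in> carrier G. \<forall>b \<in> carrier G. a \<otimes> b = fun_of \<M> mul [a, b]"
    and "formula_ideal L \<M> I" and "invariant_ideal L \<M> I" and "S1_ideal L \<M> I"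
    and "translation_invariant L \<M> G I"
    and "\<not> in_ideal \<M> I (carrier G)"
    and "definable L \<M> {} A"
    and "I_stable L \<M> I (\<lambda>x y. y \<otimes> x \<in> A)"
    and "elementary_substructure L M \<M>"
  shows "\<exists>H B. definable L \<M> M H \<and> H \<lhd> G \<and> finite (rcosets H) \<and>
           (\<exists>\<C>. finite \<C> \<and> \<C> \<subseteq> rcosets H \<and> B = \<Union>\<C>) \<and>
           in_ideal \<M> I ((A - B) \<union> (B - A))"
proof -
  interpret s1_ideal L \<M> \<kappa> I
    using assms by unfold_locales auto
  obtain M0 where M0: "M0 \<subseteq> M" "elementary_substructure L M0 \<M>" "small M0"
    using small_elementary_substructure[OF assms(14)] by blast
  interpret group G by fact
  interpret ideal_group L \<M> \<kappa> I M0 G mul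
    using assms M0 by unfold_locales auto
  define R where "R = (\<lambda>y x. y \<otimes> x \<in> A)"
  obtain k where k: "\<not> (\<exists>M a b. elementary_substructure L M \<M> \<and>
     (\<forall>i \<in> {1..k}. a i \<in> U \<and> b i \<in> U) \<and>
     (let cs = concat (map (\<lambda>i. [a i, b i]) [1..<Suc k])
      in independent L \<M> I M cs \<or> independent L \<M> I M (rev cs)) \<and>
     (\<forall>i \<in> {1..k}. \<forall>j \<in> {1..k}. b j \<otimes> a i \<in> A \<longleftrightarrow> i \<le> j))"
    using assms(13) unfolding I_stable_def by blast
  have k': False if "elementary_substructure L M' \<M>" "\<forall>i \<in> {1..k}. a i \<in> U \<and> b i \<in> U"
    "cs = concat (map (\<lambda>i. [a i, b i]) [1..<Suc k])" "independent L \<M> I M' cs \<or> independent L \<M> I M' (rev cs)"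
    "\<forall>i \<in> {1..k}. \<forall>j \<in> {1..k}. b j \<otimes> a i \<in> A \<longleftrightarrow> i \<le> j" for M' a b cs
    using k that unfolding Let_def by blast
  have inU: "\<alpha> i \<in> U" "\<beta> i \<in> U" if "windep (concat (map (\<lambda>i. [\<alpha> i, \<beta> i]) [1..<Suc k]))" "i \<in> {1..k}" for \<alpha> \<beta> i
  proof -
    have "i \<in> set [1..<Suc k]" using that(2) by auto
    then have "\<alpha> i \<in> set (concat (map (\<lambda>i. [\<alpha> i, \<beta> i]) [1..<Suc k]))"
      "\<beta> i \<in> set (concat (map (\<lambda>i. [\<alpha> i, \<beta> i]) [1..<Suc k]))"
      by (auto simp del: upt_Suc set_upt)
    then show "\<alpha> i \<in> U" "\<beta> i \<in> U" using windep_in[OF that(1)] by blast+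
  qed
  have 1: "\<not> chain R k \<alpha> \<beta>" for \<alpha> \<beta>
  proof
    assume ch: "chain R k \<alpha> \<beta>"
    let ?cs = "concat (map (\<lambda>i. [\<alpha> i, \<beta> i]) [1..<Suc k])"
    have w: "windep ?cs" using ch by (simp add: chain_def)
    then have "independent L \<M> I M0 ?cs" using independent_iff[OF windep_in[OF w]] by simp
    moreover have "\<forall>i\<in>{1..k}. \<forall>j\<in>{1..k}. \<beta> j \<otimes> \<alpha> i \<in> A \<longleftrightarrow> i \<le> j"
      using ch by (simp add: chain_def R_def)
    moreover have "\<forall>i\<in>{1..k}. \<alpha> i \<in> U \<and> \<beta> i \<in> U" using inU[OF w] by blast
    ultimately show False using k'[OF M0(2), of \<alpha> \<beta> ?cs] by blast
  qed
  have 2: "\<not> chain (\<lambda>y x. R x y) k \<alpha> \<beta>" for \<alpha> \<beta>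
  proof
    assume ch: "chain (\<lambda>y x. R x y) k \<alpha> \<beta>"
    \<comment> \<open>The ladder for exchanged arguments is relabelled backwards, index
      \<open>i\<close> becoming \<open>k + 1 - i\<close>, with the roles of \<open>\<alpha>\<close>
      and \<open>\<beta>\<close> swapped. The independent listing
      \<open>\<alpha> 1, \<beta> 1, ...\<close> is then the reverse of the listing of the new
      ladder.\<close>
    let ?a = "\<lambda>i. \<beta> (Suc k - i)" and ?b = "\<lambda>i. \<alpha> (Suc k - i)"
    let ?cs = "concat (map (\<lambda>i. [\<alpha> i, \<beta> i]) [1..<Suc k])"
    have w: "windep ?cs" using ch by (simp add: chain_def)
    then have "independent L \<M> I M0 ?cs" using independent_iff[OF windep_in[OF w]] by simp
    moreover have "rev (concat (map (\<lambda>i. [?a i, ?b i]) [1..<Suc k])) = ?cs"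
      unfolding rev_pairs[of \<alpha> \<beta> k, symmetric] by simp
    moreover have "?b j \<otimes> ?a i \<in> A \<longleftrightarrow> i \<le> j" if "i \<in> {1..k}" "j \<in> {1..k}" for i j
    proof -
      have "Suc k - j \<in> {1..k}" "Suc k - i \<in> {1..k}" using that by auto
      then have "?b j \<otimes> ?a i \<in> A \<longleftrightarrow> Suc k - j \<le> Suc k - i"
        using ch unfolding chain_def R_def by blast
      then show ?thesis using that by auto
    qed
    moreover have "\<forall>i\<in>{1..k}. ?a i \<in> U \<and> ?b i \<in> U"
    proof
      fix i assume "i \<in> {1..k}"
      then have "Suc k - i \<in> {1..k}" by auto
      then show "?a i \<in> U \<and> ?b i \<in> U" using inU[OF w] by blast
    qed
    ultimately show False using k'[OF M0(2), of ?a ?b "concat (map (\<lambda>i. [?a i, ?b i]) [1..<Suc k])"] by simp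
  qed
  have R: "dfn M0 (\<lambda>v. R (v 0) (v 1))"
    unfolding R_def using definable_mono[OF assms(12), of M0] MU
    by (intro definable_tm[of M0 A] dtm_mult dtm_var) auto
  interpret stable_group L \<M> \<kappa> I M0 R k G mul A
    using R 1 2 assms(3,11,12) by unfold_locales (auto simp: R_def)
  show ?thesis using union_of_cosets definable_mono[OF _ M0(1)] by blast
qed

end
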